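(* Consider the system described in the context with random network topologies satisfying (A1') and (A2), and assume that the noise satisfies (A3). Then from any initial state $x(1)\in\mathbb{R}^n$ the system will reach unbiased mean square average-consensus with the convergence rate $E[V(x(t))]=O\big(\frac{1}{t^{1-2\mu}}\big)$ if one selects $a(t)=\frac{\alpha}{t^{1-\mu}+t^*}$, where $\mu$ is the constant appearing in (A1') and $\alpha$ and $t^*$ are two constants satisfying $$\alpha\ge\frac{32n(n-1)^4c}{(2n-3)^2}\quad\text{and}\quad t^*\ge\lfloor2\alpha(n-1)a_{\max}\rfloor ,$$ with $c\ge1$ a constant.
   Context: System. There are $n$ agents with scalar states $x_i(t)$, $t=1,2,\dots$, and $x(t)=(x_1(t),\dots,x_n(t))'$. At each time $t$ the topology is a (random) weighted digraph $\mathcal{G}(t)=(\mathcal{V},\mathcal{E}(t),\mathcal{A}(t))$ on $\mathcal{V}=\{1,\dots,n\}$; $\mathcal{N}_i(t)=\{j:(j,i)\in\mathcal{E}(t)\}$ is the neighbor set of $i$, and the edge $(j,i)$ has weight $a_{ij}^t$ (the $(i,j)$ entry of $\mathcal{A}(t)$). It is assumed throughout that $1\le a_{ij}^t\le a_{\max}$ for all $t\ge1$, $1\le i\le n$, $j\in\mathcal{N}_i(t)$, where $a_{\max}$ is a constant. The dynamics is $$x_i(t+1)=x_i(t)+a(t)\sum_{j\in\mathcal{N}_i(t)}a_{ij}^t\,[x_j(t)-x_i(t)+w_{ji}(t)],\qquad t\ge1,\ 1\le i\le n,$$ where $a(t)\ge0$ is the common gain (an open-loop control) and $w_{ji}(t)$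 is the random noise of agent $i$ receiving information from agent $j$ at time $t$. For $x\in\mathbb{R}^n$, $x_{\rm ave}=\frac1n\sum_{i=1}^n x_i$ and $V(x)=\sum_{i=1}^n(x_i-x_{\rm ave})^2$. Mean square consensus: there is a random variable $x^*$ with $|E(x^* )|<\infty$, $\mathrm{Var}(x^* )<\infty$ and $\lim_{t\to\infty}E\|x(t)-x^*\mathbf{1}\|^2=0$ ($\mathbf 1$ is the all-ones vector, $\|\cdot\|$ the Euclidean norm). Unbiased mean square average-consensus: in addition $E(x^* )=\frac1n\sum_{i=1}^n x_i(1)$. (A1'): there exist three constants $K\in\mathbb{Z}^+$, $\mu\in(0,1/2)$ and $p>0$ such that for any $t\ge1$, $$P\Big(\bigcup_{t'=t}^{t+K-1}\mathcal{G}(t')\text{ is strongly connected}\ \Big|\ \forall\,\mathcal{G}(i),\,1\le i<t\Big)\ge p\,t^{-\mu}\log t ,$$ i.e. the bound holds conditionally on any given past topologies $\mathcal{G}(i)$, $1\le i<t$. (A2): the topology $\mathcal{G}(t)$ is balanced for all $t\ge1$, i.e. for every node $i$ the in-degree $\sum_{j\in\mathcal{N}_i(t)}a_{ij}^t$ equals the out-degree $\sum_{j:\,i\in\mathcal{N}_j(t)}a_{ji}^t$. (A3): for any topology sequence $\{\mathcal{G}(t)\}_{t\ge1}$, the noise sequence $\{w_{ji}(t)\}_{t\ge1,\,i=1,\dots,n,\,j\in\mathcal{N}_i(t)}$ is a zero-mean $\widetilde\rho$-mixing sequence satisfying $\sup_{i,j,t}\mathrm{Var}(w_{ji}(t))<\infty$.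 Here, for a sequence of random variables $\{X_i\}_{i\ge1}$ and $S,T\subset\mathbb{N}$, put $\mathcal{F}_S=\sigma(X_i,i\in S)$, $\rho(\mathcal{F}_S,\mathcal{F}_T)=\sup\{\mathrm{Corr}(X,Y):X\in L_2(\mathcal{F}_S),Y\in L_2(\mathcal{F}_T)\}$ (Corr is the linear correlation coefficient), and, for integers $m\ge0$, $\widetilde\rho(m)=\sup\{\rho(\mathcal{F}_S,\mathcal{F}_T): S,T\subset\mathbb{N}\text{ finite},\ \min_{i\in S,j\in T}|i-j|\ge m\}$; the sequence is $\widetilde\rho$-mixing if $\widetilde\rho(m)<1$ for some integer $m>0$. For positive sequences, $g_1(t)=O(g_2(t))$ means there are $c_0>0$, $t_0>0$ with $g_1(t)\le c_0g_2(t)$ for all $t\ge t_0$.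
   Formalization: In (A3) the conditions are taken conditionally on the topology sequence, with the variance bound, the integer m and the bound below 1 on the mixing coefficient the same for all topology sequences; if they may depend on the sequence the claim fails. For noise independent of the topologies this is automatic. *)

theory Defs
  imports "HOL-Probability.Probability"
begin

section \<open>Random weighted digraphs\<close>

text \<open>
  The agents are the elements of a finite linearly ordered type, so n is the cardinality of that
  type.  A weighted digraph is a pair (E, A): the edge (j, i) in E carries the weight A $ i $ j.
  Entries of A off the edge set are never looked at.
\<close>

type_synonym 'n wdigraph = "('n \<times> 'n) set \<times> (real ^ 'n ^ 'n)"

definition neighbors :: "'n wdigraph \<Rightarrow> 'n \<Rightarrow> 'n set" where
  "neighbors g i = {j. (j, i) \<in> fst g}"

definition weight :: "('n::finite) wdigraph \<Rightarrow> 'n \<Rightarrow> 'n \<Rightarrow> real" where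
  "weight g i j = snd g $ i $ j"

definition weights_within :: "real \<Rightarrow> ('n::finite) wdigraph \<Rightarrow> bool" where
  "weights_within amax g \<longleftrightarrow> (\<forall>i. \<forall>j\<in>neighbors g i. 1 \<le> weight g i j \<and> weight g i j \<le> amax)"

definition balanced :: "('n::finite) wdigraph \<Rightarrow> bool" where
  "balanced g \<longleftrightarrow>
     (\<forall>i. (\<Sum>j\<in>neighbors g i. weight g i j) = (\<Sum>j\<in>{j. i \<in> neighbors g j}. weight g j i))"

definition strongly_connected_edges :: "('n \<times> 'n) set \<Rightarrow> bool" where
  "strongly_connected_edges E \<longleftrightarrow> (\<forall>u v. (u, v) \<in> E\<^sup>*)"

definition wdigraph_space :: "('n::finite) wdigraph measure" where
  "wdigraph_space = count_space UNIV \<Otimes>\<^sub>M borel"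


section \<open>Generated sigma-algebras and conditional laws\<close>

text \<open>The sigma-algebra on the space of M generated by the B-valued maps X i with i in S.\<close>

definition generated_by ::
  "'a measure \<Rightarrow> 'b measure \<Rightarrow> ('i \<Rightarrow> 'a \<Rightarrow> 'b) \<Rightarrow> 'i set \<Rightarrow> 'a measure" where
  "generated_by M B X S = vimage_algebra (space M) (\<lambda>\<omega>. \<lambda>i\<in>S. X i \<omega>) (Pi\<^sub>M S (\<lambda>_. B))"

text \<open>The kernel \<open>\<kappa>\<close> is a regular conditional distribution of Z (in N) given Y (in T).\<close>

definition regular_cond_distr ::
  "'a measure \<Rightarrow> 'b measure \<Rightarrow> ('a \<Rightarrow> 'b) \<Rightarrow> 'c measure \<Rightarrow> ('a \<Rightarrow> 'c) \<Rightarrow> ('b \<Rightarrow> 'c measure) \<Rightarrow> bool"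
where
  "regular_cond_distr M T Y N Z \<kappa> \<longleftrightarrow>
     Y \<in> M \<rightarrow>\<^sub>M T \<and> Z \<in> M \<rightarrow>\<^sub>M N \<and> \<kappa> \<in> T \<rightarrow>\<^sub>M prob_algebra N \<and>
     (\<forall>A\<in>sets T. \<forall>B\<in>sets N.
        emeasure M {\<omega> \<in> space M. Y \<omega> \<in> A \<and> Z \<omega> \<in> B} =
        (\<integral>\<^sup>+\<omega>. emeasure (\<kappa> (Y \<omega>)) B * indicator A (Y \<omega>) \<partial>M))"


section \<open>The mixing coefficient\<close>

text \<open>
  If one of the variances vanishes, the quotient is 0 (division by zero); a constant is thus
  uncorrelated with everything.
\<close>

definition corr :: "'a measure \<Rightarrow> ('a \<Rightarrow> real) \<Rightarrow> ('a \<Rightarrow> real) \<Rightarrow> real" where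
  "corr N X Y =
     (\<integral>\<omega>. (X \<omega> - (\<integral>\<omega>'. X \<omega>' \<partial>N)) * (Y \<omega> - (\<integral>\<omega>'. Y \<omega>' \<partial>N)) \<partial>N) /
     sqrt (prob_space.variance N X * prob_space.variance N Y)"

definition L2 :: "'a measure \<Rightarrow> 'a measure \<Rightarrow> ('a \<Rightarrow> real) set" where
  "L2 N F = {X. X \<in> borel_measurable F \<and> integrable N (\<lambda>\<omega>. (X \<omega>)\<^sup>2)}"

definition rho :: "'a measure \<Rightarrow> 'a measure \<Rightarrow> 'a measure \<Rightarrow> real" where
  "rho N F H = Sup {corr N X Y | X Y. X \<in> L2 N F \<and> Y \<in> L2 N H}"

text \<open>
  The sequence consists of the random variables X i with i in I, listed so that X i stands at
  place \<open>pos i\<close>; a finite sequence is allowed.  An empty S or T satisfies the distance condition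
  vacuously and contributes the value 0.
\<close>

definition rho_tilde ::
  "'a measure \<Rightarrow> 'i set \<Rightarrow> ('i \<Rightarrow> nat) \<Rightarrow> ('i \<Rightarrow> 'a \<Rightarrow> real) \<Rightarrow> nat \<Rightarrow> real" where
  "rho_tilde N I pos X m =
     Sup {rho N (generated_by N borel X S) (generated_by N borel X T) | S T.
            finite S \<and> finite T \<and> S \<subseteq> I \<and> T \<subseteq> I \<and>
            (\<forall>i\<in>S. \<forall>j\<in>T. int m \<le> \<bar>int (pos i) - int (pos j)\<bar>)}"


section \<open>The noise sequence of a given topology sequence\<close>

text \<open>
  The triple (t, j, i) stands for the noise in the signal that i receives from j at time t.
  For a topology sequence g, the noise sequence runs through the active triples in
  lexicographic order (by t, then the receiver i, then the sender j), and \<open>noise_pos g e\<close> is the place of e in it (starting with 1).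
\<close>

definition noise_index :: "(nat \<times> 'n \<times> 'n) set" where
  "noise_index = {(t, _, _). 1 \<le> t}"

definition active :: "(nat \<Rightarrow> 'n wdigraph) \<Rightarrow> (nat \<times> 'n \<times> 'n) set" where
  "active g = {(t, j, i). 1 \<le> t \<and> j \<in> neighbors (g t) i}"

fun lex_le :: "nat \<times> 'n \<times> 'n \<Rightarrow> nat \<times> 'n \<times> ('n::linorder) \<Rightarrow> bool" where
  "lex_le (t, j, i) (t', j', i') \<longleftrightarrow>
     t < t' \<or> t = t' \<and> (i < i' \<or> i = i' \<and> j \<le> j')"

definition noise_pos :: "(nat \<Rightarrow> ('n::linorder) wdigraph) \<Rightarrow> nat \<times> 'n \<times> 'n \<Rightarrow> nat" where
  "noise_pos g e = card {e' \<in> active g. lex_le e' e}"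

definition topology_seq_space :: "(nat \<Rightarrow> ('n::finite) wdigraph) measure" where
  "topology_seq_space = Pi\<^sub>M {1..} (\<lambda>_. wdigraph_space)"

definition noise_space :: "(nat \<times> 'n \<times> 'n \<Rightarrow> real) measure" where
  "noise_space = Pi\<^sub>M noise_index (\<lambda>_. borel)"


section \<open>The assumptions on topologies and noise\<close>

definition cond_A1' ::
  "'a measure \<Rightarrow> (nat \<Rightarrow> 'a \<Rightarrow> ('n::finite) wdigraph) \<Rightarrow> nat \<Rightarrow> real \<Rightarrow> real \<Rightarrow> bool" where
  "cond_A1' M G K \<mu> p \<longleftrightarrow>
     1 \<le> K \<and> 0 < \<mu> \<and> \<mu> < 1/2 \<and> 0 < p \<and>
     (\<forall>t\<ge>1. AE \<omega> in M.
        real_cond_exp M (generated_by M wdigraph_space G {1..<t})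
          (indicator {\<omega>' \<in> space M. strongly_connected_edges (\<Union>t'\<in>{t..t+K-1}. fst (G t' \<omega>'))}) \<omega>
        \<ge> p * real t powr (-\<mu>) * ln (real t))"

definition cond_A2 :: "'a measure \<Rightarrow> (nat \<Rightarrow> 'a \<Rightarrow> ('n::finite) wdigraph) \<Rightarrow> bool" where
  "cond_A2 M G \<longleftrightarrow> (\<forall>\<omega>\<in>space M. \<forall>t\<ge>1. balanced (G t \<omega>))"

text \<open>
  "For any topology sequence" is read as: under the conditional law \<open>\<kappa> g\<close> of the noise given that
  the topology sequence is g, for every g.  The variance bound v and the mixing data m, r do not
  depend on g.  For noise whose law does not depend on the topologies this uniformity is no extra
  demand: the complete digraph activates all triples, and passing to a subsequence increases
  neither the variances nor the mixing coefficients.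
\<close>

definition cond_A3 ::
  "'a measure \<Rightarrow> (nat \<Rightarrow> 'a \<Rightarrow> ('n::{finite,linorder}) wdigraph) \<Rightarrow>
   (nat \<Rightarrow> 'n \<Rightarrow> 'n \<Rightarrow> 'a \<Rightarrow> real) \<Rightarrow> bool" where
  "cond_A3 M G w \<longleftrightarrow>
     (\<exists>\<kappa>. regular_cond_distr M
            topology_seq_space (\<lambda>\<omega>. \<lambda>t\<in>{1..}. G t \<omega>)
            noise_space (\<lambda>\<omega>. \<lambda>(t, j, i)\<in>noise_index. w t j i \<omega>) \<kappa> \<and>
        (\<exists>v. \<exists>m>0. \<exists>r<1. \<forall>g\<in>space topology_seq_space.
           (\<forall>e\<in>active g.
              integrable (\<kappa> g) (\<lambda>z. (z e)\<^sup>2) \<and>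
              prob_space.expectation (\<kappa> g) (\<lambda>z. z e) = 0 \<and>
              prob_space.variance (\<kappa> g) (\<lambda>z. z e) \<le> v) \<and>
           rho_tilde (\<kappa> g) (active g) (noise_pos g) (\<lambda>e z. z e) m \<le> r))"


section \<open>Dynamics and consensus\<close>

definition follows_dynamics ::
  "'a measure \<Rightarrow> (nat \<Rightarrow> 'a \<Rightarrow> ('n::finite) wdigraph) \<Rightarrow> (nat \<Rightarrow> 'n \<Rightarrow> 'n \<Rightarrow> 'a \<Rightarrow> real) \<Rightarrow>
   (nat \<Rightarrow> real) \<Rightarrow> (nat \<Rightarrow> 'a \<Rightarrow> real ^ 'n) \<Rightarrow> bool" where
  "follows_dynamics M G w a x \<longleftrightarrow>
     (\<forall>\<omega>\<in>space M. \<forall>t\<ge>1. \<forall>i.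
        x (t + 1) \<omega> $ i = x t \<omega> $ i +
          a t * (\<Sum>j\<in>neighbors (G t \<omega>) i.
                   weight (G t \<omega>) i j * (x t \<omega> $ j - x t \<omega> $ i + w t j i \<omega>)))"

definition ave :: "real ^ ('n::finite) \<Rightarrow> real" where
  "ave y = (1 / real CARD('n)) * (\<Sum>i\<in>UNIV. y $ i)"

definition V :: "real ^ ('n::finite) \<Rightarrow> real" where
  "V y = (\<Sum>i\<in>UNIV. (y $ i - ave y)\<^sup>2)"

definition ms_consensus_to ::
  "'a measure \<Rightarrow> (nat \<Rightarrow> 'a \<Rightarrow> real ^ ('n::finite)) \<Rightarrow> ('a \<Rightarrow> real) \<Rightarrow> bool" where
  "ms_consensus_to M x xs \<longleftrightarrow>
     xs \<in> borel_measurable M \<and> integrable M xs \<and> integrable M (\<lambda>\<omega>. (xs \<omega>)\<^sup>2) \<and>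
     (\<forall>t\<ge>1. x t \<in> borel_measurable M) \<and>
     (\<lambda>t. \<integral>\<^sup>+\<omega>. ennreal ((norm (x t \<omega> - (\<chi> i. xs \<omega>)))\<^sup>2) \<partial>M) \<longlonglongrightarrow> 0"

definition unbiased_ms_average_consensus ::
  "'a measure \<Rightarrow> (nat \<Rightarrow> 'a \<Rightarrow> real ^ ('n::finite)) \<Rightarrow> real ^ 'n \<Rightarrow> bool" where
  "unbiased_ms_average_consensus M x x1 \<longleftrightarrow>
     (\<exists>xs. ms_consensus_to M x xs \<and> prob_space.expectation M xs = ave x1)"

end

theory Submission imports Defs begin

text \<open>
  Once the topologies are fixed, the state is an affine function of the noise.  The idea is to treat
  the two sources of randomness separately: the topologies through the noise-free system, whose
  disagreement \<open>V\<close> contracts in expectation, and the noise through its conditional law given the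
  topologies, under which the noises act almost like uncorrelated random variables.

  For the noise-free system over balanced digraphs with a small gain \<open>a\<close>, every step lowers \<open>V\<close> by at
  least \<open>a / 2\<close> times the edge energy, the sum of the terms \<open>a\<^sub>i\<^sub>j (y\<^sub>j - y\<^sub>i)\<^sup>2\<close>.  Over \<open>K\<close> steps whose
  union is strongly connected this is a contraction by \<open>1 - \<eta> a\<close> with a constant \<open>\<eta>\<close>
  (\<open>V_flow_contraction\<close>).  By (A1') such a block occurs with conditional probability of
  order at least \<open>t powr (- \<mu>) * ln t\<close>, and the gain has order \<open>t powr (\<mu> - 1)\<close>, so a block at time \<open>t\<close>
  contracts the expectation of \<open>V\<close> by \<open>1 - const * ln t / t\<close>.  The logarithm eventually beats every constant,
  and the expectation of \<open>V\<close> decays at least like \<open>s / t\<close> from time \<open>s\<close> to time \<open>t\<close>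
  (\<open>expectation_V_flow_decay\<close>).

  For the noise, mixing implies that the second moment of a weighted sum is at most a constant times
  the sum of the second moments of the terms.  This follows by averaging over random signs
  (\<open>second_moment_sum_le\<close>, \<open>rho_mixing_second_moment\<close>).  The conditional law of
  the noise lets the coefficients depend on the topologies (\<open>noise_second_moment\<close>).  By variation
  of constants the noise received at time \<open>s\<close> has weight of order \<open>a s\<close> and is then carried along by the
  noise-free system, so that in total
  \<open>E V(x(t)) = O (1 / t + (\<Sum>s<t. s powr (2 * \<mu> - 2) * (s / t))) = O (t powr (2 * \<mu> - 1))\<close>.

  Balanced topologies preserve the average of the states, which therefore moves only by weighted
  sums of the noise.  As \<open>2 * \<mu> - 2 < - 1\<close>, the squared gains are summable, so the averages form a Cauchy
  sequence in \<open>L\<^sup>2\<close> with constant mean (\<open>average_limit\<close>).  Their limit is the consensus value.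
\<close>


section \<open>Second moments of mixing sums\<close>

text \<open>
  This is the average over all sign patterns: the cross terms cancel, so the mean square of the
  randomly signed sum is the sum of the squares.
\<close>

lemma sum_signed_squares:
  fixes y :: "'i \<Rightarrow> real"
  assumes "finite J"
  shows "(\<Sum>S\<in>Pow J. (sum y S - sum y (J - S))\<^sup>2) = 2 ^ card J * (\<Sum>i\<in>J. (y i)\<^sup>2)"
  using assms
proof (induction J rule: finite_induct)
  case empty
  then show ?case by simp
next
  case (insert k F)
  define d where "d S = sum y S - sum y (F - S)" for S
  have inj: "inj_on (insert k) (Pow F)"
    using insert.hyps by (auto simp: inj_on_def)
  have disj: "Pow F \<inter> insert k ` Pow F = {}"
    using insert.hyps by auto
  have outside: "sum y S - sum y (insert k F - S) = d S - y k" if "S \<in> Pow F" for S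
  proof -
    have "insert k F - S = insert k (F - S)" using that insert.hyps by auto
    then show ?thesis using insert.hyps by (simp add: d_def)
  qed
  have inside: "sum y (insert k S) - sum y (insert k F - insert k S) = d S + y k" if "S \<in> Pow F" for S
  proof -
    have "insert k F - insert k S = F - S" "k \<notin> S" "finite S"
      using that insert.hyps by (auto intro: finite_subset)
    then show ?thesis by (simp add: d_def)
  qed
  have "(\<Sum>S\<in>Pow (insert k F). (sum y S - sum y (insert k F - S))\<^sup>2)
      = (\<Sum>S\<in>Pow F. (d S - y k)\<^sup>2) + (\<Sum>S\<in>Pow F. (d S + y k)\<^sup>2)"
    unfolding Pow_insert using insert.hyps disj outside inside
    by (subst sum.union_disjoint) (auto simp: sum.reindex[OF inj])
  also have "\<dots> = (\<Sum>S\<in>Pow F. 2 * (d S)\<^sup>2 + 2 * (y k)\<^sup>2)"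
    by (subst sum.distrib[symmetric], rule sum.cong) (auto simp: power2_eq_square algebra_simps)
  also have "\<dots> = 2 * (2 ^ card F * (\<Sum>i\<in>F. (y i)\<^sup>2)) + 2 ^ card F * (2 * (y k)\<^sup>2)"
    using insert.IH insert.hyps by (simp add: sum.distrib sum_distrib_left[symmetric] d_def card_Pow)
  finally show ?case using insert.hyps by (simp add: algebra_simps)
qed

lemma integrable_mult_of_squares:
  fixes f g :: "'a \<Rightarrow> real"
  assumes [measurable]: "f \<in> borel_measurable N" "g \<in> borel_measurable N"
    and "integrable N (\<lambda>x. (f x)\<^sup>2)" "integrable N (\<lambda>x. (g x)\<^sup>2)"
  shows "integrable N (\<lambda>x. f x * g x)"
proof (rule Bochner_Integration.integrable_bound)
  show "integrable N (\<lambda>x. (f x)\<^sup>2 + (g x)\<^sup>2)" using assms by simp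
  have "\<bar>a * b\<bar> \<le> a\<^sup>2 + b\<^sup>2" for a b :: real
  proof -
    have "2 * (\<bar>a\<bar> * \<bar>b\<bar>) \<le> a\<^sup>2 + b\<^sup>2"
      using sum_squares_bound[of "\<bar>a\<bar>" "\<bar>b\<bar>"] by (simp add: mult.assoc)
    moreover have "0 \<le> \<bar>a\<bar> * \<bar>b\<bar>" by simp
    ultimately show ?thesis unfolding abs_mult by linarith
  qed
  then show "AE x in N. norm (f x * g x) \<le> norm ((f x)\<^sup>2 + (g x)\<^sup>2)" by simp
qed measurable

lemma integrable_add_square:
  fixes f g :: "'a \<Rightarrow> real"
  assumes [measurable]: "f \<in> borel_measurable N" "g \<in> borel_measurable N"
    and "integrable N (\<lambda>x. (f x)\<^sup>2)" "integrable N (\<lambda>x. (g x)\<^sup>2)"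
  shows "integrable N (\<lambda>x. (f x + g x)\<^sup>2)"
  using assms integrable_mult_of_squares[OF assms] by (simp add: power2_sum mult.assoc)

lemma integrable_sum_square:
  fixes Y :: "'i \<Rightarrow> 'a \<Rightarrow> real"
  assumes "\<And>i. i \<in> J \<Longrightarrow> Y i \<in> borel_measurable N"
    and "\<And>i. i \<in> J \<Longrightarrow> integrable N (\<lambda>x. (Y i x)\<^sup>2)"
  shows "integrable N (\<lambda>x. (\<Sum>i\<in>J. Y i x)\<^sup>2)"
  using assms
proof (induction J rule: infinite_finite_induct)
  case (insert k F)
  have "(\<lambda>x. \<Sum>i\<in>F. Y i x) \<in> borel_measurable N"
    using insert.prems(1) by (intro borel_measurable_sum) blast
  with insert have "integrable N (\<lambda>x. (Y k x + (\<Sum>i\<in>F. Y i x))\<^sup>2)"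
    by (intro integrable_add_square) blast+
  then show ?case using insert.hyps by simp
qed simp_all

text \<open>
  Cauchy--Schwarz, from the nonnegativity of the integrals of \<open>(s * f - u * g)\<^sup>2\<close>.
\<close>

lemma abs_integral_mult_le:
  fixes f g :: "'a \<Rightarrow> real"
  assumes [measurable]: "f \<in> borel_measurable N" "g \<in> borel_measurable N"
    and f: "integrable N (\<lambda>x. (f x)\<^sup>2)" and g: "integrable N (\<lambda>x. (g x)\<^sup>2)"
  shows "\<bar>\<integral>x. f x * g x \<partial>N\<bar> \<le> sqrt ((\<integral>x. (f x)\<^sup>2 \<partial>N) * (\<integral>x. (g x)\<^sup>2 \<partial>N))"
proof -
  note fg = integrable_mult_of_squares[OF assms]
  define A B C where "A = (\<integral>x. (f x)\<^sup>2 \<partial>N)" and "B = (\<integral>x. (g x)\<^sup>2 \<partial>N)" and "C = (\<integral>x. f x * g x \<partial>N)"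
  have nn: "0 \<le> A" "0 \<le> B" by (simp_all add: A_def B_def)
  have q: "0 \<le> s\<^sup>2 * A - 2 * (s * u * C) + u\<^sup>2 * B" for s u :: real
  proof -
    have "0 \<le> (\<integral>x. (s * f x - u * g x)\<^sup>2 \<partial>N)" by simp
    also have "\<dots> = (\<integral>x. s\<^sup>2 * (f x)\<^sup>2 - 2 * s * u * (f x * g x) + u\<^sup>2 * (g x)\<^sup>2 \<partial>N)"
      by (simp add: power2_eq_square algebra_simps)
    also have "\<dots> = s\<^sup>2 * A - 2 * (s * u * C) + u\<^sup>2 * B"
      using f g fg by (simp add: A_def B_def C_def)
    finally show ?thesis .
  qed
  have "C\<^sup>2 \<le> A * B"
  proof (cases "B = 0")
    case True
    have "C = 0"
    proof (rule ccontr)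
      assume "C \<noteq> 0"
      \<comment> \<open>For this witness the quadratic expression has the value \<open>- 1\<close>.\<close>
      then show False
        using q[of 1 "(A + 1) / (2 * C)"] nn True by (simp add: field_simps)
    qed
    then show ?thesis using nn by simp
  next
    case False
    then have "B > 0" using nn by simp
    have "B * C\<^sup>2 \<le> B * (A * B)" using q[of B C] by (simp add: power2_eq_square algebra_simps)
    then show ?thesis using \<open>B > 0\<close> by simp
  qed
  then show ?thesis
    unfolding A_def[symmetric] B_def[symmetric] C_def[symmetric]
    by (metis real_sqrt_abs real_sqrt_le_iff)
qed

text \<open>
  Let \<open>A\<close> and \<open>B\<close> be the sums over \<open>S\<close> and over its complement.  Since their correlation is at most
  \<open>r\<close> in absolute value, \<open>E (A + B)\<^sup>2 \<le> (1 + r) (E A\<^sup>2 + E B\<^sup>2)\<close> and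
  \<open>E (A - B)\<^sup>2 \<ge> (1 - r) (E A\<^sup>2 + E B\<^sup>2)\<close>.  So flipping the signs on any set of summands changes the second
  moment by a factor of at most \<open>(1 + r) / (1 - r)\<close>, and the average over all sign flips is the sum
  of the second moments.
\<close>

lemma second_moment_sum_le:
  fixes Y :: "'i \<Rightarrow> 'a \<Rightarrow> real"
  assumes fin: "finite J" and r: "0 \<le> r" "r < 1"
    and meas [measurable]: "\<And>i. i \<in> J \<Longrightarrow> Y i \<in> borel_measurable N"
    and sq: "\<And>i. i \<in> J \<Longrightarrow> integrable N (\<lambda>x. (Y i x)\<^sup>2)"
    and decorrelated: "\<And>S T. S \<subseteq> J \<Longrightarrow> T \<subseteq> J \<Longrightarrow> S \<inter> T = {} \<Longrightarrow>
       \<bar>\<integral>x. (\<Sum>i\<in>S. Y i x) * (\<Sum>i\<in>T. Y i x) \<partial>N\<bar>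
         \<le> r * sqrt ((\<integral>x. (\<Sum>i\<in>S. Y i x)\<^sup>2 \<partial>N) * (\<integral>x. (\<Sum>i\<in>T. Y i x)\<^sup>2 \<partial>N))"
  shows "(\<integral>x. (\<Sum>i\<in>J. Y i x)\<^sup>2 \<partial>N) \<le> (1 + r) / (1 - r) * (\<Sum>i\<in>J. \<integral>x. (Y i x)\<^sup>2 \<partial>N)"
proof -
  define A where "A S x = (\<Sum>i\<in>S. Y i x)" for S x
  define Q where "Q = (\<integral>x. (A J x)\<^sup>2 \<partial>N)"
  have Am: "A S \<in> borel_measurable N" if "S \<subseteq> J" for S
    unfolding A_def using that by (intro borel_measurable_sum meas) auto
  have Ai: "integrable N (\<lambda>x. (A S x)\<^sup>2)" if "S \<subseteq> J" for S
    unfolding A_def using that by (intro integrable_sum_square meas sq) auto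
  have split: "(1 - r) * Q \<le> (1 + r) * (\<integral>x. (A S x - A (J - S) x)\<^sup>2 \<partial>N)"
    and diff_int: "integrable N (\<lambda>x. (A S x - A (J - S) x)\<^sup>2)" if S: "S \<subseteq> J" for S
  proof -
    define T where "T = J - S"
    have T: "T \<subseteq> J" "S \<inter> T = {}" by (auto simp: T_def)
    note int = Ai[OF S] Ai[OF T(1)] integrable_mult_of_squares[OF Am[OF S] Am[OF T(1)] Ai[OF S] Ai[OF T(1)]]
    define a b k where "a = (\<integral>x. (A S x)\<^sup>2 \<partial>N)" and "b = (\<integral>x. (A T x)\<^sup>2 \<partial>N)"
      and "k = (\<integral>x. A S x * A T x \<partial>N)"
    have nn: "0 \<le> a" "0 \<le> b" by (simp_all add: a_def b_def)
    have "\<bar>k\<bar> \<le> r * sqrt (a * b)"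
      using decorrelated[OF S T] unfolding k_def a_def b_def A_def .
    also have "\<dots> \<le> r * ((a + b) / 2)"
      using r nn by (intro mult_left_mono arith_geo_mean_sqrt)
    finally have k: "2 * \<bar>k\<bar> \<le> r * (a + b)" by simp
    have "A J x = A S x + A T x" for x
      unfolding A_def T_def using S fin by (metis add.commute sum.subset_diff)
    then have "Q = (\<integral>x. (A S x)\<^sup>2 + (A T x)\<^sup>2 + 2 * (A S x * A T x) \<partial>N)"
      unfolding Q_def by (simp add: power2_sum mult.assoc)
    also have "\<dots> = a + b + 2 * k" using int by (simp add: a_def b_def k_def)
    finally have 1: "Q \<le> (1 + r) * (a + b)" using k by (simp add: algebra_simps)
    have eq: "(A S x - A T x)\<^sup>2 = (A S x)\<^sup>2 + (A T x)\<^sup>2 - 2 * (A S x * A T x)" for x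
      by (simp add: power2_diff mult.assoc)
    have "(\<integral>x. (A S x - A T x)\<^sup>2 \<partial>N) = a + b - 2 * k"
      unfolding eq using int by (simp add: a_def b_def k_def)
    then have 2: "(1 - r) * (a + b) \<le> (\<integral>x. (A S x - A T x)\<^sup>2 \<partial>N)"
      using k by (simp add: algebra_simps)
    have "(1 - r) * Q \<le> (1 - r) * ((1 + r) * (a + b))" using 1 r by (intro mult_left_mono) auto
    also have "\<dots> = (1 + r) * ((1 - r) * (a + b))" by (simp add: algebra_simps)
    also have "\<dots> \<le> (1 + r) * (\<integral>x. (A S x - A T x)\<^sup>2 \<partial>N)" using 2 r by (intro mult_left_mono) auto
    finally show "(1 - r) * Q \<le> (1 + r) * (\<integral>x. (A S x - A (J - S) x)\<^sup>2 \<partial>N)" by (simp add: T_def)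
    show "integrable N (\<lambda>x. (A S x - A (J - S) x)\<^sup>2)"
      using int unfolding T_def[symmetric] eq by simp
  qed
  have "2 ^ card J * ((1 - r) * Q) = (\<Sum>S\<in>Pow J. (1 - r) * Q)" using fin by (simp add: card_Pow)
  also have "\<dots> \<le> (\<Sum>S\<in>Pow J. (1 + r) * (\<integral>x. (A S x - A (J - S) x)\<^sup>2 \<partial>N))"
    using split by (intro sum_mono) auto
  also have "\<dots> = (1 + r) * (\<integral>x. (\<Sum>S\<in>Pow J. (A S x - A (J - S) x)\<^sup>2) \<partial>N)"
    using diff_int by (subst Bochner_Integration.integral_sum) (auto simp: sum_distrib_left)
  also have "\<dots> = (1 + r) * (\<integral>x. 2 ^ card J * (\<Sum>i\<in>J. (Y i x)\<^sup>2) \<partial>N)"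
    unfolding A_def using fin by (simp add: sum_signed_squares)
  also have "\<dots> = 2 ^ card J * ((1 + r) * (\<Sum>i\<in>J. \<integral>x. (Y i x)\<^sup>2 \<partial>N))"
    using sq by (simp add: Bochner_Integration.integral_sum)
  finally have "(1 - r) * Q \<le> (1 + r) * (\<Sum>i\<in>J. \<integral>x. (Y i x)\<^sup>2 \<partial>N)" by simp
  then have "Q \<le> (1 + r) * (\<Sum>i\<in>J. \<integral>x. (Y i x)\<^sup>2 \<partial>N) / (1 - r)"
    using r by (simp add: pos_le_divide_eq mult.commute)
  then show ?thesis unfolding Q_def A_def by simp
qed

lemma abs_corr_le_1:
  assumes "prob_space N" "X \<in> borel_measurable N" "Y \<in> borel_measurable N"
    and "integrable N (\<lambda>x. (X x)\<^sup>2)" "integrable N (\<lambda>x. (Y x)\<^sup>2)"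
  shows "\<bar>corr N X Y\<bar> \<le> 1"
proof -
  interpret prob_space N by fact
  note [measurable] = assms(2,3)
  define f where "f x = X x - expectation X" for x
  define g where "g x = Y x - expectation Y" for x
  have X: "integrable N X" "integrable N Y"
    by (auto intro: square_integrable_imp_integrable[OF assms(2,4)] square_integrable_imp_integrable[OF assms(3,5)])
  have f: "f \<in> borel_measurable N" "g \<in> borel_measurable N" by (simp_all add: f_def[abs_def] g_def[abs_def])
  have f2: "integrable N (\<lambda>x. (f x)\<^sup>2)" "integrable N (\<lambda>x. (g x)\<^sup>2)"
    unfolding f_def g_def power2_diff using assms X by simp_all
  have "\<bar>corr N X Y\<bar> = \<bar>\<integral>x. f x * g x \<partial>N\<bar> / \<bar>sqrt ((\<integral>x. (f x)\<^sup>2 \<partial>N) * (\<integral>x. (g x)\<^sup>2 \<partial>N))\<bar>"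
    unfolding corr_def f_def g_def by simp
  also have "\<dots> \<le> 1"
    using abs_integral_mult_le[OF f f2] unfolding divide_le_eq_1 by linarith
  finally show ?thesis .
qed

lemma subalgebra_generated_by:
  assumes "\<And>i. i \<in> S \<Longrightarrow> X i \<in> M \<rightarrow>\<^sub>M B"
  shows "subalgebra M (generated_by M B X S)"
proof -
  have "(\<lambda>\<omega>. \<lambda>i\<in>S. X i \<omega>) \<in> M \<rightarrow>\<^sub>M Pi\<^sub>M S (\<lambda>_. B)"
    using assms by (rule measurable_restrict)
  then have "sets (generated_by M B X S) \<subseteq> sets M"
    unfolding generated_by_def by (intro sets_image_in_sets) (auto simp: measurable_def)
  then show ?thesis by (simp add: subalgebra_def generated_by_def)
qed

lemma measurable_generated_by_imp:
  assumes "\<And>i. i \<in> S \<Longrightarrow> X i \<in> M \<rightarrow>\<^sub>M B" and "f \<in> generated_by M B X S \<rightarrow>\<^sub>M L"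
  shows "f \<in> M \<rightarrow>\<^sub>M L"
  using subalgebra_generated_by[OF assms(1)] assms(2) by (rule measurable_from_subalg)

lemma measurable_generated_by_component:
  assumes "i \<in> S" and "\<And>i. i \<in> S \<Longrightarrow> X i \<in> space M \<rightarrow> space B"
  shows "X i \<in> generated_by M B X S \<rightarrow>\<^sub>M B"
proof -
  have "(\<lambda>\<omega>. \<lambda>i\<in>S. X i \<omega>) \<in> generated_by M B X S \<rightarrow>\<^sub>M Pi\<^sub>M S (\<lambda>_. B)"
    unfolding generated_by_def using assms(2)
    by (intro measurable_vimage_algebra1) (force simp: space_PiM)
  from measurable_compose[OF this measurable_component_singleton[OF assms(1)]]
  have "(\<lambda>\<omega>. (\<lambda>i\<in>S. X i \<omega>) i) \<in> generated_by M B X S \<rightarrow>\<^sub>M B" .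
  moreover have "(\<lambda>\<omega>. (\<lambda>i\<in>S. X i \<omega>) i) = X i" using assms(1) by (simp add: fun_eq_iff)
  ultimately show ?thesis by (rule back_subst[where P="\<lambda>f. f \<in> generated_by M B X S \<rightarrow>\<^sub>M B"])
qed

text \<open>
  The coefficients are suprema of real sets, which say something only about bounded sets.
  Cauchy--Schwarz provides the bound \<open>1\<close>.
\<close>

lemma corr_le_rho_tilde:
  assumes "prob_space N" and meas: "\<And>e. e \<in> I \<Longrightarrow> X e \<in> borel_measurable N"
    and ST: "finite S" "finite T" "S \<subseteq> I" "T \<subseteq> I"
      "\<And>i j. i \<in> S \<Longrightarrow> j \<in> T \<Longrightarrow> int m \<le> \<bar>int (pos i) - int (pos j)\<bar>"
    and A: "A \<in> L2 N (generated_by N borel X S)" and B: "B \<in> L2 N (generated_by N borel X T)"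
  shows "corr N A B \<le> rho_tilde N I pos X m"
proof -
  let ?F = "generated_by N borel X"
  have L2: "Z \<in> borel_measurable N" "integrable N (\<lambda>x. (Z x)\<^sup>2)"
    if "Z \<in> L2 N (?F U)" "U \<subseteq> I" for Z U
  proof -
    have "Z \<in> borel_measurable (?F U)" using that by (simp add: L2_def)
    then show "Z \<in> borel_measurable N"
      using that(2) by (intro measurable_generated_by_imp[of U X N borel Z borel] meas) blast+
    show "integrable N (\<lambda>x. (Z x)\<^sup>2)" using that by (simp add: L2_def)
  qed
  have le1: "corr N P Q \<le> 1" if "P \<in> L2 N (?F U)" "Q \<in> L2 N (?F W)" "U \<subseteq> I" "W \<subseteq> I" for P Q U W
    using abs_corr_le_1[OF \<open>prob_space N\<close> L2(1)[OF that(1,3)] L2(1)[OF that(2,4)]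
        L2(2)[OF that(1,3)] L2(2)[OF that(2,4)]] by linarith
  have zero: "(\<lambda>_. 0) \<in> L2 N (?F U)" for U by (simp add: L2_def)
  have "corr N A B \<le> rho N (?F S) (?F T)"
    unfolding rho_def
  proof (rule cSup_upper)
    show "corr N A B \<in> {corr N P Q |P Q. P \<in> L2 N (?F S) \<and> Q \<in> L2 N (?F T)}" using A B by blast
    show "bdd_above {corr N P Q |P Q. P \<in> L2 N (?F S) \<and> Q \<in> L2 N (?F T)}"
      using le1 ST by (intro bdd_aboveI[of _ 1]) blast
  qed
  also have "\<dots> \<le> rho_tilde N I pos X m"
    unfolding rho_tilde_def
  proof (rule cSup_upper)
    show "bdd_above {rho N (?F S) (?F T) |S T. finite S \<and> finite T \<and> S \<subseteq> I \<and> T \<subseteq> I \<and>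
       (\<forall>i\<in>S. \<forall>j\<in>T. int m \<le> \<bar>int (pos i) - int (pos j)\<bar>)}"
    proof (rule bdd_aboveI[of _ 1], clarify)
      fix S T assume "S \<subseteq> I" "T \<subseteq> I"
      show "rho N (?F S) (?F T) \<le> 1"
        unfolding rho_def
      proof (rule cSup_least)
        show "{corr N P Q |P Q. P \<in> L2 N (?F S) \<and> Q \<in> L2 N (?F T)} \<noteq> {}" using zero by blast
      qed (use le1 \<open>S \<subseteq> I\<close> \<open>T \<subseteq> I\<close> in blast)
    qed
  qed (use ST in blast)
  finally show ?thesis .
qed

text \<open>
  The supremum bounds correlations from above only; applied to \<open>A\<close> and to \<open>- A\<close> it bounds the absolute
  value.  If one of the variances vanishes, then \<open>corr\<close> carries no information, but the covariance
  is \<open>0\<close> by Cauchy--Schwarz.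
\<close>

lemma abs_covariance_le_rho_tilde:
  assumes "prob_space N" and meas: "\<And>e. e \<in> I \<Longrightarrow> X e \<in> borel_measurable N"
    and ST: "finite S" "finite T" "S \<subseteq> I" "T \<subseteq> I"
      "\<And>i j. i \<in> S \<Longrightarrow> j \<in> T \<Longrightarrow> int m \<le> \<bar>int (pos i) - int (pos j)\<bar>"
    and A: "A \<in> L2 N (generated_by N borel X S)" and B: "B \<in> L2 N (generated_by N borel X T)"
    and mean: "(\<integral>x. A x \<partial>N) = 0" "(\<integral>x. B x \<partial>N) = 0"
    and r: "rho_tilde N I pos X m \<le> r"
  shows "\<bar>\<integral>x. A x * B x \<partial>N\<bar> \<le> r * sqrt ((\<integral>x. (A x)\<^sup>2 \<partial>N) * (\<integral>x. (B x)\<^sup>2 \<partial>N))"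
proof -
  define s where "s = sqrt ((\<integral>x. (A x)\<^sup>2 \<partial>N) * (\<integral>x. (B x)\<^sup>2 \<partial>N))"
  have s: "s \<ge> 0" by (simp add: s_def)
  have c: "corr N A B = (\<integral>x. A x * B x \<partial>N) / s" "corr N (\<lambda>x. - A x) B = - (\<integral>x. A x * B x \<partial>N) / s"
    unfolding corr_def s_def using mean by simp_all
  have A': "(\<lambda>x. - A x) \<in> L2 N (generated_by N borel X S)" using A by (simp add: L2_def)
  have le: "(\<integral>x. A x * B x \<partial>N) / s \<le> r" "- (\<integral>x. A x * B x \<partial>N) / s \<le> r"
  proof -
    have "corr N A B \<le> rho_tilde N I pos X m" "corr N (\<lambda>x. - A x) B \<le> rho_tilde N I pos X m"
      by (rule corr_le_rho_tilde[where S=S and T=T]; fact)+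
    then show "(\<integral>x. A x * B x \<partial>N) / s \<le> r" "- (\<integral>x. A x * B x \<partial>N) / s \<le> r"
      using r unfolding c by linarith+
  qed
  show ?thesis
  proof (cases "s = 0")
    case False
    then have "(\<integral>x. A x * B x \<partial>N) \<le> r * s" "- (\<integral>x. A x * B x \<partial>N) \<le> r * s"
      using le s by (simp_all add: field_simps)
    then show ?thesis unfolding s_def[symmetric] by linarith
  next
    case True
    have "A \<in> borel_measurable (generated_by N borel X S)" "B \<in> borel_measurable (generated_by N borel X T)"
      using A B by (simp_all add: L2_def)
    then have "A \<in> borel_measurable N" "B \<in> borel_measurable N"
      using ST(3,4) measurable_generated_by_imp[of S X N borel A borel]
        measurable_generated_by_imp[of T X N borel B borel] meas by blast+
    then have "\<bar>\<integral>x. A x * B x \<partial>N\<bar> \<le> s"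
      unfolding s_def using A B by (intro abs_integral_mult_le) (auto simp: L2_def)
    then show ?thesis using True unfolding s_def[symmetric] by simp
  qed
qed

lemma sum_square_le_card_mult:
  fixes f :: "'i \<Rightarrow> real"
  shows "(\<Sum>i\<in>S. f i)\<^sup>2 \<le> card S * (\<Sum>i\<in>S. (f i)\<^sup>2)"
  using Cauchy_Schwarz_ineq_sum[of "\<lambda>_. 1" f S] by simp

text \<open>
  Within one residue class of positions modulo \<open>m\<close> any two distinct positions are at distance at
  least \<open>m\<close>, so that disjoint subsets of the class have correlation at most \<open>r\<close> and
  \<open>second_moment_sum_le\<close> applies.  Adding up the \<open>m\<close> classes costs the factor \<open>m\<close>.
\<close>

lemma rho_mixing_second_moment:
  fixes X :: "'i \<Rightarrow> 'a \<Rightarrow> real" and r :: real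
  assumes "prob_space N" and meas: "\<And>e. e \<in> I \<Longrightarrow> X e \<in> borel_measurable N"
    and sq: "\<And>e. e \<in> I \<Longrightarrow> integrable N (\<lambda>x. (X e x)\<^sup>2)"
    and mean: "\<And>e. e \<in> I \<Longrightarrow> (\<integral>x. X e x \<partial>N) = 0"
    and inj: "inj_on pos I" and m: "m > 0"
    and r: "rho_tilde N I pos X m \<le> r" "0 \<le> r" "r < 1"
    and J: "finite J" "J \<subseteq> I"
  shows "(\<integral>x. (\<Sum>e\<in>J. c e * X e x)\<^sup>2 \<partial>N)
     \<le> m * ((1 + r) / (1 - r)) * (\<Sum>e\<in>J. (c e)\<^sup>2 * (\<integral>x. (X e x)\<^sup>2 \<partial>N))"
proof -
  interpret prob_space N by fact
  define Jk where "Jk k = {e\<in>J. pos e mod m = k}" for k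
  have Jk: "finite (Jk k)" "Jk k \<subseteq> I" for k using J by (auto simp: Jk_def)
  have Xi: "integrable N (X e)" if "e \<in> I" for e
    using square_integrable_imp_integrable meas sq that by blast
  have cm: "(\<lambda>x. c e * X e x) \<in> borel_measurable N" if "e \<in> I" for e using meas[OF that] by simp
  have csq: "integrable N (\<lambda>x. (c e * X e x)\<^sup>2)" if "e \<in> I" for e
    using sq[OF that] by (simp add: power_mult_distrib)
  have gap: "int m \<le> \<bar>int (pos i) - int (pos j)\<bar>"
    if ij: "i \<in> Jk k" "j \<in> Jk k" "i \<noteq> j" for i j k
  proof -
    have "pos i \<noteq> pos j" "pos i mod m = pos j mod m"
    proof -
      have "i \<in> I" "j \<in> I" using ij(1,2) Jk(2)[of k] by blast+
      then show "pos i \<noteq> pos j" using inj_onD[OF inj, of i j] ij(3) by blast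
      show "pos i mod m = pos j mod m" using ij(1,2) by (simp add: Jk_def)
    qed
    then have "int (pos i) - int (pos j) \<noteq> 0" "int m dvd int (pos i) - int (pos j)"
      by (simp_all add: mod_eq_dvd_iff[symmetric] flip: of_nat_mod)
    from dvd_imp_le_int[OF this] show ?thesis by simp
  qed
  have L2: "(\<lambda>x. \<Sum>i\<in>S. c i * X i x) \<in> L2 N (generated_by N borel X S)" if "S \<subseteq> I" for S
  proof -
    have "X i \<in> borel_measurable (generated_by N borel X S)" if "i \<in> S" for i
      using that by (intro measurable_generated_by_component) auto
    then have "(\<lambda>x. \<Sum>i\<in>S. c i * X i x) \<in> borel_measurable (generated_by N borel X S)"
      by (intro borel_measurable_sum borel_measurable_times) auto
    moreover have "integrable N (\<lambda>x. (\<Sum>i\<in>S. c i * X i x)\<^sup>2)"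
      using that by (intro integrable_sum_square cm csq) auto
    ultimately show ?thesis by (simp add: L2_def)
  qed
  have zero: "(\<integral>x. (\<Sum>i\<in>S. c i * X i x) \<partial>N) = 0" if "S \<subseteq> I" for S
    using that Xi mean by (subst Bochner_Integration.integral_sum) (auto intro!: sum.neutral)
  have residue_class: "(\<integral>x. (\<Sum>e\<in>Jk k. c e * X e x)\<^sup>2 \<partial>N)
     \<le> (1 + r) / (1 - r) * (\<Sum>e\<in>Jk k. \<integral>x. (c e * X e x)\<^sup>2 \<partial>N)" for k
  proof (rule second_moment_sum_le[OF Jk(1) r(2,3)])
    fix S T assume S: "S \<subseteq> Jk k" "T \<subseteq> Jk k" "S \<inter> T = {}"
    have fin: "finite S" "finite T" using S Jk(1) by (meson finite_subset)+
    have sub: "S \<subseteq> I" "T \<subseteq> I" using S Jk(2) by blast+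
    have g: "int m \<le> \<bar>int (pos i) - int (pos j)\<bar>" if "i \<in> S" "j \<in> T" for i j
      using gap[of i k j] that S by blast
    show "\<bar>\<integral>x. (\<Sum>i\<in>S. c i * X i x) * (\<Sum>i\<in>T. c i * X i x) \<partial>N\<bar>
        \<le> r * sqrt ((\<integral>x. (\<Sum>i\<in>S. c i * X i x)\<^sup>2 \<partial>N) * (\<integral>x. (\<Sum>i\<in>T. c i * X i x)\<^sup>2 \<partial>N))"
      by (rule abs_covariance_le_rho_tilde[where S=S and T=T, OF assms(1) _ fin sub _
            L2[OF sub(1)] L2[OF sub(2)] zero[OF sub(1)] zero[OF sub(2)] r(1)]) (fact meas g)+
  next
    fix e assume "e \<in> Jk k"
    then have "e \<in> I" using Jk by blast
    then show "(\<lambda>x. c e * X e x) \<in> borel_measurable N" "integrable N (\<lambda>x. (c e * X e x)\<^sup>2)"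
      using cm csq by auto
  qed
  have part: "(\<Sum>e\<in>J. f e) = (\<Sum>k<m. \<Sum>e\<in>Jk k. f e)" for f :: "'i \<Rightarrow> real"
    unfolding Jk_def using J(1) m by (subst sum.group) auto
  have "(\<integral>x. (\<Sum>e\<in>J. c e * X e x)\<^sup>2 \<partial>N) \<le> (\<integral>x. m * (\<Sum>k<m. (\<Sum>e\<in>Jk k. c e * X e x)\<^sup>2) \<partial>N)"
  proof (rule integral_mono)
    show "integrable N (\<lambda>x. (\<Sum>e\<in>J. c e * X e x)\<^sup>2)"
      using J by (intro integrable_sum_square cm csq) auto
    show "integrable N (\<lambda>x. real m * (\<Sum>k<m. (\<Sum>e\<in>Jk k. c e * X e x)\<^sup>2))"
      using Jk(2) by (intro integrable_mult_right Bochner_Integration.integrable_sum integrable_sum_square cm csq) auto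
    show "(\<Sum>e\<in>J. c e * X e x)\<^sup>2 \<le> real m * (\<Sum>k<m. (\<Sum>e\<in>Jk k. c e * X e x)\<^sup>2)" for x
      using sum_square_le_card_mult[of "\<lambda>k. \<Sum>e\<in>Jk k. c e * X e x" "{..<m}"]
      unfolding part by simp
  qed
  also have "\<dots> = m * (\<Sum>k<m. \<integral>x. (\<Sum>e\<in>Jk k. c e * X e x)\<^sup>2 \<partial>N)"
  proof -
    have "integrable N (\<lambda>x. (\<Sum>e\<in>Jk k. c e * X e x)\<^sup>2)" for k
      using Jk(2) by (intro integrable_sum_square cm csq) auto
    then show ?thesis by (simp add: Bochner_Integration.integral_sum)
  qed
  also have "\<dots> \<le> m * (\<Sum>k<m. (1 + r) / (1 - r) * (\<Sum>e\<in>Jk k. \<integral>x. (c e * X e x)\<^sup>2 \<partial>N))"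
    by (intro mult_left_mono sum_mono residue_class) auto
  also have "\<dots> = m * ((1 + r) / (1 - r)) * (\<Sum>e\<in>J. (c e)\<^sup>2 * (\<integral>x. (X e x)\<^sup>2 \<partial>N))"
    unfolding part by (simp add: power_mult_distrib sum_distrib_left mult.assoc)
  finally show ?thesis .
qed


section \<open>Noise-free consensus over balanced digraphs\<close>

definition consensus_step :: "real \<Rightarrow> ('n::finite) wdigraph \<Rightarrow> real ^ 'n \<Rightarrow> real ^ 'n" where
  "consensus_step a g y =
     (\<chi> i. y $ i + a * (\<Sum>j\<in>neighbors g i. weight g i j * (y $ j - y $ i)))"

text \<open>
  For a balanced digraph this is twice the quadratic form of the Laplacian.
\<close>

definition edge_energy :: "('n::finite) wdigraph \<Rightarrow> real ^ 'n \<Rightarrow> real" where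
  "edge_energy g y = (\<Sum>i\<in>UNIV. \<Sum>j\<in>neighbors g i. weight g i j * (y $ j - y $ i)\<^sup>2)"

text \<open>
  The bound on the gain leaves out self-loops: they do not move the noise-free state, and with them
  there could be \<open>CARD('n)\<close> instead of \<open>CARD('n) - 1\<close> neighbors.
\<close>

definition admissible :: "real \<Rightarrow> ('n::finite) wdigraph \<Rightarrow> bool" where
  "admissible a g \<longleftrightarrow> 0 \<le> a \<and> balanced g \<and> (\<forall>i. \<forall>j\<in>neighbors g i. 1 \<le> weight g i j) \<and>
     (\<forall>i. a * (\<Sum>j\<in>neighbors g i - {i}. weight g i j) \<le> 1 / 2)"

lemma sum_neighbors_eq:
  fixes g :: "('n::finite) wdigraph"
  shows "(\<Sum>j\<in>neighbors g i. f j) = (\<Sum>j\<in>UNIV. if (j, i) \<in> fst g then f j else 0)"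
  using sum.inter_filter[of UNIV f "\<lambda>j. (j, i) \<in> fst g"] by (simp add: neighbors_def)

text \<open>
  Summing over the edges by their senders or by their receivers gives the same total exactly because
  out-degrees equal in-degrees.
\<close>

lemma balanced_sum_swap:
  fixes f :: "'n::finite \<Rightarrow> real"
  assumes "balanced g"
  shows "(\<Sum>i\<in>UNIV. \<Sum>j\<in>neighbors g i. weight g i j * f j)
       = (\<Sum>i\<in>UNIV. \<Sum>j\<in>neighbors g i. weight g i j * f i)"
proof -
  have "(\<Sum>i\<in>UNIV. \<Sum>j\<in>neighbors g i. weight g i j * f j)
      = (\<Sum>j\<in>UNIV. \<Sum>i\<in>{i. j \<in> neighbors g i}. weight g i j * f j)"
    using sum.swap_restrict[of UNIV UNIV "\<lambda>i j. weight g i j * f j" "\<lambda>i j. j \<in> neighbors g i"]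
    by simp
  also have "\<dots> = (\<Sum>j\<in>UNIV. (\<Sum>i\<in>{i. j \<in> neighbors g i}. weight g i j) * f j)"
    by (simp add: sum_distrib_right)
  also have "\<dots> = (\<Sum>j\<in>UNIV. (\<Sum>i\<in>neighbors g j. weight g j i) * f j)"
    using assms unfolding balanced_def by simp
  finally show ?thesis by (simp add: sum_distrib_right)
qed

lemma ave_diff_sum: "(\<Sum>i\<in>UNIV. y $ i - ave y) = 0"
  by (simp add: ave_def sum_subtractf)

lemma ave_consensus_step:
  assumes "balanced g"
  shows "ave (consensus_step a g y) = ave y"
proof -
  have "(\<Sum>i\<in>UNIV. \<Sum>j\<in>neighbors g i. weight g i j * (y $ j - y $ i)) = 0"
    using balanced_sum_swap[OF assms, of "\<lambda>i. y $ i"]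
    by (simp add: right_diff_distrib sum_subtractf)
  then show ?thesis
    by (simp add: ave_def consensus_step_def sum.distrib sum_distrib_left[symmetric])
qed

lemma weighted_sum_square_le:
  fixes w z :: "'i \<Rightarrow> real"
  assumes "\<And>i. i \<in> S \<Longrightarrow> 0 \<le> w i"
  shows "(\<Sum>i\<in>S. w i * z i)\<^sup>2 \<le> (\<Sum>i\<in>S. w i) * (\<Sum>i\<in>S. w i * (z i)\<^sup>2)"
proof -
  have "(\<Sum>i\<in>S. w i * z i) = (\<Sum>i\<in>S. sqrt (w i) * (sqrt (w i) * z i))"
    using assms by (intro sum.cong) (auto simp flip: mult.assoc)
  also have "\<dots>\<^sup>2 \<le> (\<Sum>i\<in>S. (sqrt (w i))\<^sup>2) * (\<Sum>i\<in>S. (sqrt (w i) * z i)\<^sup>2)"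
    by (rule Cauchy_Schwarz_ineq_sum)
  also have "\<dots> = (\<Sum>i\<in>S. w i) * (\<Sum>i\<in>S. w i * (z i)\<^sup>2)"
    using assms by (simp add: power_mult_distrib)
  finally show ?thesis .
qed

lemma edge_energy_nonneg:
  assumes "admissible a g" shows "0 \<le> edge_energy g y"
  unfolding edge_energy_def
proof (intro sum_nonneg)
  fix i j assume "j \<in> neighbors g i"
  then have "1 \<le> weight g i j" using assms by (auto simp: admissible_def)
  then show "0 \<le> weight g i j * (y $ j - y $ i)\<^sup>2" by simp
qed

text \<open>
  By the weighted Cauchy--Schwarz inequality an agent moves in square by at most \<open>a\<close> times its degree
  times \<open>a\<close> times its share of the edge energy, and admissibility bounds the first product by \<open>1 / 2\<close>.
\<close>

lemma consensus_step_moves_le: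
  assumes "admissible a g"
  shows "(\<Sum>i\<in>UNIV. (consensus_step a g y $ i - y $ i)\<^sup>2) \<le> a / 2 * edge_energy g y"
proof -
  have w: "0 \<le> weight g i j" if "j \<in> neighbors g i" for i j
    using assms that unfolding admissible_def by force
  have a: "0 \<le> a" using assms by (simp add: admissible_def)
  have "(consensus_step a g y $ i - y $ i)\<^sup>2
      \<le> a / 2 * (\<Sum>j\<in>neighbors g i. weight g i j * (y $ j - y $ i)\<^sup>2)" for i
  proof -
    let ?N = "neighbors g i - {i}"
    have drop: "(\<Sum>j\<in>neighbors g i. weight g i j * f j) = (\<Sum>j\<in>?N. weight g i j * f j)"
      if "f i = 0" for f :: "'a \<Rightarrow> real"
      using that by (intro sum.mono_neutral_right) auto
    have "(consensus_step a g y $ i - y $ i)\<^sup>2 = a\<^sup>2 * (\<Sum>j\<in>?N. weight g i j * (y $ j - y $ i))\<^sup>2"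
      using drop[of "\<lambda>j. y $ j - y $ i"] by (simp add: consensus_step_def power_mult_distrib)
    also have "\<dots> \<le> a\<^sup>2 * ((\<Sum>j\<in>?N. weight g i j) * (\<Sum>j\<in>?N. weight g i j * (y $ j - y $ i)\<^sup>2))"
      by (intro mult_left_mono weighted_sum_square_le w) auto
    also have "\<dots> = (a * (\<Sum>j\<in>?N. weight g i j)) * (a * (\<Sum>j\<in>?N. weight g i j * (y $ j - y $ i)\<^sup>2))"
      by (simp add: power2_eq_square algebra_simps)
    also have "\<dots> \<le> 1 / 2 * (a * (\<Sum>j\<in>?N. weight g i j * (y $ j - y $ i)\<^sup>2))"
      using assms a w by (intro mult_right_mono mult_nonneg_nonneg sum_nonneg) (auto simp: admissible_def)
    also have "\<dots> = a / 2 * (\<Sum>j\<in>neighbors g i. weight g i j * (y $ j - y $ i)\<^sup>2)"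
      using drop[of "\<lambda>j. (y $ j - y $ i)\<^sup>2"] by simp
    finally show ?thesis .
  qed
  then have "(\<Sum>i\<in>UNIV. (consensus_step a g y $ i - y $ i)\<^sup>2)
      \<le> (\<Sum>i\<in>UNIV. a / 2 * (\<Sum>j\<in>neighbors g i. weight g i j * (y $ j - y $ i)\<^sup>2))"
    by (rule sum_mono)
  then show ?thesis by (simp add: edge_energy_def sum_distrib_left)
qed

text \<open>
  With \<open>z = y - ave y\<close>, the first-order term of the change of \<open>V\<close> is \<open>2 a\<close> times the sum of
  \<open>a\<^sub>i\<^sub>j z\<^sub>i (z\<^sub>j - z\<^sub>i) = a\<^sub>i\<^sub>j (z\<^sub>j\<^sup>2 - z\<^sub>i\<^sup>2 - (z\<^sub>j - z\<^sub>i)\<^sup>2) / 2\<close>.  By balancedness the first two parts cancel in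
  the sum, which leaves minus the edge energy.  The second-order term takes back at most half of it.
\<close>

lemma V_consensus_step_le:
  assumes "admissible a g"
  shows "V (consensus_step a g y) \<le> V y - a / 2 * edge_energy g y"
proof -
  have bal: "balanced g" using assms by (simp add: admissible_def)
  define u where "u i = (\<Sum>j\<in>neighbors g i. weight g i j * (y $ j - y $ i))" for i
  define z where "z i = y $ i - ave y" for i
  have "z i * u i = (\<Sum>j\<in>neighbors g i. weight g i j * (z j)\<^sup>2 / 2)
      - (\<Sum>j\<in>neighbors g i. weight g i j * (z i)\<^sup>2 / 2)
      - (\<Sum>j\<in>neighbors g i. weight g i j * (y $ j - y $ i)\<^sup>2) / 2" for i
    unfolding u_def z_def sum_distrib_left sum_subtractf[symmetric] sum_divide_distrib
    by (intro sum.cong) (auto simp: field_simps power2_eq_square)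
  then have "(\<Sum>i\<in>UNIV. z i * u i) = (\<Sum>i\<in>UNIV. \<Sum>j\<in>neighbors g i. weight g i j * ((z j)\<^sup>2 / 2))
      - (\<Sum>i\<in>UNIV. \<Sum>j\<in>neighbors g i. weight g i j * ((z i)\<^sup>2 / 2)) - edge_energy g y / 2"
    by (simp add: sum_subtractf sum_divide_distrib[symmetric] edge_energy_def)
  then have zu: "(\<Sum>i\<in>UNIV. z i * u i) = - edge_energy g y / 2"
    using balanced_sum_swap[OF bal, of "\<lambda>i. (z i)\<^sup>2 / 2"] by simp
  have moves: "(\<Sum>i\<in>UNIV. (a * u i)\<^sup>2) \<le> a / 2 * edge_energy g y"
    using consensus_step_moves_le[OF assms, of y] by (simp add: consensus_step_def u_def)
  have "V (consensus_step a g y) = (\<Sum>i\<in>UNIV. (z i + a * u i)\<^sup>2)"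
    unfolding V_def ave_consensus_step[OF bal] by (simp add: consensus_step_def z_def u_def algebra_simps)
  also have "\<dots> = (\<Sum>i\<in>UNIV. (z i)\<^sup>2) + 2 * a * (\<Sum>i\<in>UNIV. z i * u i) + (\<Sum>i\<in>UNIV. (a * u i)\<^sup>2)"
    by (simp add: power2_sum sum.distrib sum_distrib_left mult_ac)
  also have "\<dots> \<le> V y - a / 2 * edge_energy g y"
    using moves unfolding zu by (simp add: V_def z_def)
  finally show ?thesis .
qed

lemma V_nonneg: "0 \<le> V y"
  by (simp add: V_def sum_nonneg)

lemma V_consensus_step_mono:
  assumes "admissible a g"
  shows "V (consensus_step a g y) \<le> V y"
proof -
  have "0 \<le> a / 2 * edge_energy g y"
    using assms edge_energy_nonneg[OF assms] by (simp add: admissible_def)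
  then show ?thesis using V_consensus_step_le[OF assms, of y] by linarith
qed

text \<open>
  The noise-free system: \<open>flow a g s k y\<close> is the state at time \<open>s + k\<close> after starting from \<open>y\<close> at time \<open>s\<close>.
\<close>

fun flow :: "(nat \<Rightarrow> real) \<Rightarrow> (nat \<Rightarrow> ('n::finite) wdigraph) \<Rightarrow> nat \<Rightarrow> nat \<Rightarrow> real ^ 'n \<Rightarrow> real ^ 'n" where
  "flow a g s 0 y = y"
| "flow a g s (Suc k) y = consensus_step (a (s + k)) (g (s + k)) (flow a g s k y)"

lemma V_flow_le:
  assumes "\<And>l. l < k \<Longrightarrow> admissible (a (s + l)) (g (s + l))"
  shows "V (flow a g s k y) \<le> V y"
  using assms
proof (induction k)
  case (Suc k)
  then have "V (consensus_step (a (s + k)) (g (s + k)) (flow a g s k y)) \<le> V (flow a g s k y)"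
    by (intro V_consensus_step_mono) auto
  with Suc show ?case by fastforce
qed simp

lemma flow_add: "flow a g s (k + l) y = flow a g (s + k) l (flow a g s k y)"
  by (induction l) (simp_all add: add.assoc)

lemma flow_cong:
  "(\<And>l. l < k \<Longrightarrow> g (s + l) = g' (s + l)) \<Longrightarrow> flow a g s k y = flow a g' s k y"
  by (induction k) simp_all

lemma relpow_step_bound:
  fixes f :: "'v \<Rightarrow> real"
  assumes "\<And>u v. (u, v) \<in> E \<Longrightarrow> \<bar>f u - f v\<bar> \<le> d" and "(u, v) \<in> E ^^ k"
  shows "\<bar>f u - f v\<bar> \<le> k * d"
  using assms(2)
proof (induction k arbitrary: v)
  case (Suc k)
  then obtain w where "(u, w) \<in> E ^^ k" "(w, v) \<in> E" by auto
  with Suc.IH[of w] assms(1)[of w v] show ?case by (simp add: algebra_simps)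
qed simp

lemma strongly_connected_spread:
  fixes y :: "real ^ ('n::finite)"
  assumes "strongly_connected_edges E" and "\<And>u v. (u, v) \<in> E \<Longrightarrow> \<bar>y $ u - y $ v\<bar> \<le> d" and "0 \<le> d"
  shows "\<bar>y $ u - y $ v\<bar> \<le> (real CARD('n))\<^sup>2 * d"
proof -
  have "(u, v) \<in> E\<^sup>*" using assms(1) by (simp add: strongly_connected_edges_def)
  then obtain k where k: "(u, v) \<in> E ^^ k" "k \<le> card E"
    using rtrancl_finite_eq_relpow[of E] by auto
  \<comment> \<open>A shortest path repeats no edge, and there are at most \<open>CARD('n)\<^sup>2\<close> edges.\<close>
  have "card E \<le> card (UNIV :: ('n \<times> 'n) set)" by (intro card_mono) auto
  then have "k \<le> CARD('n)\<^sup>2" using k(2) by (simp add: card_cartesian_product power2_eq_square)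
  then have "real k \<le> (real CARD('n))\<^sup>2" by (metis of_nat_le_iff of_nat_power)
  then have "k * d \<le> (real CARD('n))\<^sup>2 * d" using assms(3) by (rule mult_right_mono)
  then show ?thesis using relpow_step_bound[of E "\<lambda>i. y $ i" d u v k] assms(2) k(1) by force
qed

lemma V_le_spread:
  fixes y :: "real ^ ('n::finite)"
  assumes "\<And>u v. \<bar>y $ u - y $ v\<bar> \<le> d"
  shows "V y \<le> real CARD('n) * d\<^sup>2"
proof -
  have "\<bar>y $ i - ave y\<bar> \<le> d" for i
  proof -
    have eq: "y $ i - ave y = (\<Sum>j\<in>UNIV. y $ i - y $ j) / real CARD('n)"
      by (simp add: ave_def sum_subtractf field_simps)
    have "\<bar>\<Sum>j\<in>UNIV. y $ i - y $ j\<bar> \<le> (\<Sum>j\<in>(UNIV :: 'n set). d)"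
      using assms by (intro order.trans[OF sum_abs] sum_mono) auto
    then show ?thesis unfolding eq by (simp add: pos_divide_le_eq mult.commute)
  qed
  then have "(y $ i - ave y)\<^sup>2 \<le> d\<^sup>2" for i by (metis abs_le_square_iff abs_of_nonneg abs_ge_zero order.trans)
  then have "V y \<le> (\<Sum>i\<in>(UNIV :: 'n set). d\<^sup>2)" unfolding V_def by (intro sum_mono) auto
  then show ?thesis by simp
qed

text \<open>
  The share of \<open>V\<close>, per unit of gain, that is lost over \<open>K\<close> steps with a strongly connected union.
  The bound comes from the proof of \<open>V_flow_contraction\<close>.
\<close>

definition contraction_const :: "nat \<Rightarrow> nat \<Rightarrow> real \<Rightarrow> real" where
  "contraction_const N K A = 1 / (real N ^ 5 * (2 * real K * sqrt A + 2)\<^sup>2)"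

text \<open>
  Let \<open>\<Delta>\<close> be the loss of \<open>V\<close> over the block.  It controls both the square of every single step and, up to
  the factor \<open>2 / a0\<close>, the squared difference across every edge at the time at which the edge is present.
  Hence the endpoints of each edge of the union are at distance \<open>O (sqrt (\<Delta> / a0))\<close> already at the start
  of the block.  Strong connectivity carries this bound to all pairs of agents, so \<open>V y = O (\<Delta> / a0)\<close>.
\<close>

lemma V_flow_contraction:
  fixes g :: "nat \<Rightarrow> ('n::finite) wdigraph"
  assumes adm: "\<And>l. l < K \<Longrightarrow> admissible (a (s + l)) (g (s + l))"
    and a0: "0 \<le> a0" "a0 \<le> A" "\<And>l. l < K \<Longrightarrow> a0 \<le> a (s + l)"
    and conn: "strongly_connected_edges (\<Union>l<K. fst (g (s + l)))"
  shows "V (flow a g s K y) \<le> (1 - contraction_const CARD('n) K A * a0) * V y"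
proof (cases "a0 = 0")
  case True
  then show ?thesis using V_flow_le[of K a s g y] adm by simp
next
  case False
  then have a0pos: "0 < a0" using a0 by simp
  define Y where "Y k = flow a g s k y" for k
  define S where "S k = a (s + k) / 2 * edge_energy (g (s + k)) (Y k)" for k
  define \<Delta> where "\<Delta> = V y - V (Y K)"
  have Snn: "0 \<le> S k" if "k < K" for k
    using adm[OF that] edge_energy_nonneg[OF adm[OF that]] by (simp add: S_def admissible_def)
  have Vs: "V (Y (Suc k)) \<le> V (Y k) - S k" if "k < K" for k
    unfolding Y_def S_def flow.simps by (rule V_consensus_step_le[OF adm[OF that]])
  have tot: "(\<Sum>l<k. S l) \<le> V y - V (Y k)" if "k \<le> K" for k
    using that
  proof (induction k)
    case 0 then show ?case by (simp add: Y_def)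
  next
    case (Suc k) then show ?case using Vs[of k] by simp
  qed
  have SD: "S k \<le> \<Delta>" if "k < K" for k
    using tot[of K] member_le_sum[of k "{..<K}" S] Snn that by (fastforce simp: \<Delta>_def)
  have D0: "0 \<le> \<Delta>" using V_flow_le[of K a s g y] adm by (simp add: \<Delta>_def Y_def)
  have step: "\<bar>Y (Suc k) $ i - Y k $ i\<bar> \<le> sqrt \<Delta>" if "k < K" for k i
  proof -
    have "(Y (Suc k) $ i - Y k $ i)\<^sup>2 \<le> (\<Sum>i\<in>UNIV. (Y (Suc k) $ i - Y k $ i)\<^sup>2)"
      by (intro member_le_sum) auto
    also have "\<dots> \<le> S k"
      unfolding Y_def S_def flow.simps by (rule consensus_step_moves_le[OF adm[OF that]])
    also have "\<dots> \<le> \<Delta>" by (rule SD[OF that])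
    finally show ?thesis by (simp add: real_le_rsqrt)
  qed
  have drift: "\<bar>Y k $ i - y $ i\<bar> \<le> real k * sqrt \<Delta>" if "k \<le> K" for k i
    using that
  proof (induction k)
    case 0 then show ?case by (simp add: Y_def)
  next
    case (Suc k) then show ?case using step[of k i] by (simp add: algebra_simps)
  qed
  \<comment> \<open>All distances are measured in this unit: single steps are at most \<open>sqrt A * q\<close>, edges at most \<open>2 * q\<close>.\<close>
  define q where "q = sqrt (\<Delta> / a0)"
  have q: "0 \<le> q" "q\<^sup>2 = \<Delta> / a0" using D0 a0pos by (simp_all add: q_def)
  have sD: "sqrt \<Delta> \<le> sqrt A * q"
  proof -
    have "\<Delta> \<le> A * (\<Delta> / a0)" using mult_right_mono[OF a0(2) D0] a0pos by (simp add: field_simps)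
    then show ?thesis unfolding q_def real_sqrt_mult[symmetric] by simp
  qed
  define d where "d = (2 * real K * sqrt A + 2) * q"
  have d0: "0 \<le> d" using q a0 by (simp add: d_def)
  have edge: "\<bar>y $ j - y $ i\<bar> \<le> d" if ji: "(j, i) \<in> (\<Union>l<K. fst (g (s + l)))" for i j
  proof -
    from ji obtain k where k: "k < K" "(j, i) \<in> fst (g (s + k))" by auto
    have nb: "j \<in> neighbors (g (s + k)) i" using k by (simp add: neighbors_def)
    have w: "0 \<le> weight (g (s + k)) i j" if "j \<in> neighbors (g (s + k)) i" for i j
      using adm[OF k(1)] that unfolding admissible_def by force
    have "(Y k $ j - Y k $ i)\<^sup>2 \<le> weight (g (s + k)) i j * (Y k $ j - Y k $ i)\<^sup>2"
      using adm[OF k(1)] nb mult_right_mono[of 1 "weight (g (s + k)) i j" "(Y k $ j - Y k $ i)\<^sup>2"]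
      by (auto simp: admissible_def)
    also have "\<dots> \<le> (\<Sum>j\<in>neighbors (g (s + k)) i. weight (g (s + k)) i j * (Y k $ j - Y k $ i)\<^sup>2)"
      using w nb by (intro member_le_sum[of j "neighbors (g (s + k)) i"]) auto
    also have "\<dots> \<le> edge_energy (g (s + k)) (Y k)"
      unfolding edge_energy_def using w
      by (intro member_le_sum[of i UNIV "\<lambda>i. \<Sum>j\<in>neighbors (g (s + k)) i. weight (g (s + k)) i j * (Y k $ j - Y k $ i)\<^sup>2"] sum_nonneg) auto
    finally have e: "(Y k $ j - Y k $ i)\<^sup>2 \<le> edge_energy (g (s + k)) (Y k)" .
    have "a0 / 2 * (Y k $ j - Y k $ i)\<^sup>2 \<le> a (s + k) / 2 * edge_energy (g (s + k)) (Y k)"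
      using a0(3)[OF k(1)] a0pos e by (intro mult_mono) auto
    also have "\<dots> \<le> \<Delta>" using SD[OF k(1)] by (simp add: S_def)
    finally have "(Y k $ j - Y k $ i)\<^sup>2 \<le> 2 * q\<^sup>2" using a0pos by (simp add: q field_simps)
    also have "\<dots> \<le> (2 * q)\<^sup>2" by (simp add: power2_eq_square)
    finally have "\<bar>Y k $ j - Y k $ i\<bar> \<le> \<bar>2 * q\<bar>" unfolding abs_le_square_iff .
    then have "\<bar>Y k $ j - Y k $ i\<bar> \<le> 2 * q" using q by simp
    moreover have "\<bar>Y k $ v - y $ v\<bar> \<le> real K * (sqrt A * q)" for v
    proof -
      have "real k * sqrt \<Delta> \<le> real K * (sqrt A * q)" using k(1) sD D0 by (intro mult_mono) auto
      then show ?thesis using drift[of k v] k(1) by simp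
    qed
    from this[of i] this[of j] have "\<bar>Y k $ i - y $ i\<bar> \<le> real K * (sqrt A * q)" "\<bar>Y k $ j - y $ j\<bar> \<le> real K * (sqrt A * q)" .
    ultimately have "\<bar>y $ j - y $ i\<bar> \<le> 2 * q + 2 * (real K * (sqrt A * q))" by linarith
    then show ?thesis by (simp add: d_def algebra_simps)
  qed
  have "V y \<le> real CARD('n) * ((real CARD('n))\<^sup>2 * d)\<^sup>2"
    by (intro V_le_spread strongly_connected_spread[OF conn] edge d0)
  also have "\<dots> = real CARD('n) ^ 5 * (2 * real K * sqrt A + 2)\<^sup>2 * (\<Delta> / a0)"
    unfolding d_def power_mult_distrib q by (simp add: eval_nat_numeral)
  finally have "V y * a0 \<le> real CARD('n) ^ 5 * (2 * real K * sqrt A + 2)\<^sup>2 * \<Delta>"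
    using a0pos by (simp add: field_simps)
  moreover have "0 < real CARD('n) ^ 5 * (2 * real K * sqrt A + 2)\<^sup>2"
  proof -
    have "0 \<le> 2 * real K * sqrt A" using a0 by simp
    then have "2 * real K * sqrt A + 2 \<noteq> 0" by linarith
    then show ?thesis by simp
  qed
  ultimately have "contraction_const CARD('n) K A * a0 * V y \<le> \<Delta>"
    unfolding contraction_const_def by (simp add: pos_divide_le_eq mult_ac)
  then show ?thesis unfolding \<Delta>_def Y_def by (simp add: algebra_simps)
qed

lemma linear_consensus_step: "linear (consensus_step a g)"
  by (intro linearI)
    (simp_all add: vec_eq_iff consensus_step_def sum.distrib[symmetric] sum_distrib_left algebra_simps)

lemma linear_flow: "linear (flow a g s k)"
proof (induction k)
  case 0
  show ?case by (intro linearI) simp_all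
next
  case (Suc k)
  show ?case
    by (intro linearI) (simp_all add: linear_add[OF Suc] linear_scale[OF Suc]
        linear_add[OF linear_consensus_step] linear_scale[OF linear_consensus_step])
qed

lemma variation_of_constants:
  assumes "\<And>t. 1 \<le> t \<Longrightarrow> x (t + 1) = consensus_step (a t) (g t) (x t) + u t"
  shows "x (Suc k) = flow a g 1 k (x 1) + (\<Sum>s=1..k. flow a g (s + 1) (k - s) (u s))"
proof (induction k)
  case (Suc k)
  let ?c = "consensus_step (a (Suc k)) (g (Suc k))"
  have "x (Suc (Suc k)) = ?c (x (Suc k)) + u (Suc k)" using assms[of "Suc k"] by simp
  also have "?c (x (Suc k)) = ?c (flow a g 1 k (x 1)) + (\<Sum>s=1..k. ?c (flow a g (s + 1) (k - s) (u s)))"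
    unfolding Suc.IH by (simp add: linear_add[OF linear_consensus_step] linear_sum[OF linear_consensus_step])
  also have "?c (flow a g 1 k (x 1)) = flow a g 1 (Suc k) (x 1)" by simp
  also have "(\<Sum>s=1..k. ?c (flow a g (s + 1) (k - s) (u s))) = (\<Sum>s=1..k. flow a g (s + 1) (Suc k - s) (u s))"
    by (intro sum.cong) (auto simp: Suc_diff_le)
  finally show ?case by (simp add: add.assoc)
qed simp

lemma linear_deviation: "linear (\<lambda>y. y $ k - ave y)"
  by (intro linearI) (simp_all add: ave_def sum.distrib sum_distrib_left sum_divide_distrib algebra_simps)

lemma V_add_le: "V (x + y) \<le> 2 * V x + 2 * V y"
proof -
  have "(x + y) $ k - ave (x + y) = (x $ k - ave x) + (y $ k - ave y)" for k
    using linear_add[OF linear_deviation] .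
  then have "V (x + y) = (\<Sum>k\<in>UNIV. ((x $ k - ave x) + (y $ k - ave y))\<^sup>2)"
    by (simp only: V_def)
  also have "\<dots> \<le> (\<Sum>k\<in>UNIV. 2 * (x $ k - ave x)\<^sup>2 + 2 * (y $ k - ave y)\<^sup>2)"
  proof (rule sum_mono)
    fix k
    show "((x $ k - ave x) + (y $ k - ave y))\<^sup>2 \<le> 2 * (x $ k - ave x)\<^sup>2 + 2 * (y $ k - ave y)\<^sup>2"
      using sum_squares_bound[of "x $ k - ave x" "y $ k - ave y"] by (simp add: power2_sum)
  qed
  finally show ?thesis by (simp add: V_def sum.distrib sum_distrib_left)
qed

lemma norm_diff_const_square:
  fixes y :: "real ^ ('n::finite)"
  shows "(norm (y - (\<chi> i. b)))\<^sup>2 = V y + real CARD('n) * (ave y - b)\<^sup>2"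
proof -
  have "(norm (y - (\<chi> i. b)))\<^sup>2 = (\<Sum>i\<in>UNIV. (y $ i - b)\<^sup>2)"
    by (simp add: norm_vec_def L2_set_def sum_nonneg)
  also have "\<dots> = (\<Sum>i\<in>UNIV. (y $ i - ave y)\<^sup>2 + 2 * (ave y - b) * (y $ i - ave y) + (ave y - b)\<^sup>2)"
    by (intro sum.cong) (auto simp: power2_eq_square algebra_simps)
  also have "\<dots> = V y + 2 * (ave y - b) * (\<Sum>i\<in>UNIV. y $ i - ave y) + real CARD('n) * (ave y - b)\<^sup>2"
    by (simp add: V_def sum.distrib sum_distrib_left[symmetric])
  finally show ?thesis by (simp add: ave_diff_sum)
qed


section \<open>Expected decay over random topologies\<close>

lemma borel_measurable_vec_iff:
  fixes f :: "'a \<Rightarrow> real ^ ('n::finite)"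
  shows "f \<in> borel_measurable M \<longleftrightarrow> (\<forall>i. (\<lambda>x. f x $ i) \<in> borel_measurable M)"
proof -
  have "(\<forall>b\<in>Basis. (\<lambda>x. f x \<bullet> b) \<in> borel_measurable M) \<longleftrightarrow> (\<forall>i. (\<lambda>x. f x $ i) \<in> borel_measurable M)"
    by (auto simp: Basis_vec_def inner_axis)
  then show ?thesis using borel_measurable_euclidean_space[of f M] by simp
qed

lemma measurable_edge:
  assumes "g \<in> N \<rightarrow>\<^sub>M wdigraph_space"
  shows "Measurable.pred N (\<lambda>\<omega>. (j, i) \<in> fst (g \<omega>))"
proof -
  have "(\<lambda>\<omega>. fst (g \<omega>)) \<in> N \<rightarrow>\<^sub>M count_space UNIV"
    using assms unfolding wdigraph_space_def by (rule measurable_fst')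
  from measurable_compose[OF this, of "\<lambda>E. (j, i) \<in> E" "count_space UNIV"] show ?thesis by simp
qed

lemma measurable_weight:
  fixes g :: "'a \<Rightarrow> ('n::finite) wdigraph"
  assumes "g \<in> N \<rightarrow>\<^sub>M wdigraph_space"
  shows "(\<lambda>\<omega>. weight (g \<omega>) i j) \<in> borel_measurable N"
proof -
  have "(\<lambda>\<omega>. snd (g \<omega>)) \<in> borel_measurable N"
    using assms unfolding wdigraph_space_def by (rule measurable_snd')
  moreover have "(\<lambda>A :: real ^ 'n ^ 'n. A $ i $ j) \<in> borel_measurable borel"
    by (intro borel_measurable_continuous_onI continuous_intros)
  ultimately show ?thesis unfolding weight_def by (rule measurable_compose)
qed

lemma measurable_flow:
  fixes G :: "nat \<Rightarrow> 'a \<Rightarrow> ('n::finite) wdigraph"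
  assumes "\<And>l. l < k \<Longrightarrow> G (s + l) \<in> N \<rightarrow>\<^sub>M wdigraph_space"
  shows "(\<lambda>\<omega>. flow a (\<lambda>t. G t \<omega>) s k y) \<in> borel_measurable N"
  using assms
proof (induction k)
  case (Suc k)
  let ?Y = "\<lambda>\<omega>. flow a (\<lambda>t. G t \<omega>) s k y"
  have Y [measurable]: "(\<lambda>\<omega>. ?Y \<omega> $ i) \<in> borel_measurable N" for i
    using Suc by (simp add: borel_measurable_vec_iff)
  have G: "G (s + k) \<in> N \<rightarrow>\<^sub>M wdigraph_space" using Suc.prems by simp
  note [measurable] = measurable_edge[OF G] measurable_weight[OF G]
  have "(\<lambda>\<omega>. consensus_step (a (s + k)) (G (s + k) \<omega>) (?Y \<omega>)) \<in> borel_measurable N"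
    unfolding borel_measurable_vec_iff consensus_step_def sum_neighbors_eq by simp
  then show ?case by simp
qed simp

lemma measurable_V:
  fixes f :: "'a \<Rightarrow> real ^ ('n::finite)"
  assumes "f \<in> borel_measurable N"
  shows "(\<lambda>\<omega>. V (f \<omega>)) \<in> borel_measurable N"
proof -
  have [measurable]: "(\<lambda>\<omega>. f \<omega> $ i) \<in> borel_measurable N" for i
    using assms by (simp add: borel_measurable_vec_iff)
  show ?thesis unfolding V_def ave_def by measurable
qed

text \<open>
  There are only finitely many edge sets, so the union of the topologies is compared with each of the
  strongly connected ones.
\<close>

lemma measurable_strongly_connected:
  fixes G :: "nat \<Rightarrow> 'a \<Rightarrow> ('n::finite) wdigraph"
  assumes "finite T" and "\<And>t. t \<in> T \<Longrightarrow> G t \<in> N \<rightarrow>\<^sub>M wdigraph_space"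
  shows "{\<omega> \<in> space N. strongly_connected_edges (\<Union>t\<in>T. fst (G t \<omega>))} \<in> sets N"
proof -
  have [measurable]: "Measurable.pred N (\<lambda>\<omega>. \<exists>t\<in>T. e \<in> fst (G t \<omega>))" for e
    using assms measurable_edge[of _ N "fst e" "snd e"] by (intro pred_intros_finite) auto
  have "strongly_connected_edges (\<Union>t\<in>T. fst (G t \<omega>))
      \<longleftrightarrow> (\<exists>E\<in>{E. strongly_connected_edges E}. \<forall>e. (e \<in> E) = (\<exists>t\<in>T. e \<in> fst (G t \<omega>)))" for \<omega>
  proof
    assume "\<exists>E\<in>{E. strongly_connected_edges E}. \<forall>e. (e \<in> E) = (\<exists>t\<in>T. e \<in> fst (G t \<omega>))"
    then obtain E where E: "strongly_connected_edges E" "\<forall>e. (e \<in> E) = (\<exists>t\<in>T. e \<in> fst (G t \<omega>))"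
      by blast
    then have "E = (\<Union>t\<in>T. fst (G t \<omega>))" by blast
    with E(1) show "strongly_connected_edges (\<Union>t\<in>T. fst (G t \<omega>))" by simp
  next
    assume "strongly_connected_edges (\<Union>t\<in>T. fst (G t \<omega>))"
    then show "\<exists>E\<in>{E. strongly_connected_edges E}. \<forall>e. (e \<in> E) = (\<exists>t\<in>T. e \<in> fst (G t \<omega>))"
      by (intro bexI[of _ "\<Union>t\<in>T. fst (G t \<omega>)"]) simp_all
  qed
  moreover have "Measurable.pred N (\<lambda>\<omega>. \<exists>E\<in>{E. strongly_connected_edges E}.
      \<forall>e. (e \<in> E) = (\<exists>t\<in>T. e \<in> fst (G t \<omega>)))"
  proof (intro pred_intros_finite(4) finite)
    fix E :: "('n \<times> 'n) set"
    have "Measurable.pred N (\<lambda>\<omega>. \<forall>e\<in>UNIV. (e \<in> E) = (\<exists>t\<in>T. e \<in> fst (G t \<omega>)))"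
      by (intro pred_intros_finite(3) finite) measurable
    then show "Measurable.pred N (\<lambda>\<omega>. \<forall>e. (e \<in> E) = (\<exists>t\<in>T. e \<in> fst (G t \<omega>)))" by simp
  qed
  ultimately show ?thesis by (simp add: pred_def)
qed

text \<open>
  The quantity \<open>t * v\<close> does not grow over blocks of length \<open>K\<close> that start after time \<open>T0\<close>.  The
  constant absorbs the time before \<open>T0\<close> and the first incomplete block.
\<close>

lemma block_decay:
  fixes v :: "nat \<Rightarrow> real"
  assumes nonneg: "\<And>k. 0 \<le> v k" and mono: "\<And>k. v (Suc k) \<le> v k"
    and s: "1 \<le> s" and T0: "1 \<le> T0"
    and block: "\<And>k. T0 \<le> s + k \<Longrightarrow> real (s + k + K) * v (k + K) \<le> real (s + k) * v k"
    and K: "1 \<le> K"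
  shows "real (s + k) * v k \<le> real (T0 + K) * real s * v 0"
proof (induction k rule: less_induct)
  case (less k)
  have le0: "v k \<le> v 0" using lift_Suc_antimono_le[of v 0 k] mono by blast
  consider "s + k \<le> T0 + K" | "k < K" | "K \<le> k" "T0 \<le> s + (k - K)" by linarith
  then show ?case
  proof cases
    case 1
    then have "real (s + k) * v k \<le> real (T0 + K) * v 0"
      using le0 nonneg by (intro mult_mono) auto
    also have "\<dots> \<le> real (T0 + K) * real s * v 0"
      using s nonneg[of 0] by (intro mult_right_mono) (auto simp: mult_le_cancel_left1)
    finally show ?thesis .
  next
    case 2
    have "s + k \<le> (T0 + K) * s"
    proof -
      have "s + k \<le> 1 * s + K * s" using 2 s K by (intro add_mono) (auto intro: order.trans[of k K])
      also have "\<dots> \<le> (T0 + K) * s" using T0 by (simp add: algebra_simps)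
      finally show ?thesis .
    qed
    then have "real (s + k) \<le> real (T0 + K) * real s" by (metis of_nat_le_iff of_nat_mult)
    then show ?thesis using le0 nonneg by (intro mult_mono) auto
  next
    case 3
    have "real (s + k) * v k \<le> real (s + (k - K)) * v (k - K)"
      using block[OF 3(2)] 3(1) by simp
    also have "\<dots> \<le> real (T0 + K) * real s * v 0" using less.IH[of "k - K"] 3(1) K by simp
    finally show ?thesis .
  qed
qed

text \<open>
  The state at time \<open>s + k\<close> is determined by the earlier topologies.  So conditioning on them
  decouples it from the event that the next \<open>K\<close> topologies have a strongly connected union, on which \<open>V\<close>
  contracts.
\<close>

lemma expectation_V_flow_block:
  fixes G :: "nat \<Rightarrow> 'a \<Rightarrow> ('n::finite) wdigraph"
  assumes "prob_space M"
    and G: "\<And>t. 1 \<le> t \<Longrightarrow> G t \<in> M \<rightarrow>\<^sub>M wdigraph_space"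
    and adm: "\<And>t \<omega>. 1 \<le> t \<Longrightarrow> \<omega> \<in> space M \<Longrightarrow> admissible (a t) (G t \<omega>)"
    and A1: "cond_A1' M G K \<mu> p"
    and s: "1 \<le> s" and a0: "0 \<le> a0" "a0 \<le> A" "\<And>l. l < K \<Longrightarrow> a0 \<le> a (s + k + l)"
  shows "(\<integral>\<omega>. V (flow a (\<lambda>t. G t \<omega>) s (k + K) y) \<partial>M)
     \<le> (1 - contraction_const CARD('n) K A * a0 * (p * real (s + k) powr (-\<mu>) * ln (real (s + k))))
        * (\<integral>\<omega>. V (flow a (\<lambda>t. G t \<omega>) s k y) \<partial>M)"
proof -
  interpret prob_space M by fact
  let ?Y = "\<lambda>k \<omega>. flow a (\<lambda>t. G t \<omega>) s k y"
  let ?t = "s + k"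
  define F where "F = generated_by M wdigraph_space G {1..<?t}"
  define E where "E = {\<omega> \<in> space M. strongly_connected_edges (\<Union>t'\<in>{?t..?t + K - 1}. fst (G t' \<omega>))}"
  define q where "q = p * real ?t powr (-\<mu>) * ln (real ?t)"
  define \<eta> where "\<eta> = contraction_const CARD('n) K A"
  have \<eta>: "0 \<le> \<eta>" by (simp add: \<eta>_def contraction_const_def)
  have K: "1 \<le> K" using A1 by (simp add: cond_A1'_def)
  have sub: "subalgebra M F"
    unfolding F_def by (rule subalgebra_generated_by) (use G in auto)
  interpret finite_measure_subalgebra M F by unfold_locales (fact sub)
  have GF: "G t \<in> F \<rightarrow>\<^sub>M wdigraph_space" if "t \<in> {1..<?t}" for t
    unfolding F_def using that G by (intro measurable_generated_by_component) (auto dest: measurable_space)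
  have VF: "(\<lambda>\<omega>. V (?Y k \<omega>)) \<in> borel_measurable F"
    using s by (intro measurable_V measurable_flow GF) auto
  have VM [measurable]: "(\<lambda>\<omega>. V (?Y l \<omega>)) \<in> borel_measurable M" for l
    using s by (intro measurable_V measurable_flow G) auto
  have bound: "V (?Y l \<omega>) \<le> V y" if "\<omega> \<in> space M" for l \<omega>
    using adm that s by (intro V_flow_le) auto
  have int: "integrable M (\<lambda>\<omega>. V (?Y l \<omega>))" for l
    by (rule integrable_const_bound[where B="V y"]) (auto simp: V_nonneg bound)
  have E [measurable]: "E \<in> sets M"
    unfolding E_def using s by (intro measurable_strongly_connected G) auto
  have intE: "integrable M (\<lambda>\<omega>. V (?Y k \<omega>) * indicator E \<omega>)"
    by (rule integrable_real_mult_indicator[OF E int])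
  note ce = real_cond_exp_intg[OF intE VF]
  have pt: "V (?Y (k + K) \<omega>) \<le> V (?Y k \<omega>) - \<eta> * a0 * (V (?Y k \<omega>) * indicator E \<omega>)"
    if \<omega>: "\<omega> \<in> space M" for \<omega>
  proof (cases "\<omega> \<in> E")
    case True
    have un: "(\<Union>l<K. fst (G (?t + l) \<omega>)) = (\<Union>t'\<in>{?t..?t + K - 1}. fst (G t' \<omega>))"
    proof -
      have "{?t..?t + K - 1} = {0 + ?t..<K + ?t}" using K by auto
      also have "\<dots> = (+) ?t ` {..<K}" by (simp only: image_add_atLeastLessThan lessThan_atLeast0)
      finally show ?thesis by simp
    qed
    have "V (flow a (\<lambda>t. G t \<omega>) ?t K (?Y k \<omega>)) \<le> (1 - \<eta> * a0) * V (?Y k \<omega>)"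
      unfolding \<eta>_def using True \<omega> s adm a0 un
      by (intro V_flow_contraction) (auto simp: E_def)
    then show ?thesis using True unfolding flow_add by (simp add: left_diff_distrib)
  next
    case False
    have "V (flow a (\<lambda>t. G t \<omega>) ?t K (?Y k \<omega>)) \<le> V (?Y k \<omega>)"
      using \<omega> s adm by (intro V_flow_le) auto
    then show ?thesis using False unfolding flow_add by simp
  qed
  have "q * expectation (\<lambda>\<omega>. V (?Y k \<omega>)) = expectation (\<lambda>\<omega>. V (?Y k \<omega>) * q)" by simp
  also have "\<dots> \<le> expectation (\<lambda>\<omega>. V (?Y k \<omega>) * real_cond_exp M F (indicator E) \<omega>)"
  proof (rule integral_mono_AE)
    show "integrable M (\<lambda>\<omega>. V (?Y k \<omega>) * q)" using int by simp
    show "integrable M (\<lambda>\<omega>. V (?Y k \<omega>) * real_cond_exp M F (indicator E) \<omega>)"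
      by (rule ce(1)) measurable
    have "1 \<le> ?t" using s by simp
    then have "AE \<omega> in M. q \<le> real_cond_exp M F (indicator E) \<omega>"
      using A1 unfolding cond_A1'_def F_def E_def q_def by blast
    then show "AE \<omega> in M. V (?Y k \<omega>) * q \<le> V (?Y k \<omega>) * real_cond_exp M F (indicator E) \<omega>"
      by eventually_elim (intro mult_left_mono V_nonneg)
  qed
  also have "\<dots> = expectation (\<lambda>\<omega>. V (?Y k \<omega>) * indicator E \<omega>)"
    by (rule ce(2)) measurable
  finally have cond: "q * expectation (\<lambda>\<omega>. V (?Y k \<omega>)) \<le> expectation (\<lambda>\<omega>. V (?Y k \<omega>) * indicator E \<omega>)" .
  have "expectation (\<lambda>\<omega>. V (?Y (k + K) \<omega>))
      \<le> expectation (\<lambda>\<omega>. V (?Y k \<omega>) - \<eta> * a0 * (V (?Y k \<omega>) * indicator E \<omega>))"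
    using int intE pt by (intro integral_mono) auto
  also have "\<dots> = expectation (\<lambda>\<omega>. V (?Y k \<omega>)) - \<eta> * a0 * expectation (\<lambda>\<omega>. V (?Y k \<omega>) * indicator E \<omega>)"
    using int intE by simp
  also have "\<dots> \<le> expectation (\<lambda>\<omega>. V (?Y k \<omega>)) - \<eta> * a0 * (q * expectation (\<lambda>\<omega>. V (?Y k \<omega>)))"
    using cond \<eta> a0 by (intro diff_left_mono mult_left_mono) auto
  finally show ?thesis unfolding \<eta>_def q_def by (simp add: algebra_simps)
qed

text \<open>
  The gain contributes \<open>t powr (\<mu> - 1)\<close> and the probability of a connected block contributes
  \<open>t powr (- \<mu>) * ln t\<close>, so a block starting at time \<open>t\<close> multiplies the expectation of \<open>V\<close> by at most
  \<open>1 - const * ln t / (t + K)\<close>.  Because of the logarithm this is eventually at most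
  \<open>1 - K / (t + K) = t / (t + K)\<close>, and these factors telescope to a decay like \<open>s / (s + k)\<close>.
\<close>

lemma expectation_V_flow_decay:
  fixes G :: "nat \<Rightarrow> 'a \<Rightarrow> ('n::finite) wdigraph"
  assumes "prob_space M"
    and G: "\<And>t. 1 \<le> t \<Longrightarrow> G t \<in> M \<rightarrow>\<^sub>M wdigraph_space"
    and adm: "\<And>t \<omega>. 1 \<le> t \<Longrightarrow> \<omega> \<in> space M \<Longrightarrow> admissible (a t) (G t \<omega>)"
    and A1: "cond_A1' M G K \<mu> p"
    and b: "0 < b" "\<And>t. 1 \<le> t \<Longrightarrow> b * real t powr (\<mu> - 1) \<le> a t"
  shows "\<exists>C\<ge>0. \<forall>s\<ge>1. \<forall>k y.
     real (s + k) * (\<integral>\<omega>. V (flow a (\<lambda>t. G t \<omega>) s k y) \<partial>M) \<le> C * real s * V y"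
proof -
  interpret prob_space M by fact
  have K: "1 \<le> K" and \<mu>: "0 < \<mu>" "\<mu> < 1/2" and p: "0 < p" using A1 by (simp_all add: cond_A1'_def)
  define \<eta> where "\<eta> = contraction_const CARD('n) K b"
  have \<eta>: "0 < \<eta>"
  proof -
    have "0 \<le> 2 * real K * sqrt b" using b by simp
    then have "2 * real K * sqrt b + 2 \<noteq> 0" by linarith
    then show ?thesis by (simp add: \<eta>_def contraction_const_def)
  qed
  \<comment> \<open>From \<open>T0\<close> on, \<open>\<eta> * b * p * ln t\<close> is at least \<open>K\<close>, as the factor \<open>t / (t + K)\<close> requires.\<close>
  define T0 where "T0 = Suc (nat \<lceil>exp (real K / (\<eta> * b * p))\<rceil>)"
  have T0: "1 \<le> T0" by (simp add: T0_def)
  have log_large: "real K \<le> \<eta> * b * p * ln (real t)" if "T0 \<le> t" for t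
  proof -
    have "exp (real K / (\<eta> * b * p)) \<le> real t" using that unfolding T0_def by linarith
    then have "real K / (\<eta> * b * p) \<le> ln (real t)"
      using that T0 by (subst ln_ge_iff) auto
    then show ?thesis using \<eta> b p by (simp add: pos_divide_le_eq mult_ac)
  qed
  have "real (s + k) * expectation (\<lambda>\<omega>. V (flow a (\<lambda>t. G t \<omega>) s k y)) \<le> real (T0 + K) * real s * V y"
    if s: "1 \<le> s" for s k y
  proof -
    let ?Y = "\<lambda>k \<omega>. flow a (\<lambda>t. G t \<omega>) s k y"
    define v where "v k = expectation (\<lambda>\<omega>. V (?Y k \<omega>))" for k
    have VM [measurable]: "(\<lambda>\<omega>. V (?Y l \<omega>)) \<in> borel_measurable M" for l
      using s by (intro measurable_V measurable_flow G) auto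
    have bound: "V (?Y l \<omega>) \<le> V y" if "\<omega> \<in> space M" for l \<omega>
      using adm that s by (intro V_flow_le) auto
    have int: "integrable M (\<lambda>\<omega>. V (?Y l \<omega>))" for l
      by (rule integrable_const_bound[where B="V y"]) (auto simp: V_nonneg bound)
    have v0: "v 0 = V y" by (simp add: v_def prob_space)
    have vnn: "0 \<le> v k" for k by (simp add: v_def V_nonneg)
    have "real (s + k) * v k \<le> real (T0 + K) * real s * v 0"
    proof (rule block_decay[OF vnn _ s T0 _ K])
      fix k
      show "v (Suc k) \<le> v k"
        unfolding v_def using s adm by (intro integral_mono int) (auto intro: V_consensus_step_mono)
    next
      fix k assume k: "T0 \<le> s + k"
      define t where "t = s + k"
      have t: "1 \<le> t" "T0 \<le> t" using s k by (simp_all add: t_def)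
      define a0 where "a0 = b * real (t + K) powr (\<mu> - 1)"
      have "a0 \<le> b * 1"
        unfolding a0_def using b \<mu> t powr_mono[of "\<mu> - 1" 0 "real (t + K)"] by (intro mult_left_mono) auto
      then have a0b: "a0 \<le> b" by simp
      have a0a: "a0 \<le> a (s + k + l)" if "l < K" for l
      proof -
        have "a0 \<le> b * real (t + l) powr (\<mu> - 1)"
          unfolding a0_def using b \<mu> t that by (intro mult_left_mono powr_mono2') auto
        also have "\<dots> \<le> a (t + l)" using b(2)[of "t + l"] t by simp
        finally show ?thesis by (simp add: t_def)
      qed
      have blk: "v (k + K) \<le> (1 - \<eta> * a0 * (p * real t powr (-\<mu>) * ln (real t))) * v k"
        unfolding v_def \<eta>_def t_def
        by (rule expectation_V_flow_block[OF assms(1) G adm A1 s])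
          (use a0b a0a b in \<open>auto simp: a0_def\<close>)
      have "real K / real (t + K) \<le> \<eta> * b * p * ln (real t) * (real (t + K) powr (\<mu> - 1) * real (t + K) powr (-\<mu>))"
      proof -
        have "real (t + K) powr (\<mu> - 1) * real (t + K) powr (-\<mu>) = 1 / real (t + K)"
        proof -
          have "\<mu> - 1 + - \<mu> = - 1" by simp
          then show ?thesis unfolding powr_add[symmetric] using t by (simp add: powr_minus_divide)
        qed
        then show ?thesis using log_large[OF t(2)] by (simp add: divide_right_mono)
      qed
      also have "\<dots> \<le> \<eta> * b * p * ln (real t) * (real (t + K) powr (\<mu> - 1) * real t powr (-\<mu>))"
        using \<eta> b p t \<mu> by (intro mult_left_mono powr_mono2') auto
      also have "\<dots> = \<eta> * a0 * (p * real t powr (-\<mu>) * ln (real t))" by (simp add: a0_def mult_ac)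
      finally have "(1 - \<eta> * a0 * (p * real t powr (-\<mu>) * ln (real t))) * v k \<le> (1 - real K / real (t + K)) * v k"
        using vnn by (intro mult_right_mono) auto
      also have "\<dots> = real t / real (t + K) * v k" using t by (simp add: field_simps)
      finally have "v (k + K) \<le> real t / real (t + K) * v k" using blk by simp
      then have "real (t + K) * v (k + K) \<le> real t * v k"
        using t by (simp add: pos_le_divide_eq mult.commute)
      then show "real (s + k + K) * v (k + K) \<le> real (s + k) * v k" unfolding t_def .
    qed
    then show ?thesis unfolding v0 by (simp add: v_def)
  qed
  then show ?thesis by (intro exI[of _ "real (T0 + K)"]) auto
qed


section \<open>Conditional laws and limits in mean square\<close>

text \<open>
  The definition of a conditional distribution gives the joint law on rectangles.  They generate the
  product sigma-algebra, so the joint law is the composition of the law of \<open>Y\<close> with the kernel.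
\<close>

lemma regular_cond_distr_nn_integral:
  assumes "prob_space M" and rcd: "regular_cond_distr M T Y N Z \<kappa>"
    and f [measurable]: "f \<in> borel_measurable (T \<Otimes>\<^sub>M N)"
  shows "(\<integral>\<^sup>+\<omega>. f (Y \<omega>, Z \<omega>) \<partial>M) = (\<integral>\<^sup>+\<omega>. (\<integral>\<^sup>+z. f (Y \<omega>, z) \<partial>\<kappa> (Y \<omega>)) \<partial>M)"
proof -
  interpret prob_space M by fact
  have Y [measurable]: "Y \<in> M \<rightarrow>\<^sub>M T" and Z [measurable]: "Z \<in> M \<rightarrow>\<^sub>M N" and \<kappa>: "\<kappa> \<in> T \<rightarrow>\<^sub>M prob_algebra N"
    using rcd by (simp_all add: regular_cond_distr_def)
  have \<kappa>' [measurable]: "\<kappa> \<in> T \<rightarrow>\<^sub>M subprob_algebra N" using \<kappa> by (rule measurable_prob_algebraD)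
  have sets\<kappa>: "sets (\<kappa> y) = sets N" if "y \<in> space T" for y
    using measurable_space[OF \<kappa> that] by (simp add: space_prob_algebra)
  define D where "D y = distr (\<kappa> y) (T \<Otimes>\<^sub>M N) (Pair y)" for y
  have D: "D \<in> T \<rightarrow>\<^sub>M subprob_algebra (T \<Otimes>\<^sub>M N)"
    unfolding D_def[abs_def] by (rule measurable_distr2[OF _ \<kappa>']) simp
  have Pair: "Pair y \<in> \<kappa> y \<rightarrow>\<^sub>M T \<Otimes>\<^sub>M N" if "y \<in> space T" for y
    using that by (simp add: measurable_cong_sets[OF sets\<kappa>[OF that] refl])
  define P1 where "P1 = distr M (T \<Otimes>\<^sub>M N) (\<lambda>\<omega>. (Y \<omega>, Z \<omega>))"
  define P2 where "P2 = distr M T Y \<bind> D"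
  have ne: "space (distr M T Y) \<noteq> {}" using measurable_space[OF Y] not_empty by auto
  have D': "D \<in> distr M T Y \<rightarrow>\<^sub>M subprob_algebra (T \<Otimes>\<^sub>M N)" using D by simp
  have eq: "P1 = P2"
  proof (rule measure_eqI_generator_eq[where \<Omega>="space T \<times> space N"
        and E="{a \<times> b | a b. a \<in> sets T \<and> b \<in> sets N}" and A="\<lambda>_. space T \<times> space N"])
    show "sets P2 = sigma_sets (space T \<times> space N) {a \<times> b | a b. a \<in> sets T \<and> b \<in> sets N}"
    proof -
      have "sets P2 = sets (T \<Otimes>\<^sub>M N)" unfolding P2_def by (rule sets_bind[OF _ ne]) (simp add: D_def)
      then show ?thesis by (simp add: sets_pair_measure)
    qed
    interpret P1: prob_space P1 unfolding P1_def by (rule prob_space_distr) simp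
    show "emeasure P1 (space T \<times> space N) \<noteq> \<infinity>" by simp
    fix X assume "X \<in> {a \<times> b | a b. a \<in> sets T \<and> b \<in> sets N}"
    then obtain A B where X: "X = A \<times> B" and [measurable]: "A \<in> sets T" "B \<in> sets N" by auto
    have "emeasure P1 X = emeasure M {\<omega> \<in> space M. Y \<omega> \<in> A \<and> Z \<omega> \<in> B}"
      unfolding P1_def X by (subst emeasure_distr) (auto intro!: arg_cong[where f="emeasure M"])
    also have "\<dots> = (\<integral>\<^sup>+\<omega>. emeasure (\<kappa> (Y \<omega>)) B * indicator A (Y \<omega>) \<partial>M)"
      using rcd by (simp add: regular_cond_distr_def)
    also have "\<dots> = (\<integral>\<^sup>+\<omega>. emeasure (D (Y \<omega>)) X \<partial>M)"
    proof (rule nn_integral_cong)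
      fix \<omega> assume "\<omega> \<in> space M"
      then have y: "Y \<omega> \<in> space T" using measurable_space[OF Y] by blast
      have "emeasure (D (Y \<omega>)) X = emeasure (\<kappa> (Y \<omega>)) (Pair (Y \<omega>) -` (A \<times> B) \<inter> space (\<kappa> (Y \<omega>)))"
        unfolding D_def X by (rule emeasure_distr[OF Pair[OF y]]) simp
      also have "Pair (Y \<omega>) -` (A \<times> B) \<inter> space (\<kappa> (Y \<omega>)) = (if Y \<omega> \<in> A then B else {})"
        using sets.sets_into_space[of B N] sets_eq_imp_space_eq[OF sets\<kappa>[OF y]] by auto
      finally show "emeasure (\<kappa> (Y \<omega>)) B * indicator A (Y \<omega>) = emeasure (D (Y \<omega>)) X" by simp
    qed
    also have "\<dots> = emeasure P2 X"
      unfolding P2_def X by (subst emeasure_bind[OF ne D'])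
        (auto intro!: nn_integral_distr[symmetric] measurable_emeasure_kernel[OF D])
    finally show "emeasure P1 X = emeasure P2 X" .
  qed (use pair_measure_closed[of T N] in \<open>auto simp: Int_stable_pair_measure_generator P1_def sets_pair_measure\<close>)
  have "(\<integral>\<^sup>+\<omega>. f (Y \<omega>, Z \<omega>) \<partial>M) = (\<integral>\<^sup>+x. f x \<partial>P1)"
    unfolding P1_def by (subst nn_integral_distr) auto
  also have "\<dots> = (\<integral>\<^sup>+y. \<integral>\<^sup>+x. f x \<partial>D y \<partial>distr M T Y)"
    unfolding eq P2_def by (rule nn_integral_bind[OF f D'])
  also have "\<dots> = (\<integral>\<^sup>+\<omega>. \<integral>\<^sup>+x. f x \<partial>D (Y \<omega>) \<partial>M)"
    by (rule nn_integral_distr[OF Y]) (use D in simp)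
  also have "\<dots> = (\<integral>\<^sup>+\<omega>. (\<integral>\<^sup>+z. f (Y \<omega>, z) \<partial>\<kappa> (Y \<omega>)) \<partial>M)"
  proof (rule nn_integral_cong)
    fix \<omega> assume "\<omega> \<in> space M"
    then have y: "Y \<omega> \<in> space T" using measurable_space[OF Y] by blast
    show "(\<integral>\<^sup>+x. f x \<partial>D (Y \<omega>)) = (\<integral>\<^sup>+z. f (Y \<omega>, z) \<partial>\<kappa> (Y \<omega>))"
      unfolding D_def by (rule nn_integral_distr[OF Pair[OF y]]) simp
  qed
  finally show ?thesis .
qed

lemma lex_le_iff:
  "lex_le e e' \<longleftrightarrow> fst e < fst e' \<or> fst e = fst e' \<and>
     (snd (snd e) < snd (snd e') \<or> snd (snd e) = snd (snd e') \<and> fst (snd e) \<le> fst (snd e'))"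
  by (cases e; cases e') simp

text \<open>
  Every active triple has only finitely many predecessors, so the number of predecessors increases
  strictly along the sequence.
\<close>

lemma inj_on_noise_pos:
  fixes g :: "nat \<Rightarrow> ('n::{finite,linorder}) wdigraph"
  shows "inj_on (noise_pos g) (active g)"
proof (rule inj_onI, rule ccontr)
  have less: "noise_pos g e < noise_pos g e'"
    if e: "e \<in> active g" "e' \<in> active g" "e \<noteq> e'" "lex_le e e'" for e e' :: "nat \<times> 'n \<times> 'n"
    unfolding noise_pos_def
  proof (rule psubset_card_mono)
    have "{e'' \<in> active g. lex_le e'' e'} \<subseteq> {..fst e'} \<times> UNIV"
      by (auto simp: lex_le_iff)
    then show "finite {e'' \<in> active g. lex_le e'' e'}" by (rule finite_subset) simp
    have "\<not> lex_le e' e" using e(3,4) by (auto simp: lex_le_iff prod_eq_iff)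
    moreover have "lex_le e' e'" by (simp add: lex_le_iff)
    moreover have "lex_le e'' e'" if "lex_le e'' e" for e''
      using that e(4) unfolding lex_le_iff by auto
    ultimately show "{e'' \<in> active g. lex_le e'' e} \<subset> {e'' \<in> active g. lex_le e'' e'}"
      using e by blast
  qed
  fix e e' assume e: "e \<in> active g" "e' \<in> active g" "noise_pos g e = noise_pos g e'" "e \<noteq> e'"
  have "lex_le e e' \<or> lex_le e' e" unfolding lex_le_iff by auto
  then show False using less[of e e'] less[of e' e] e by auto
qed

lemma active_subset_noise_index: "active g \<subseteq> noise_index"
  by (auto simp: active_def noise_index_def)

text \<open>
  In this form the vanishing of a mean can be passed through \<open>regular_cond_distr_nn_integral\<close>, which
  speaks of nonnegative functions.
\<close>

lemma nn_integral_pos_eq_neg: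
  fixes f :: "'a \<Rightarrow> real"
  assumes "integrable N f"
  shows "(\<integral>x. f x \<partial>N) = 0 \<longleftrightarrow> (\<integral>\<^sup>+x. ennreal (f x) \<partial>N) = (\<integral>\<^sup>+x. ennreal (- f x) \<partial>N)"
proof -
  have "(\<integral>\<^sup>+x. ennreal (f x) \<partial>N) \<noteq> \<infinity>" "(\<integral>\<^sup>+x. ennreal (- f x) \<partial>N) \<noteq> \<infinity>"
    using assms by (auto simp: real_integrable_def)
  then have "(\<integral>\<^sup>+x. ennreal (f x) \<partial>N) = (\<integral>\<^sup>+x. ennreal (- f x) \<partial>N)
      \<longleftrightarrow> enn2real (\<integral>\<^sup>+x. ennreal (f x) \<partial>N) = enn2real (\<integral>\<^sup>+x. ennreal (- f x) \<partial>N)"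
    by (metis ennreal_enn2real_if infinity_ennreal_def)
  then show ?thesis unfolding real_lebesgue_integral_def[OF assms] by simp
qed

text \<open>
  Completeness of \<open>L\<^sup>2\<close> with an explicit rate.  A subsequence converges almost everywhere, and
  Fatou's lemma transfers the bound on the increments to the limit.
\<close>

lemma L2_limit_exists:
  fixes X :: "nat \<Rightarrow> 'a \<Rightarrow> real"
  assumes "prob_space M" and meas [measurable]: "\<And>k. X k \<in> borel_measurable M"
    and sq: "\<And>k. integrable M (\<lambda>\<omega>. (X k \<omega>)\<^sup>2)"
    and incr: "\<And>k l. k \<le> l \<Longrightarrow> (\<integral>\<omega>. (X l \<omega> - X k \<omega>)\<^sup>2 \<partial>M) \<le> \<epsilon> k" and \<epsilon>: "\<epsilon> \<longlonglongrightarrow> 0"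
  obtains Z where "Z \<in> borel_measurable M" "integrable M Z" "integrable M (\<lambda>\<omega>. (Z \<omega>)\<^sup>2)"
    "\<And>k. (\<integral>\<^sup>+\<omega>. ennreal ((X k \<omega> - Z \<omega>)\<^sup>2) \<partial>M) \<le> ennreal (\<epsilon> k)"
    "(\<lambda>k. \<integral>\<omega>. X k \<omega> \<partial>M) \<longlonglongrightarrow> (\<integral>\<omega>. Z \<omega> \<partial>M)"
proof -
  interpret prob_space M by fact
  have int: "integrable M (X k)" for k
    by (rule square_integrable_imp_integrable[OF meas sq])
  have dsq: "integrable M (\<lambda>\<omega>. (X l \<omega> - X k \<omega>)\<^sup>2)" for k l
    using integrable_add_square[of "X l" M "\<lambda>\<omega>. - X k \<omega>"] sq by simp
  have abs_le: "expectation (\<lambda>\<omega>. \<bar>f \<omega>\<bar>) \<le> sqrt (expectation (\<lambda>\<omega>. (f \<omega>)\<^sup>2))"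
    if "f \<in> borel_measurable M" "integrable M (\<lambda>\<omega>. (f \<omega>)\<^sup>2)" for f :: "'a \<Rightarrow> real"
  proof -
    have "\<bar>expectation (\<lambda>\<omega>. \<bar>f \<omega>\<bar> * 1)\<bar> \<le> sqrt (expectation (\<lambda>\<omega>. (\<bar>f \<omega>\<bar>)\<^sup>2) * expectation (\<lambda>\<omega>. 1\<^sup>2))"
      using that by (intro abs_integral_mult_le) auto
    then show ?thesis by (simp add: prob_space)
  qed
  have L1: "expectation (\<lambda>\<omega>. \<bar>X l \<omega> - X k \<omega>\<bar>) \<le> sqrt (\<epsilon> k)" if "k \<le> l" for k l
    using abs_le[OF borel_measurable_diff[OF meas meas] dsq[of l k]] real_sqrt_le_mono[OF incr[OF that]]
    by linarith
  have cauchy: "\<exists>N. \<forall>i\<ge>N. \<forall>j\<ge>N. expectation (\<lambda>\<omega>. norm (X i \<omega> - X j \<omega>)) < e" if "e > 0" for e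
  proof -
    from \<epsilon> \<open>e > 0\<close> have "\<forall>\<^sub>F k in sequentially. \<epsilon> k < e\<^sup>2"
      by (intro order_tendstoD(2)) auto
    then obtain N where N: "\<And>k. N \<le> k \<Longrightarrow> \<epsilon> k < e\<^sup>2" by (auto simp: eventually_sequentially)
    have lt: "expectation (\<lambda>\<omega>. \<bar>X l \<omega> - X k \<omega>\<bar>) < e" if "N \<le> k" "k \<le> l" for k l
    proof -
      have "sqrt (\<epsilon> k) < sqrt (e\<^sup>2)" using N[OF that(1)] by (rule real_sqrt_less_mono)
      then show ?thesis using L1[OF that(2)] \<open>e > 0\<close> by simp
    qed
    have "expectation (\<lambda>\<omega>. norm (X i \<omega> - X j \<omega>)) < e" if "N \<le> i" "N \<le> j" for i j
      using lt[of i j] lt[of j i] that by (cases "i \<le> j") (simp_all add: abs_minus_commute)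
    then show ?thesis by blast
  qed
  obtain r where r: "strict_mono r" "AE \<omega> in M. Cauchy (\<lambda>i. X (r i) \<omega>)"
    using cauchy_L1_AE_cauchy_subseq[of M X, OF int cauchy] by blast
  define Z where "Z \<omega> = lim (\<lambda>i. X (r i) \<omega>)" for \<omega>
  have Z [measurable]: "Z \<in> borel_measurable M"
    unfolding Z_def[abs_def] by (rule borel_measurable_lim_metric) simp
  have conv: "AE \<omega> in M. (\<lambda>i. X (r i) \<omega>) \<longlonglongrightarrow> Z \<omega>"
    using r(2) by eventually_elim (simp add: Z_def convergent_LIMSEQ_iff[symmetric] Cauchy_convergent)
  have bound: "(\<integral>\<^sup>+\<omega>. ennreal ((X k \<omega> - Z \<omega>)\<^sup>2) \<partial>M) \<le> ennreal (\<epsilon> k)" for k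
  proof -
    have "(\<integral>\<^sup>+\<omega>. ennreal ((X k \<omega> - Z \<omega>)\<^sup>2) \<partial>M)
        = (\<integral>\<^sup>+\<omega>. liminf (\<lambda>i. ennreal ((X k \<omega> - X (r i) \<omega>)\<^sup>2)) \<partial>M)"
    proof (rule nn_integral_cong_AE)
      show "AE \<omega> in M. ennreal ((X k \<omega> - Z \<omega>)\<^sup>2) = liminf (\<lambda>i. ennreal ((X k \<omega> - X (r i) \<omega>)\<^sup>2))"
        using conv
      proof eventually_elim
        case (elim \<omega>)
        then have "(\<lambda>i. ennreal ((X k \<omega> - X (r i) \<omega>)\<^sup>2)) \<longlonglongrightarrow> ennreal ((X k \<omega> - Z \<omega>)\<^sup>2)"
          by (intro tendsto_ennrealI tendsto_intros)
        then show ?case by (intro lim_imp_Liminf[symmetric]) auto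
      qed
    qed
    also have "\<dots> \<le> liminf (\<lambda>i. \<integral>\<^sup>+\<omega>. ennreal ((X k \<omega> - X (r i) \<omega>)\<^sup>2) \<partial>M)"
      by (rule nn_integral_liminf) simp
    also have "\<dots> \<le> ennreal (\<epsilon> k)"
    proof (rule Liminf_le)
      have "(\<integral>\<^sup>+\<omega>. ennreal ((X k \<omega> - X (r i) \<omega>)\<^sup>2) \<partial>M) \<le> ennreal (\<epsilon> k)" if "k \<le> i" for i
      proof -
        have "k \<le> r i" using that seq_suble[OF r(1), of i] by simp
        then have "expectation (\<lambda>\<omega>. (X k \<omega> - X (r i) \<omega>)\<^sup>2) \<le> \<epsilon> k"
          using incr[of k "r i"] by (simp add: power2_commute)
        then show ?thesis by (subst nn_integral_eq_integral[OF dsq]) (auto intro: ennreal_leI)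
      qed
      then show "\<forall>\<^sub>F i in sequentially. (\<integral>\<^sup>+\<omega>. ennreal ((X k \<omega> - X (r i) \<omega>)\<^sup>2) \<partial>M) \<le> ennreal (\<epsilon> k)"
        unfolding eventually_sequentially by blast
    qed simp
    finally show ?thesis .
  qed
  have diff: "integrable M (\<lambda>\<omega>. (X k \<omega> - Z \<omega>)\<^sup>2)" for k
    using bound[of k] by (intro integrableI_bounded) (auto simp: le_less_trans[OF _ ennreal_less_top])
  have Zsq: "integrable M (\<lambda>\<omega>. (Z \<omega>)\<^sup>2)"
    using integrable_add_square[of "\<lambda>\<omega>. - (X 0 \<omega> - Z \<omega>)" M "X 0"] diff[of 0] sq[of 0]
    by (simp add: power2_commute)
  then have Zint: "integrable M Z" by (rule square_integrable_imp_integrable[OF Z])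
  have "(\<lambda>k. expectation (X k) - expectation Z) \<longlonglongrightarrow> 0"
  proof (rule Lim_null_comparison)
    show "(\<lambda>k. sqrt (\<epsilon> k)) \<longlonglongrightarrow> 0" using tendsto_real_sqrt[OF \<epsilon>] by simp
    have "norm (expectation (X k) - expectation Z) \<le> sqrt (\<epsilon> k)" for k
    proof -
      have "0 \<le> \<epsilon> k" using incr[of k k] by simp
      then have "expectation (\<lambda>\<omega>. (X k \<omega> - Z \<omega>)\<^sup>2) \<le> \<epsilon> k"
        using bound[of k] by (subst (asm) nn_integral_eq_integral[OF diff]) auto
      moreover have "\<bar>expectation (\<lambda>\<omega>. X k \<omega> - Z \<omega>)\<bar> \<le> expectation (\<lambda>\<omega>. \<bar>X k \<omega> - Z \<omega>\<bar>)"
        by (rule integral_abs_bound)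
      moreover have "expectation (\<lambda>\<omega>. \<bar>X k \<omega> - Z \<omega>\<bar>) \<le> sqrt (expectation (\<lambda>\<omega>. (X k \<omega> - Z \<omega>)\<^sup>2))"
        by (rule abs_le[OF _ diff]) simp
      ultimately show ?thesis using int Zint real_sqrt_le_mono by (fastforce intro: order.trans)
    qed
    then show "\<forall>\<^sub>F k in sequentially. norm (expectation (X k) - expectation Z) \<le> sqrt (\<epsilon> k)" by simp
  qed
  then have "(\<lambda>k. expectation (X k)) \<longlonglongrightarrow> expectation Z" by (rule LIM_zero_cancel)
  with that[OF Z Zint Zsq bound] show thesis by blast
qed


section \<open>Linear response to the noise\<close>

lemma sum_UNIV_prod:
  fixes F :: "'b::finite \<times> 'c::finite \<Rightarrow> 'd::comm_monoid_add"
  shows "(\<Sum>e\<in>UNIV. F e) = (\<Sum>j\<in>UNIV. \<Sum>i\<in>UNIV. F (j, i))"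
  by (simp add: sum.cartesian_product)

text \<open>
  The system without (A1').  Of the gain only admissibility is recorded; its decay in time and the
  contraction of the noise-free system enter the lemmas as hypotheses.
\<close>

locale noisy_consensus = prob_space M for M :: "'a measure" +
  fixes G :: "nat \<Rightarrow> 'a \<Rightarrow> ('n::{finite,linorder}) wdigraph"
    and w :: "nat \<Rightarrow> 'n::{finite,linorder} \<Rightarrow> 'n \<Rightarrow> 'a \<Rightarrow> real"
    and a :: "nat \<Rightarrow> real" and amax :: real
    and x :: "nat \<Rightarrow> 'a \<Rightarrow> real ^ ('n::{finite,linorder})"
    and x1 :: "real ^ ('n::{finite,linorder})"
  assumes measurable_G: "1 \<le> t \<Longrightarrow> G t \<in> M \<rightarrow>\<^sub>M wdigraph_space"
    and measurable_w: "1 \<le> t \<Longrightarrow> w t j i \<in> borel_measurable M"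
    and weights: "1 \<le> t \<Longrightarrow> \<omega> \<in> space M \<Longrightarrow> weights_within amax (G t \<omega>)"
    and adm: "1 \<le> t \<Longrightarrow> \<omega> \<in> space M \<Longrightarrow> admissible (a t) (G t \<omega>)"
    and A3: "cond_A3 M G w"
    and initial: "\<omega> \<in> space M \<Longrightarrow> x 1 \<omega> = x1"
    and dynamics: "follows_dynamics M G w a x"
begin

definition topologies :: "'a \<Rightarrow> nat \<Rightarrow> 'n wdigraph" where
  "topologies \<omega> = (\<lambda>t\<in>{1..}. G t \<omega>)"

definition noises :: "'a \<Rightarrow> nat \<times> 'n \<times> 'n \<Rightarrow> real" where
  "noises \<omega> = (\<lambda>(t, j, i)\<in>noise_index. w t j i \<omega>)"

text \<open>
  All random quantities below are linear in the noise once the topologies \<open>g\<close> are fixed; \<open>c g e\<close> is the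
  coefficient of the noise \<open>z e\<close>.
\<close>

definition active_sum :: "(nat \<times> 'n \<times> 'n) set \<Rightarrow>
    ((nat \<Rightarrow> 'n wdigraph) \<Rightarrow> nat \<times> 'n \<times> 'n \<Rightarrow> real) \<Rightarrow>
    (nat \<Rightarrow> 'n wdigraph) \<Rightarrow> (nat \<times> 'n \<times> 'n \<Rightarrow> real) \<Rightarrow> real" where
  "active_sum J c g z = (\<Sum>e\<in>J. if e \<in> active g then c g e * z e else 0)"

lemma measurable_active:
  assumes "e \<in> noise_index"
  shows "Measurable.pred topology_seq_space (\<lambda>g :: nat \<Rightarrow> 'n wdigraph. e \<in> active g)"
proof -
  obtain t j i where e: "e = (t, j, i)" "1 \<le> t" using assms by (auto simp: noise_index_def)
  have "(\<lambda>g. g t) \<in> topology_seq_space \<rightarrow>\<^sub>M wdigraph_space"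
    unfolding topology_seq_space_def using e by (intro measurable_component_singleton) auto
  from measurable_edge[OF this, of j i] show ?thesis
    using e by (simp add: active_def neighbors_def)
qed

lemma measurable_active_sum:
  fixes c :: "(nat \<Rightarrow> 'n wdigraph) \<Rightarrow> nat \<times> 'n \<times> 'n \<Rightarrow> real"
  assumes "finite J" "J \<subseteq> noise_index"
    and "\<And>e. e \<in> J \<Longrightarrow> (\<lambda>g. c g e) \<in> borel_measurable topology_seq_space"
  shows "(\<lambda>(g, z). active_sum J c g z) \<in> borel_measurable (topology_seq_space \<Otimes>\<^sub>M noise_space)"
  unfolding active_sum_def split_beta
proof (rule borel_measurable_sum)
  fix e assume e: "e \<in> J"
  then have i: "e \<in> noise_index" using assms by auto
  have z: "(\<lambda>z. z e) \<in> borel_measurable noise_space"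
    unfolding noise_space_def using i by (rule measurable_component_singleton)
  have "(\<lambda>p. c (fst p) e * snd p e) \<in> borel_measurable (topology_seq_space \<Otimes>\<^sub>M noise_space)"
    by (intro borel_measurable_times measurable_compose[OF measurable_fst assms(3)[OF e]]
        measurable_compose[OF measurable_snd z])
  then show "(\<lambda>p. if e \<in> active (fst p) then c (fst p) e * snd p e else 0)
      \<in> borel_measurable (topology_seq_space \<Otimes>\<^sub>M noise_space)"
    using measurable_compose[OF measurable_fst measurable_active[OF i]]
    by (intro measurable_If) (simp_all add: pred_def)
qed

lemma topologies_apply: "1 \<le> t \<Longrightarrow> topologies \<omega> t = G t \<omega>"
  by (simp add: topologies_def)

lemma noises_apply: "1 \<le> t \<Longrightarrow> noises \<omega> (t, j, i) = w t j i \<omega>"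
  by (simp add: noises_def noise_index_def)

lemma active_topologies: "(t, j, i) \<in> active (topologies \<omega>) \<longleftrightarrow> 1 \<le> t \<and> j \<in> neighbors (G t \<omega>) i"
  by (auto simp: active_def topologies_def)

text \<open>
  The bounds \<open>v\<close> and \<open>r\<close> of (A3) may be negative; enlarged to nonnegative numbers they remain valid.
\<close>

lemma noise_law:
  "\<exists>\<kappa> v m r. regular_cond_distr M topology_seq_space topologies noise_space noises \<kappa> \<and>
     0 \<le> v \<and> 0 < m \<and> 0 \<le> r \<and> r < 1 \<and>
     (\<forall>g\<in>space topology_seq_space.
        (\<forall>e\<in>active g. integrable (\<kappa> g) (\<lambda>z. (z e)\<^sup>2) \<and> (\<integral>z. z e \<partial>\<kappa> g) = 0 \<and> (\<integral>z. (z e)\<^sup>2 \<partial>\<kappa> g) \<le> v) \<and>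
        rho_tilde (\<kappa> g) (active g) (noise_pos g) (\<lambda>e z. z e) m \<le> r)"
proof -
  from A3 obtain \<kappa> v m r where *:
    "regular_cond_distr M topology_seq_space topologies noise_space noises \<kappa>"
    "0 < m" "r < 1"
    "\<And>g e. g \<in> space topology_seq_space \<Longrightarrow> e \<in> active g \<Longrightarrow>
       integrable (\<kappa> g) (\<lambda>z. (z e)\<^sup>2) \<and> (\<integral>z. z e \<partial>\<kappa> g) = 0 \<and>
       prob_space.variance (\<kappa> g) (\<lambda>z. z e) \<le> v"
    "\<And>g. g \<in> space topology_seq_space \<Longrightarrow>
       rho_tilde (\<kappa> g) (active g) (noise_pos g) (\<lambda>e z. z e) m \<le> r"
    unfolding cond_A3_def topologies_def[abs_def] noises_def[abs_def] by blast
  have sq: "(\<integral>z. (z e)\<^sup>2 \<partial>\<kappa> g) \<le> max v 0"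
    if ge: "g \<in> space topology_seq_space" "e \<in> active g"
    for g :: "nat \<Rightarrow> 'n wdigraph" and e :: "nat \<times> 'n \<times> 'n"
  proof -
    have mean: "(\<integral>z. z e \<partial>\<kappa> g) = 0" and var: "prob_space.variance (\<kappa> g) (\<lambda>z. z e) \<le> v"
      using *(4)[OF ge] by blast+
    from var show ?thesis unfolding mean diff_0_right by linarith
  qed
  show ?thesis
    by (rule exI[of _ \<kappa>], rule exI[of _ "max v 0"], rule exI[of _ m], rule exI[of _ "max r 0"],
        intro conjI ballI sq)
      (use * in \<open>auto simp: le_max_iff_disj\<close>)
qed

lemma noise_kernel:
  assumes "regular_cond_distr M topology_seq_space topologies noise_space noises \<kappa>"
    and "g \<in> space topology_seq_space"
  shows "prob_space (\<kappa> g)"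
    and "\<And>e. e \<in> noise_index \<Longrightarrow> (\<lambda>z. z e) \<in> borel_measurable (\<kappa> g)"
proof -
  have "\<kappa> \<in> topology_seq_space \<rightarrow>\<^sub>M prob_algebra noise_space"
    using assms(1) by (simp add: regular_cond_distr_def)
  from measurable_space[OF this assms(2)] show "prob_space (\<kappa> g)" by (simp add: space_prob_algebra)
  from measurable_space[OF \<open>\<kappa> \<in> _\<close> assms(2)] have s: "sets (\<kappa> g) = sets noise_space"
    by (simp add: space_prob_algebra)
  show "(\<lambda>z. z e) \<in> borel_measurable (\<kappa> g)" if "e \<in> noise_index" for e
    using that unfolding measurable_cong_sets[OF s refl] noise_space_def
    by (rule measurable_component_singleton)
qed

text \<open>
  Given the topologies, the coefficients are constants and the noise is mixing with uniform constants,
  so the sum behaves like a sum of uncorrelated terms up to the constant \<open>C\<close>.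
\<close>

lemma noise_second_moment:
  obtains C where "0 \<le> C" and
    "\<And>J c. finite J \<Longrightarrow> J \<subseteq> noise_index \<Longrightarrow>
       (\<And>e. e \<in> J \<Longrightarrow> (\<lambda>g. c g e) \<in> borel_measurable topology_seq_space) \<Longrightarrow>
       (\<integral>\<^sup>+\<omega>. ennreal ((active_sum J c (topologies \<omega>) (noises \<omega>))\<^sup>2) \<partial>M)
         \<le> (\<integral>\<^sup>+\<omega>. ennreal (C * (\<Sum>e\<in>J \<inter> active (topologies \<omega>). (c (topologies \<omega>) e)\<^sup>2)) \<partial>M)"
proof -
  obtain \<kappa> v m r where law:
    "regular_cond_distr M topology_seq_space topologies noise_space noises \<kappa>"
    "0 \<le> v" "0 < m" "0 \<le> r" "r < 1"
    and per_edge: "\<And>g e. g \<in> space topology_seq_space \<Longrightarrow> e \<in> active g \<Longrightarrow>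
      integrable (\<kappa> g) (\<lambda>z. (z e)\<^sup>2) \<and> (\<integral>z. z e \<partial>\<kappa> g) = 0 \<and> (\<integral>z. (z e)\<^sup>2 \<partial>\<kappa> g) \<le> v"
    and mix: "\<And>g. g \<in> space topology_seq_space \<Longrightarrow>
      rho_tilde (\<kappa> g) (active g) (noise_pos g) (\<lambda>e z. z e) m \<le> r"
    using noise_law by blast
  define B where "B = real m * ((1 + r) / (1 - r))"
  have B: "0 \<le> B" using law by (simp add: B_def)
  show thesis
  proof (rule that[of "B * v"])
    show "0 \<le> B * v" using B law by simp
    fix J :: "(nat \<times> 'n \<times> 'n) set" and c :: "(nat \<Rightarrow> 'n wdigraph) \<Rightarrow> nat \<times> 'n \<times> 'n \<Rightarrow> real"
    assume J: "finite J" "J \<subseteq> noise_index"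
      and c: "\<And>e. e \<in> J \<Longrightarrow> (\<lambda>g. c g e) \<in> borel_measurable topology_seq_space"
    have inner: "(\<integral>\<^sup>+z. ennreal ((active_sum J c g z)\<^sup>2) \<partial>\<kappa> g)
        \<le> ennreal (B * v * (\<Sum>e\<in>J \<inter> active g. (c g e)\<^sup>2))"
      if g: "g \<in> space topology_seq_space" for g
    proof -
      note N = noise_kernel[OF law(1) g]
      have meas: "(\<lambda>z. z e) \<in> borel_measurable (\<kappa> g)" if "e \<in> active g" for e
        using N(2) that active_subset_noise_index by blast
      have sq: "integrable (\<kappa> g) (\<lambda>z. (\<Sum>e\<in>J \<inter> active g. c g e * z e)\<^sup>2)"
        using meas per_edge[OF g] by (intro integrable_sum_square) (auto simp: power_mult_distrib)
      have "active_sum J c g z = (\<Sum>e\<in>J \<inter> active g. c g e * z e)" for z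
        unfolding active_sum_def using J(1) by (rule sum.inter_restrict[symmetric])
      then have "(\<integral>\<^sup>+z. ennreal ((active_sum J c g z)\<^sup>2) \<partial>\<kappa> g)
          = ennreal (\<integral>z. (\<Sum>e\<in>J \<inter> active g. c g e * z e)\<^sup>2 \<partial>\<kappa> g)"
        using nn_integral_eq_integral[OF sq] by simp
      also have "(\<integral>z. (\<Sum>e\<in>J \<inter> active g. c g e * z e)\<^sup>2 \<partial>\<kappa> g)
          \<le> B * (\<Sum>e\<in>J \<inter> active g. (c g e)\<^sup>2 * (\<integral>z. (z e)\<^sup>2 \<partial>\<kappa> g))"
        unfolding B_def
      proof (rule rho_mixing_second_moment[where I="active g" and X="\<lambda>e z. z e" and pos="noise_pos g"])
        show "finite (J \<inter> active g)" using J by simp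
      qed (use N(1) meas per_edge[OF g] law(3-5) mix[OF g] inj_on_noise_pos in simp_all)
      also have "\<dots> \<le> B * (\<Sum>e\<in>J \<inter> active g. (c g e)\<^sup>2 * v)"
        using B per_edge[OF g] by (intro mult_left_mono sum_mono) auto
      also have "\<dots> = B * v * (\<Sum>e\<in>J \<inter> active g. (c g e)\<^sup>2)"
        by (simp add: sum_distrib_right[symmetric])
      finally show ?thesis by (simp add: ennreal_leI)
    qed
    have f: "(\<lambda>p. ennreal ((active_sum J c (fst p) (snd p))\<^sup>2))
        \<in> borel_measurable (topology_seq_space \<Otimes>\<^sub>M noise_space)"
      using measurable_active_sum[OF J c] by (simp add: split_beta)
    have top: "topologies \<omega> \<in> space topology_seq_space" if "\<omega> \<in> space M" for \<omega>
      using law(1) that by (auto simp: regular_cond_distr_def dest: measurable_space)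
    have "(\<integral>\<^sup>+\<omega>. ennreal ((active_sum J c (topologies \<omega>) (noises \<omega>))\<^sup>2) \<partial>M)
        = (\<integral>\<^sup>+\<omega>. (\<integral>\<^sup>+z. ennreal ((active_sum J c (topologies \<omega>) z)\<^sup>2) \<partial>\<kappa> (topologies \<omega>)) \<partial>M)"
      using regular_cond_distr_nn_integral[OF prob_space_axioms law(1) f] by simp
    also have "\<dots> \<le> (\<integral>\<^sup>+\<omega>. ennreal (B * v * (\<Sum>e\<in>J \<inter> active (topologies \<omega>). (c (topologies \<omega>) e)\<^sup>2)) \<partial>M)"
      by (rule nn_integral_mono) (intro inner top)
    finally show "(\<integral>\<^sup>+\<omega>. ennreal ((active_sum J c (topologies \<omega>) (noises \<omega>))\<^sup>2) \<partial>M)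
       \<le> (\<integral>\<^sup>+\<omega>. ennreal (B * v * (\<Sum>e\<in>J \<inter> active (topologies \<omega>). (c (topologies \<omega>) e)\<^sup>2)) \<partial>M)" .
  qed
qed

lemma measurable_active_sum_path:
  fixes c :: "(nat \<Rightarrow> 'n wdigraph) \<Rightarrow> nat \<times> 'n \<times> 'n \<Rightarrow> real"
  assumes "finite J" "J \<subseteq> noise_index"
    and "\<And>e. e \<in> J \<Longrightarrow> (\<lambda>g. c g e) \<in> borel_measurable topology_seq_space"
  shows "(\<lambda>\<omega>. active_sum J c (topologies \<omega>) (noises \<omega>)) \<in> borel_measurable M"
proof -
  obtain \<kappa> where "regular_cond_distr M topology_seq_space topologies noise_space noises \<kappa>"
    using noise_law by blast
  then have "(\<lambda>\<omega>. (topologies \<omega>, noises \<omega>)) \<in> M \<rightarrow>\<^sub>M topology_seq_space \<Otimes>\<^sub>M noise_space"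
    by (auto simp: regular_cond_distr_def)
  from measurable_compose[OF this measurable_active_sum[OF assms]] show ?thesis by simp
qed

lemma measurable_coeff_squares:
  fixes c :: "(nat \<Rightarrow> 'n wdigraph) \<Rightarrow> nat \<times> 'n \<times> 'n \<Rightarrow> real"
  assumes J: "finite J" "J \<subseteq> noise_index"
    and c: "\<And>e. e \<in> J \<Longrightarrow> (\<lambda>g. c g e) \<in> borel_measurable topology_seq_space"
  shows "(\<lambda>\<omega>. \<Sum>e\<in>J \<inter> active (topologies \<omega>). (c (topologies \<omega>) e)\<^sup>2) \<in> borel_measurable M"
proof -
  obtain \<kappa> where "regular_cond_distr M topology_seq_space topologies noise_space noises \<kappa>"
    using noise_law by blast
  then have top: "topologies \<in> M \<rightarrow>\<^sub>M topology_seq_space" by (simp add: regular_cond_distr_def)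
  have "(\<lambda>g. \<Sum>e\<in>J. if e \<in> active g then (c g e)\<^sup>2 else 0) \<in> borel_measurable topology_seq_space"
  proof (rule borel_measurable_sum)
    fix e assume e: "e \<in> J"
    then have "e \<in> noise_index" using J by auto
    from measurable_active[OF this] c[OF e]
    show "(\<lambda>g. if e \<in> active g then (c g e)\<^sup>2 else 0) \<in> borel_measurable topology_seq_space"
      by (intro measurable_If borel_measurable_power) (simp_all add: pred_def)
  qed
  from measurable_compose[OF top this] show ?thesis using J(1) by (simp add: sum.inter_restrict)
qed

text \<open>
  Given the topologies, the sum has mean zero.
\<close>

lemma expectation_active_sum_eq_0:
  fixes c :: "(nat \<Rightarrow> 'n wdigraph) \<Rightarrow> nat \<times> 'n \<times> 'n \<Rightarrow> real"
  assumes J: "finite J" "J \<subseteq> noise_index"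
    and c: "\<And>e. e \<in> J \<Longrightarrow> (\<lambda>g. c g e) \<in> borel_measurable topology_seq_space"
    and int: "integrable M (\<lambda>\<omega>. active_sum J c (topologies \<omega>) (noises \<omega>))"
  shows "expectation (\<lambda>\<omega>. active_sum J c (topologies \<omega>) (noises \<omega>)) = 0"
proof -
  obtain \<kappa> where law:
    "regular_cond_distr M topology_seq_space topologies noise_space noises \<kappa>"
    "\<And>g e. g \<in> space topology_seq_space \<Longrightarrow> e \<in> active g \<Longrightarrow> integrable (\<kappa> g) (\<lambda>z. (z e)\<^sup>2)"
    "\<And>g e. g \<in> space topology_seq_space \<Longrightarrow> e \<in> active g \<Longrightarrow> (\<integral>z. z e \<partial>\<kappa> g) = 0"
    using noise_law by blast
  have inner: "(\<integral>\<^sup>+z. ennreal (active_sum J c g z) \<partial>\<kappa> g) = (\<integral>\<^sup>+z. ennreal (- active_sum J c g z) \<partial>\<kappa> g)"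
    if g: "g \<in> space topology_seq_space" for g
  proof -
    interpret N: prob_space "\<kappa> g" by (rule noise_kernel[OF law(1) g])
    have int: "integrable (\<kappa> g) (\<lambda>z. if e \<in> active g then c g e * z e else 0)" for e
    proof (cases "e \<in> active g")
      case True
      then have "(\<lambda>z. z e) \<in> borel_measurable (\<kappa> g)"
        using noise_kernel(2)[OF law(1) g] active_subset_noise_index by blast
      from N.square_integrable_imp_integrable[OF this law(2)[OF g True]] show ?thesis
        using True by simp
    qed simp
    have zero: "(\<integral>z. (if e \<in> active g then c g e * z e else 0) \<partial>\<kappa> g) = 0" for e
      using law(3)[OF g, of e] by (cases "e \<in> active g") simp_all
    have "(\<integral>z. active_sum J c g z \<partial>\<kappa> g) = 0" "integrable (\<kappa> g) (active_sum J c g)"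
      unfolding active_sum_def[abs_def] using int zero by (simp_all add: Bochner_Integration.integral_sum)
    then show ?thesis using nn_integral_pos_eq_neg by blast
  qed
  have top: "topologies \<omega> \<in> space topology_seq_space" if "\<omega> \<in> space M" for \<omega>
    using law(1) that by (auto simp: regular_cond_distr_def dest: measurable_space)
  have [measurable]: "(\<lambda>p. active_sum J c (fst p) (snd p))
      \<in> borel_measurable (topology_seq_space \<Otimes>\<^sub>M noise_space)"
    using measurable_active_sum[OF J c] by (simp add: split_beta)
  have "(\<integral>\<^sup>+\<omega>. ennreal (active_sum J c (topologies \<omega>) (noises \<omega>)) \<partial>M)
      = (\<integral>\<^sup>+\<omega>. (\<integral>\<^sup>+z. ennreal (active_sum J c (topologies \<omega>) z) \<partial>\<kappa> (topologies \<omega>)) \<partial>M)"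
    using regular_cond_distr_nn_integral[OF prob_space_axioms law(1),
        of "\<lambda>p. ennreal (active_sum J c (fst p) (snd p))"] by simp
  also have "\<dots> = (\<integral>\<^sup>+\<omega>. (\<integral>\<^sup>+z. ennreal (- active_sum J c (topologies \<omega>) z) \<partial>\<kappa> (topologies \<omega>)) \<partial>M)"
    by (rule nn_integral_cong) (intro inner top)
  also have "\<dots> = (\<integral>\<^sup>+\<omega>. ennreal (- active_sum J c (topologies \<omega>) (noises \<omega>)) \<partial>M)"
    using regular_cond_distr_nn_integral[OF prob_space_axioms law(1),
        of "\<lambda>p. ennreal (- active_sum J c (fst p) (snd p))"] by simp
  finally show ?thesis using nn_integral_pos_eq_neg[OF int] by simp
qed

definition noise_input :: "nat \<Rightarrow> 'a \<Rightarrow> (real, 'n) vec" where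
  "noise_input t \<omega> = (\<chi> i. a t * (\<Sum>j\<in>neighbors (G t \<omega>) i. weight (G t \<omega>) i j * w t j i \<omega>))"

lemma state_step:
  assumes "1 \<le> t" "\<omega> \<in> space M"
  shows "x (t + 1) \<omega> = consensus_step (a t) (G t \<omega>) (x t \<omega>) + noise_input t \<omega>"
  using dynamics assms
  by (simp add: follows_dynamics_def vec_eq_iff consensus_step_def noise_input_def
      distrib_left sum.distrib)

lemma measurable_state: "1 \<le> t \<Longrightarrow> x t \<in> borel_measurable M"
proof (induction t rule: nat_induct_at_least)
  case base
  have "x 1 \<in> borel_measurable M \<longleftrightarrow> (\<lambda>_. x1) \<in> borel_measurable M"
    by (rule measurable_cong) (rule initial)
  then show ?case by simp
next
  case (Suc t)
  note [measurable] = measurable_edge[OF measurable_G[OF Suc.hyps]] measurable_weight[OF measurable_G[OF Suc.hyps]]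
    measurable_w[OF Suc.hyps]
  have [measurable]: "(\<lambda>\<omega>. x t \<omega> $ i) \<in> borel_measurable M" for i
    using Suc.IH unfolding borel_measurable_vec_iff by blast
  have "(\<lambda>\<omega>. consensus_step (a t) (G t \<omega>) (x t \<omega>) + noise_input t \<omega>) \<in> borel_measurable M"
    unfolding borel_measurable_vec_iff consensus_step_def noise_input_def sum_neighbors_eq by simp
  moreover have "x (Suc t) \<in> borel_measurable M \<longleftrightarrow>
      (\<lambda>\<omega>. consensus_step (a t) (G t \<omega>) (x t \<omega>) + noise_input t \<omega>) \<in> borel_measurable M"
    by (rule measurable_cong) (use state_step[OF Suc.hyps] in simp)
  ultimately show ?case by simp
qed

lemma active_sum_eq:
  assumes "1 \<le> m"
  shows "active_sum ({m..k} \<times> UNIV) c (topologies \<omega>) (noises \<omega>)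
    = (\<Sum>s=m..k. \<Sum>i\<in>UNIV. \<Sum>j\<in>neighbors (G s \<omega>) i. c (topologies \<omega>) (s, j, i) * w s j i \<omega>)"
proof -
  have "active_sum ({m..k} \<times> UNIV) c (topologies \<omega>) (noises \<omega>)
    = (\<Sum>s=m..k. \<Sum>e\<in>UNIV. if (s, e) \<in> active (topologies \<omega>) then c (topologies \<omega>) (s, e) * noises \<omega> (s, e) else 0)"
    unfolding active_sum_def sum.cartesian_product by (intro sum.cong) auto
  also have "\<dots> = (\<Sum>s=m..k. \<Sum>i\<in>UNIV. \<Sum>j\<in>neighbors (G s \<omega>) i. c (topologies \<omega>) (s, j, i) * w s j i \<omega>)"
  proof (rule sum.cong[OF refl])
    fix s assume "s \<in> {m..k}"
    then have s: "1 \<le> s" using assms by simp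
    have "(\<Sum>e\<in>UNIV. if (s, e) \<in> active (topologies \<omega>) then c (topologies \<omega>) (s, e) * noises \<omega> (s, e) else 0)
        = (\<Sum>j\<in>UNIV. \<Sum>i\<in>UNIV. if (j, i) \<in> fst (G s \<omega>) then c (topologies \<omega>) (s, j, i) * w s j i \<omega> else 0)"
      using s by (subst sum_UNIV_prod) (simp add: active_topologies noises_apply neighbors_def cong: if_cong)
    also have "\<dots> = (\<Sum>i\<in>UNIV. \<Sum>j\<in>neighbors (G s \<omega>) i. c (topologies \<omega>) (s, j, i) * w s j i \<omega>)"
      unfolding sum_neighbors_eq by (rule sum.swap)
    finally show "(\<Sum>e\<in>UNIV. if (s, e) \<in> active (topologies \<omega>) then c (topologies \<omega>) (s, e) * noises \<omega> (s, e) else 0)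
      = (\<Sum>i\<in>UNIV. \<Sum>j\<in>neighbors (G s \<omega>) i. c (topologies \<omega>) (s, j, i) * w s j i \<omega>)" .
  qed
  finally show ?thesis .
qed

lemma linear_noise_input:
  assumes "linear (L :: (real, 'n) vec \<Rightarrow> real)"
  shows "L (noise_input s \<omega>)
    = (\<Sum>i\<in>UNIV. \<Sum>j\<in>neighbors (G s \<omega>) i. a s * weight (G s \<omega>) i j * L (axis i 1) * w s j i \<omega>)"
proof -
  have "noise_input s \<omega> = (\<Sum>i\<in>UNIV. (noise_input s \<omega> $ i) *\<^sub>R axis i 1)"
    using basis_expansion[of "noise_input s \<omega>"] by (simp add: scalar_mult_eq_scaleR)
  then have "L (noise_input s \<omega>) = (\<Sum>i\<in>UNIV. (noise_input s \<omega> $ i) * L (axis i 1))"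
    using linear_sum[OF assms, of "\<lambda>i. (noise_input s \<omega> $ i) *\<^sub>R axis i 1" UNIV]
    by (simp only: linear_scale[OF assms] real_scaleR_def)
  then show ?thesis by (simp add: noise_input_def sum_distrib_left sum_distrib_right mult_ac)
qed

text \<open>
  The part of the state that is caused by the noise: each input \<open>noise_input s\<close> travels through the
  noise-free system from time \<open>s + 1\<close> on.
\<close>

definition noise_response :: "nat \<Rightarrow> 'a \<Rightarrow> (real, 'n) vec" where
  "noise_response k \<omega> = (\<Sum>s=1..k. flow a (\<lambda>t. G t \<omega>) (s + 1) (k - s) (noise_input s \<omega>))"

lemma state_eq:
  assumes "\<omega> \<in> space M"
  shows "x (Suc k) \<omega> = flow a (\<lambda>t. G t \<omega>) 1 k x1 + noise_response k \<omega>"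
  unfolding noise_response_def
  using variation_of_constants[of "\<lambda>t. x t \<omega>" a "\<lambda>t. G t \<omega>" "\<lambda>t. noise_input t \<omega>" k]
    state_step[OF _ assms] initial[OF assms] by simp

text \<open>
  The effect of the noise \<open>(s, j, i)\<close> on the deviation of agent \<open>l\<close> from the average at time \<open>k + 1\<close>.
\<close>

definition response_coeff ::
  "nat \<Rightarrow> 'n \<Rightarrow> (nat \<Rightarrow> 'n wdigraph) \<Rightarrow> nat \<times> 'n \<times> 'n \<Rightarrow> real" where
  "response_coeff k l g = (\<lambda>(s, j, i). a s * weight (g s) i j *
     (flow a g (s + 1) (k - s) (axis i 1) $ l - ave (flow a g (s + 1) (k - s) (axis i 1))))"

lemma noise_response_deviation:
  "noise_response k \<omega> $ l - ave (noise_response k \<omega>)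
     = active_sum ({1..k} \<times> UNIV) (response_coeff k l) (topologies \<omega>) (noises \<omega>)"
proof -
  let ?g = "\<lambda>t. G t \<omega>"
  let ?L = "\<lambda>s y. flow a ?g (s + 1) (k - s) y $ l - ave (flow a ?g (s + 1) (k - s) y)"
  have lin: "linear (?L s)" for s
    using linear_compose[OF linear_flow[of a ?g "s + 1" "k - s"] linear_deviation[of l]] by (simp add: o_def)
  have fl: "flow a (topologies \<omega>) (Suc s) m y = flow a ?g (Suc s) m y" for s m y
    by (rule flow_cong) (simp add: topologies_apply)
  have "noise_response k \<omega> $ l - ave (noise_response k \<omega>) = (\<Sum>s=1..k. ?L s (noise_input s \<omega>))"
    unfolding noise_response_def by (rule linear_sum[OF linear_deviation])
  also have "\<dots> = (\<Sum>s=1..k. \<Sum>i\<in>UNIV. \<Sum>j\<in>neighbors (G s \<omega>) i.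
      response_coeff k l (topologies \<omega>) (s, j, i) * w s j i \<omega>)"
    by (rule sum.cong[OF refl], subst linear_noise_input[OF lin])
      (simp add: response_coeff_def fl topologies_apply)
  finally show ?thesis by (simp add: active_sum_eq)
qed

lemma measurable_response_coeff:
  assumes "e \<in> {1..k} \<times> UNIV"
  shows "(\<lambda>g. response_coeff k l g e) \<in> borel_measurable topology_seq_space"
proof -
  obtain s j i where e: "e = (s, j, i)" by (cases e)
  have s: "1 \<le> s" using assms e by auto
  have comp: "(\<lambda>g :: nat \<Rightarrow> 'n wdigraph. g t) \<in> topology_seq_space \<rightarrow>\<^sub>M wdigraph_space" if "1 \<le> t" for t
    unfolding topology_seq_space_def using that by (intro measurable_component_singleton) auto
  have "(\<lambda>g. flow a (\<lambda>t. g t) (s + 1) (k - s) (axis i 1)) \<in> borel_measurable topology_seq_space"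
    by (rule measurable_flow) (simp add: comp)
  then have [measurable]: "(\<lambda>g. flow a g (s + 1) (k - s) (axis i 1) $ l) \<in> borel_measurable topology_seq_space" for l
    by (simp add: borel_measurable_vec_iff)
  note [measurable] = measurable_weight[OF comp[OF s]]
  show ?thesis unfolding e response_coeff_def ave_def prod.case by measurable
qed

lemma V_axis_le: "V (axis i 1 :: (real, 'n) vec) \<le> real CARD('n)"
  using V_le_spread[of "axis i 1 :: (real, 'n) vec" 1] by (simp add: axis_def)

lemma index_subset: "1 \<le> m \<Longrightarrow> {m..k} \<times> UNIV \<subseteq> noise_index"
  by (auto simp: noise_index_def)

lemma active_weight:
  assumes "\<omega> \<in> space M" "(s, j, i) \<in> active (topologies \<omega>)"
  shows "(weight (topologies \<omega> s) i j)\<^sup>2 \<le> amax\<^sup>2"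
proof -
  have "1 \<le> s" "j \<in> neighbors (G s \<omega>) i" using assms(2) by (simp_all add: active_topologies)
  moreover from this have "1 \<le> weight (G s \<omega>) i j" "weight (G s \<omega>) i j \<le> amax"
    using weights[OF _ assms(1)] by (auto simp: weights_within_def)
  ultimately show ?thesis by (simp add: topologies_apply power_mono)
qed

lemma sum_index_product:
  fixes f :: "nat \<Rightarrow> 'n \<Rightarrow> real"
  shows "(\<Sum>(s, j, i)\<in>{m..k} \<times> (UNIV :: ('n \<times> 'n) set). f s i) = real CARD('n) * (\<Sum>s=m..k. \<Sum>i\<in>UNIV. f s i)"
proof -
  have "(\<Sum>(s, j, i)\<in>{m..k} \<times> (UNIV :: ('n \<times> 'n) set). f s i)
      = (\<Sum>s=m..k. \<Sum>e\<in>(UNIV :: ('n \<times> 'n) set). f s (snd e))"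
    unfolding sum.cartesian_product by (intro sum.cong) auto
  then show ?thesis by (simp add: sum_UNIV_prod sum_distrib_left)
qed

text \<open>
  By \<open>noise_second_moment\<close> the contributions of the single noises add up in mean square.  The noise
  that agent \<open>i\<close> receives at time \<open>s\<close> contributes \<open>(a s)\<^sup>2\<close> times the expectation of \<open>V\<close> for the noise-free
  system started at the unit vector of \<open>i\<close>, and this decays like \<open>(s + 1) / (k + 1)\<close>.
\<close>

lemma expectation_V_noise_response:
  assumes decay: "\<And>s k y. 1 \<le> s \<Longrightarrow>
      real (s + k) * expectation (\<lambda>\<omega>. V (flow a (\<lambda>t. G t \<omega>) s k y)) \<le> D * real s * V y"
    and D: "0 \<le> D"
  obtains C where "0 \<le> C" "\<And>k. (\<integral>\<^sup>+\<omega>. ennreal (V (noise_response k \<omega>)) \<partial>M)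
      \<le> ennreal (C / real (Suc k) * (\<Sum>s=1..k. (a s)\<^sup>2 * real (s + 1)))"
proof -
  obtain C where C: "0 \<le> C" and moment: "\<And>J c. finite J \<Longrightarrow> J \<subseteq> noise_index \<Longrightarrow>
       (\<And>e. e \<in> J \<Longrightarrow> (\<lambda>g. c g e) \<in> borel_measurable topology_seq_space) \<Longrightarrow>
       (\<integral>\<^sup>+\<omega>. ennreal ((active_sum J c (topologies \<omega>) (noises \<omega>))\<^sup>2) \<partial>M)
         \<le> (\<integral>\<^sup>+\<omega>. ennreal (C * (\<Sum>e\<in>J \<inter> active (topologies \<omega>). (c (topologies \<omega>) e)\<^sup>2)) \<partial>M)"
    by (rule noise_second_moment) blast
  let ?n = "real CARD('n)"
  define B where "B = C * amax\<^sup>2 * ?n * ?n * D * ?n"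
  show thesis
  proof (rule that[of B])
    show "0 \<le> B" using C D by (simp add: B_def)
    fix k :: nat
    define J where "J = {1..k} \<times> (UNIV :: ('n \<times> 'n) set)"
    define Y where "Y s i \<omega> = flow a (\<lambda>t. G t \<omega>) (s + 1) (k - s) (axis i 1)" for s i \<omega>
    have J: "finite J" "J \<subseteq> noise_index" using index_subset[of 1 k] by (simp_all add: J_def)
    have meas: "(\<lambda>g. response_coeff k l g e) \<in> borel_measurable topology_seq_space" if "e \<in> J" for e l
      using that unfolding J_def by (rule measurable_response_coeff)
    have Ym [measurable]: "(\<lambda>\<omega>. V (Y s i \<omega>)) \<in> borel_measurable M" for s i
      unfolding Y_def by (intro measurable_V measurable_flow measurable_G) simp
    have Yb: "V (Y s i \<omega>) \<le> V (axis i 1 :: (real, 'n) vec)" if "\<omega> \<in> space M" for s i \<omega>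
      unfolding Y_def using that by (intro V_flow_le adm) auto
    have Yi: "integrable M (\<lambda>\<omega>. V (Y s i \<omega>))" for s i
      by (rule integrable_const_bound[where B="V (axis i 1 :: (real, 'n) vec)"]) (auto simp: V_nonneg Yb)
    have sq: "(\<Sum>l\<in>UNIV. \<Sum>e\<in>J \<inter> active (topologies \<omega>). (response_coeff k l (topologies \<omega>) e)\<^sup>2)
        \<le> (\<Sum>(s, j, i)\<in>J. amax\<^sup>2 * (a s)\<^sup>2 * V (Y s i \<omega>))" if \<omega>: "\<omega> \<in> space M" for \<omega>
    proof -
      have fl: "flow a (topologies \<omega>) (s + 1) (k - s) y = flow a (\<lambda>t. G t \<omega>) (s + 1) (k - s) y"
        for s and y :: "(real, 'n) vec"
        by (rule flow_cong) (simp add: topologies_apply)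
      have "(\<Sum>l\<in>UNIV. \<Sum>e\<in>J \<inter> active (topologies \<omega>). (response_coeff k l (topologies \<omega>) e)\<^sup>2)
          = (\<Sum>e\<in>J \<inter> active (topologies \<omega>). \<Sum>l\<in>UNIV. (response_coeff k l (topologies \<omega>) e)\<^sup>2)"
        by (rule sum.swap)
      also have "\<dots> \<le> (\<Sum>e\<in>J \<inter> active (topologies \<omega>). case e of (s, j, i) \<Rightarrow> amax\<^sup>2 * (a s)\<^sup>2 * V (Y s i \<omega>))"
      proof (rule sum_mono)
        fix e assume e: "e \<in> J \<inter> active (topologies \<omega>)"
        obtain s j i where sji: "e = (s, j, i)" by (cases e)
        have "(\<Sum>l\<in>UNIV. (response_coeff k l (topologies \<omega>) e)\<^sup>2)
            = (a s)\<^sup>2 * (weight (topologies \<omega> s) i j)\<^sup>2 * V (Y s i \<omega>)"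
          unfolding sji response_coeff_def Y_def V_def prod.case fl power_mult_distrib sum_distrib_left ..
        also have "\<dots> \<le> (a s)\<^sup>2 * amax\<^sup>2 * V (Y s i \<omega>)"
          using e sji active_weight[OF \<omega>] by (intro mult_right_mono mult_left_mono) (auto simp: V_nonneg)
        finally show "(\<Sum>l\<in>UNIV. (response_coeff k l (topologies \<omega>) e)\<^sup>2)
            \<le> (case e of (s, j, i) \<Rightarrow> amax\<^sup>2 * (a s)\<^sup>2 * V (Y s i \<omega>))"
          unfolding sji by (simp add: mult_ac)
      qed
      also have "\<dots> \<le> (\<Sum>e\<in>J. case e of (s, j, i) \<Rightarrow> amax\<^sup>2 * (a s)\<^sup>2 * V (Y s i \<omega>))"
        using J(1) by (intro sum_mono2) (auto simp: V_nonneg)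
      finally show ?thesis .
    qed
    have mean: "expectation (\<lambda>\<omega>. V (Y s i \<omega>)) \<le> D * real (s + 1) * ?n / real (Suc k)"
      if "s \<in> {1..k}" for s i
    proof -
      have "real (Suc k) * expectation (\<lambda>\<omega>. V (Y s i \<omega>)) \<le> D * real (s + 1) * V (axis i 1 :: (real, 'n) vec)"
        using decay[of "s + 1" "k - s" "axis i 1"] that unfolding Y_def by simp
      also have "\<dots> \<le> D * real (s + 1) * ?n"
        using D V_axis_le by (intro mult_left_mono) auto
      finally show ?thesis by (simp add: pos_le_divide_eq mult.commute)
    qed
    have ms: "(\<lambda>\<omega>. active_sum J (response_coeff k l) (topologies \<omega>) (noises \<omega>)) \<in> borel_measurable M" for l
      by (rule measurable_active_sum_path[OF J meas])
    have "(\<integral>\<^sup>+\<omega>. ennreal (V (noise_response k \<omega>)) \<partial>M)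
        = (\<integral>\<^sup>+\<omega>. (\<Sum>l\<in>UNIV. ennreal ((active_sum J (response_coeff k l) (topologies \<omega>) (noises \<omega>))\<^sup>2)) \<partial>M)"
      unfolding V_def noise_response_deviation J_def by (simp add: sum_ennreal)
    also have "\<dots> = (\<Sum>l\<in>UNIV. \<integral>\<^sup>+\<omega>. ennreal ((active_sum J (response_coeff k l) (topologies \<omega>) (noises \<omega>))\<^sup>2) \<partial>M)"
      using ms by (intro nn_integral_sum) auto
    also have "\<dots> \<le> (\<Sum>l\<in>UNIV. \<integral>\<^sup>+\<omega>. ennreal (C * (\<Sum>e\<in>J \<inter> active (topologies \<omega>). (response_coeff k l (topologies \<omega>) e)\<^sup>2)) \<partial>M)"
      by (intro sum_mono moment J meas)
    also have "\<dots> = (\<integral>\<^sup>+\<omega>. (\<Sum>l\<in>UNIV. ennreal (C * (\<Sum>e\<in>J \<inter> active (topologies \<omega>). (response_coeff k l (topologies \<omega>) e)\<^sup>2))) \<partial>M)"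
      using measurable_coeff_squares[OF J meas] by (intro nn_integral_sum[symmetric]) auto
    also have "\<dots> \<le> (\<integral>\<^sup>+\<omega>. ennreal (C * (\<Sum>(s, j, i)\<in>J. amax\<^sup>2 * (a s)\<^sup>2 * V (Y s i \<omega>))) \<partial>M)"
    proof (rule nn_integral_mono)
      fix \<omega> assume \<omega>: "\<omega> \<in> space M"
      show "(\<Sum>l\<in>UNIV. ennreal (C * (\<Sum>e\<in>J \<inter> active (topologies \<omega>). (response_coeff k l (topologies \<omega>) e)\<^sup>2)))
        \<le> ennreal (C * (\<Sum>(s, j, i)\<in>J. amax\<^sup>2 * (a s)\<^sup>2 * V (Y s i \<omega>)))"
        using sq[OF \<omega>] C
        by (subst sum_ennreal) (auto simp: sum_nonneg sum_distrib_left[symmetric] intro!: ennreal_leI mult_left_mono)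
    qed
    also have "\<dots> = ennreal (expectation (\<lambda>\<omega>. C * (\<Sum>(s, j, i)\<in>J. amax\<^sup>2 * (a s)\<^sup>2 * V (Y s i \<omega>))))"
      using Yi C by (intro nn_integral_eq_integral) (auto simp: split_beta V_nonneg intro!: AE_I2 mult_nonneg_nonneg sum_nonneg)
    also have "expectation (\<lambda>\<omega>. C * (\<Sum>(s, j, i)\<in>J. amax\<^sup>2 * (a s)\<^sup>2 * V (Y s i \<omega>)))
        = C * (\<Sum>(s, j, i)\<in>J. amax\<^sup>2 * (a s)\<^sup>2 * expectation (\<lambda>\<omega>. V (Y s i \<omega>)))"
      using Yi by (simp add: split_beta Bochner_Integration.integral_sum)
    also have "\<dots> \<le> C * (\<Sum>(s, j, i)\<in>J. amax\<^sup>2 * (a s)\<^sup>2 * (D * real (s + 1) * ?n / real (Suc k)))"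
    proof (intro mult_left_mono sum_mono C)
      fix e assume "e \<in> J"
      then obtain s j i where sji: "e = (s, j, i)" "s \<in> {1..k}" by (auto simp: J_def)
      show "(case e of (s, j, i) \<Rightarrow> amax\<^sup>2 * (a s)\<^sup>2 * expectation (\<lambda>\<omega>. V (Y s i \<omega>)))
        \<le> (case e of (s, j, i) \<Rightarrow> amax\<^sup>2 * (a s)\<^sup>2 * (D * real (s + 1) * ?n / real (Suc k)))"
        unfolding sji(1) prod.case using mean[OF sji(2)] by (intro mult_left_mono) auto
    qed
    also have "\<dots> = B / real (Suc k) * (\<Sum>s=1..k. (a s)\<^sup>2 * real (s + 1))"
      unfolding J_def sum_index_product[of "\<lambda>s i. amax\<^sup>2 * (a s)\<^sup>2 * (D * real (s + 1) * ?n / real (Suc k))"]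
      by (simp add: B_def sum_distrib_left sum_divide_distrib mult_ac)
    finally show "(\<integral>\<^sup>+\<omega>. ennreal (V (noise_response k \<omega>)) \<partial>M)
        \<le> ennreal (B / real (Suc k) * (\<Sum>s=1..k. (a s)\<^sup>2 * real (s + 1)))"
      by (simp add: ennreal_leI)
  qed
qed

end


section \<open>Rate and limit\<close>

text \<open>
  Comparison of the sum with the integral of \<open>t powr (b - 1)\<close>, one summand at a time.
\<close>

lemma sum_powr_le:
  fixes b :: real
  assumes "0 < b" "b \<le> 1"
  shows "(\<Sum>s=1..k. real s powr (b - 1)) \<le> real k powr b / b"
proof (induction k)
  case (Suc k)
  have "real (Suc k) powr (b - 1) * b \<le> real (Suc k) powr b - real k powr b"
  proof (cases "k = 0")
    case True
    then show ?thesis using assms by simp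
  next
    case False
    have "\<exists>z. real k < z \<and> z < real (Suc k) \<and>
        real (Suc k) powr b - real k powr b = (real (Suc k) - real k) * (b * z powr (b - 1))"
      using False by (intro MVT2) (auto intro!: derivative_eq_intros)
    then obtain z where z: "real k < z" "z < real (Suc k)"
      "real (Suc k) powr b - real k powr b = b * z powr (b - 1)" by auto
    have "real (Suc k) powr (b - 1) \<le> z powr (b - 1)"
      using z False assms by (intro powr_mono2') auto
    then show ?thesis using z(3) assms by (simp add: mult.commute)
  qed
  then have "real (Suc k) powr (b - 1) \<le> real (Suc k) powr b / b - real k powr b / b"
    using assms by (simp add: field_simps)
  then show ?case using Suc by simp
qed simp

context noisy_consensus
begin

text \<open>
  The noise-free part is \<open>O (1 / t)\<close>.  With \<open>(a s)\<^sup>2 = O (s powr (2 * \<mu> - 2))\<close> the noise part is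
  \<open>1 / t\<close> times a sum of \<open>s powr (2 * \<mu> - 1)\<close>, that is \<open>O (t powr (2 * \<mu> - 1))\<close>, and it dominates.
\<close>

lemma V_state_second_moment:
  assumes decay: "\<And>s k y. 1 \<le> s \<Longrightarrow>
      real (s + k) * expectation (\<lambda>\<omega>. V (flow a (\<lambda>t. G t \<omega>) s k y)) \<le> D * real s * V y"
    and D: "0 \<le> D"
    and gain: "\<And>t. 1 \<le> t \<Longrightarrow> a t \<le> A * real t powr (\<mu> - 1)" and A: "0 \<le> A"
    and \<mu>: "0 < \<mu>" "\<mu> < 1 / 2"
  obtains C where "0 \<le> C"
    "\<And>t. 1 \<le> t \<Longrightarrow> (\<integral>\<^sup>+\<omega>. ennreal (V (x t \<omega>)) \<partial>M) \<le> ennreal (C * real t powr (2 * \<mu> - 1))"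
proof -
  obtain C where C: "0 \<le> C" "\<And>k. (\<integral>\<^sup>+\<omega>. ennreal (V (noise_response k \<omega>)) \<partial>M)
      \<le> ennreal (C / real (Suc k) * (\<Sum>s=1..k. (a s)\<^sup>2 * real (s + 1)))"
    using expectation_V_noise_response[OF decay D] by blast
  define B where "B = C * (2 * A\<^sup>2 / (2 * \<mu>))"
  have B: "0 \<le> B" using C \<mu> by (simp add: B_def)
  obtain \<omega>0 where \<omega>0: "\<omega>0 \<in> space M" using not_empty by blast
  have a0: "0 \<le> a t" if "1 \<le> t" for t using adm[OF that \<omega>0] by (simp add: admissible_def)
  have gains: "(\<Sum>s=1..k. (a s)\<^sup>2 * real (s + 1)) \<le> 2 * A\<^sup>2 / (2 * \<mu>) * real (Suc k) powr (2 * \<mu>)" for k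
  proof -
    have "(\<Sum>s=1..k. (a s)\<^sup>2 * real (s + 1)) \<le> (\<Sum>s=1..k. 2 * A\<^sup>2 * real s powr (2 * \<mu> - 1))"
    proof (rule sum_mono)
      fix s assume "s \<in> {1..k}"
      then have s: "1 \<le> s" by simp
      have "(a s)\<^sup>2 * real (s + 1) \<le> (A * real s powr (\<mu> - 1))\<^sup>2 * (2 * real s)"
        using s a0[OF s] gain[OF s] by (intro mult_mono power_mono) auto
      also have "\<dots> = 2 * A\<^sup>2 * (real s powr (\<mu> - 1) * real s powr (\<mu> - 1) * real s powr 1)"
        using s by (simp add: power2_eq_square mult_ac)
      also have "real s powr (\<mu> - 1) * real s powr (\<mu> - 1) * real s powr 1 = real s powr (2 * \<mu> - 1)"
        unfolding powr_add[symmetric] by (simp add: algebra_simps)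
      finally show "(a s)\<^sup>2 * real (s + 1) \<le> 2 * A\<^sup>2 * real s powr (2 * \<mu> - 1)" .
    qed
    also have "\<dots> = 2 * A\<^sup>2 * (\<Sum>s=1..k. real s powr (2 * \<mu> - 1))" by (simp add: sum_distrib_left)
    also have "\<dots> \<le> 2 * A\<^sup>2 * (real k powr (2 * \<mu>) / (2 * \<mu>))"
      using \<mu> by (intro mult_left_mono sum_powr_le) auto
    also have "\<dots> \<le> 2 * A\<^sup>2 * (real (Suc k) powr (2 * \<mu>) / (2 * \<mu>))"
      using \<mu> by (intro mult_left_mono divide_right_mono powr_mono2) auto
    finally show ?thesis by simp
  qed
  have powr: "real (Suc k) powr (2 * \<mu>) / real (Suc k) = real (Suc k) powr (2 * \<mu> - 1)" for k
    by (simp add: powr_diff)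
  show thesis
  proof (rule that[of "2 * (D * V x1) + 2 * B"])
    show "0 \<le> 2 * (D * V x1) + 2 * B" using D B V_nonneg[of x1] by simp
    fix t :: nat assume "1 \<le> t"
    then obtain k where t: "t = Suc k" by (cases t) auto
    define Y where "Y \<omega> = flow a (\<lambda>t. G t \<omega>) 1 k x1" for \<omega>
    have Ym [measurable]: "(\<lambda>\<omega>. V (Y \<omega>)) \<in> borel_measurable M"
      unfolding Y_def by (intro measurable_V measurable_flow measurable_G) simp
    have Yb: "V (Y \<omega>) \<le> V x1" if "\<omega> \<in> space M" for \<omega>
      unfolding Y_def using that by (intro V_flow_le adm) auto
    have Yi: "integrable M (\<lambda>\<omega>. V (Y \<omega>))"
      by (rule integrable_const_bound[where B="V x1"]) (auto simp: V_nonneg Yb)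
    have p1: "1 / real (Suc k) \<le> real (Suc k) powr (2 * \<mu> - 1)"
      using \<mu> powr_mono[of "-1" "2 * \<mu> - 1" "real (Suc k)"] by (simp add: powr_minus_divide)
    have "real (Suc k) * expectation (\<lambda>\<omega>. V (Y \<omega>)) \<le> D * V x1" using decay[of 1 k x1] by (simp add: Y_def)
    then have "expectation (\<lambda>\<omega>. V (Y \<omega>)) \<le> D * V x1 * (1 / real (Suc k))"
      by (simp add: pos_le_divide_eq mult.commute)
    also have "\<dots> \<le> D * V x1 * real (Suc k) powr (2 * \<mu> - 1)"
      using p1 D V_nonneg[of x1] by (intro mult_left_mono) auto
    finally have free: "(\<integral>\<^sup>+\<omega>. ennreal (V (Y \<omega>)) \<partial>M) \<le> ennreal (D * V x1 * real (Suc k) powr (2 * \<mu> - 1))"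
      using nn_integral_eq_integral[OF Yi] by (simp add: V_nonneg ennreal_leI)
    have "C / real (Suc k) * (\<Sum>s=1..k. (a s)\<^sup>2 * real (s + 1))
        \<le> C / real (Suc k) * (2 * A\<^sup>2 / (2 * \<mu>) * real (Suc k) powr (2 * \<mu>))"
      using C by (intro mult_left_mono gains) auto
    also have "\<dots> = B * real (Suc k) powr (2 * \<mu> - 1)" unfolding B_def powr[symmetric] by (simp add: mult_ac)
    finally have noise: "(\<integral>\<^sup>+\<omega>. ennreal (V (noise_response k \<omega>)) \<partial>M)
        \<le> ennreal (B * real (Suc k) powr (2 * \<mu> - 1))"
      using C(2)[of k] ennreal_leI order.trans by blast
    have nm: "(\<lambda>\<omega>. V (noise_response k \<omega>)) \<in> borel_measurable M"
    proof -
      have "(\<lambda>\<omega>. \<Sum>l\<in>UNIV. (active_sum ({1..k} \<times> UNIV) (response_coeff k l) (topologies \<omega>) (noises \<omega>))\<^sup>2)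
          \<in> borel_measurable M"
        by (intro borel_measurable_sum borel_measurable_power measurable_active_sum_path
            measurable_response_coeff index_subset) auto
      then show ?thesis unfolding V_def noise_response_deviation .
    qed
    have "(\<integral>\<^sup>+\<omega>. ennreal (V (x t \<omega>)) \<partial>M)
        \<le> (\<integral>\<^sup>+\<omega>. 2 * ennreal (V (Y \<omega>)) + 2 * ennreal (V (noise_response k \<omega>)) \<partial>M)"
    proof (rule nn_integral_mono)
      fix \<omega> assume "\<omega> \<in> space M"
      then have "V (x t \<omega>) \<le> 2 * V (Y \<omega>) + 2 * V (noise_response k \<omega>)"
        using V_add_le[of "Y \<omega>" "noise_response k \<omega>"] unfolding t by (simp add: state_eq Y_def)
      then have "ennreal (V (x t \<omega>)) \<le> ennreal (2 * V (Y \<omega>) + 2 * V (noise_response k \<omega>))"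
        by (rule ennreal_leI)
      then show "ennreal (V (x t \<omega>)) \<le> 2 * ennreal (V (Y \<omega>)) + 2 * ennreal (V (noise_response k \<omega>))"
        by (simp add: V_nonneg ennreal_mult)
    qed
    also have "\<dots> = 2 * (\<integral>\<^sup>+\<omega>. ennreal (V (Y \<omega>)) \<partial>M) + 2 * (\<integral>\<^sup>+\<omega>. ennreal (V (noise_response k \<omega>)) \<partial>M)"
      using nm by (subst nn_integral_add) (auto simp: nn_integral_cmult)
    also have "\<dots> \<le> 2 * ennreal (D * V x1 * real (Suc k) powr (2 * \<mu> - 1)) + 2 * ennreal (B * real (Suc k) powr (2 * \<mu> - 1))"
      by (intro add_mono mult_left_mono free noise) auto
    also have "\<dots> = ennreal ((2 * (D * V x1) + 2 * B) * real t powr (2 * \<mu> - 1))"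
      using D B V_nonneg[of x1] unfolding t
      by (simp add: ennreal_mult'[symmetric] ennreal_plus[symmetric] distrib_right ennreal_numeral[symmetric] del: ennreal_numeral ennreal_plus)
    finally show "(\<integral>\<^sup>+\<omega>. ennreal (V (x t \<omega>)) \<partial>M)
        \<le> ennreal ((2 * (D * V x1) + 2 * B) * real t powr (2 * \<mu> - 1))" .
  qed
qed

text \<open>
  The effect of the noise \<open>(s, j, i)\<close> on the average, the same at all later times.
\<close>

definition average_coeff :: "(nat \<Rightarrow> 'n wdigraph) \<Rightarrow> nat \<times> 'n \<times> 'n \<Rightarrow> real" where
  "average_coeff g = (\<lambda>(s, j, i). a s * weight (g s) i j / real CARD('n))"

lemma linear_ave: "linear (ave :: (real, 'n) vec \<Rightarrow> real)"
  by (intro linearI) (simp_all add: ave_def sum.distrib sum_distrib_left sum_divide_distrib add_divide_distrib)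

text \<open>
  Since balanced topologies preserve the average, only the noise moves it.
\<close>

lemma ave_state_diff:
  assumes \<omega>: "\<omega> \<in> space M" and "k \<le> l"
  shows "ave (x (Suc l) \<omega>) - ave (x (Suc k) \<omega>)
    = active_sum ({Suc k..l} \<times> UNIV) average_coeff (topologies \<omega>) (noises \<omega>)"
proof -
  have step: "ave (x (Suc s) \<omega>) - ave (x s \<omega>)
      = (\<Sum>i\<in>UNIV. \<Sum>j\<in>neighbors (G s \<omega>) i. average_coeff (topologies \<omega>) (s, j, i) * w s j i \<omega>)"
    if s: "1 \<le> s" for s
  proof -
    have "balanced (G s \<omega>)" using adm[OF s \<omega>] by (simp add: admissible_def)
    then have "ave (x (Suc s) \<omega>) - ave (x s \<omega>) = ave (noise_input s \<omega>)"
      using state_step[OF s \<omega>] by (simp add: linear_add[OF linear_ave] ave_consensus_step)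
    also have "\<dots> = (\<Sum>i\<in>UNIV. \<Sum>j\<in>neighbors (G s \<omega>) i. a s * weight (G s \<omega>) i j * ave (axis i 1 :: (real, 'n) vec) * w s j i \<omega>)"
      by (rule linear_noise_input[OF linear_ave])
    also have "\<dots> = (\<Sum>i\<in>UNIV. \<Sum>j\<in>neighbors (G s \<omega>) i. average_coeff (topologies \<omega>) (s, j, i) * w s j i \<omega>)"
      using s by (simp add: average_coeff_def topologies_apply ave_def axis_def)
    finally show ?thesis .
  qed
  have "ave (x (Suc l) \<omega>) - ave (x (Suc k) \<omega>) = (\<Sum>s=Suc k..l. ave (x (Suc s) \<omega>) - ave (x s \<omega>))"
    using assms(2) sum_Suc_diff[of "Suc k" l "\<lambda>s. ave (x s \<omega>)"] by simp
  also have "\<dots> = (\<Sum>s=Suc k..l. \<Sum>i\<in>UNIV. \<Sum>j\<in>neighbors (G s \<omega>) i. average_coeff (topologies \<omega>) (s, j, i) * w s j i \<omega>)"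
    by (intro sum.cong step) auto
  finally show ?thesis by (simp add: active_sum_eq)
qed

lemma measurable_average_coeff:
  assumes "1 \<le> m" "e \<in> {m..k} \<times> UNIV"
  shows "(\<lambda>g. average_coeff g e) \<in> borel_measurable topology_seq_space"
proof -
  obtain s j i where e: "e = (s, j, i)" by (cases e)
  have s: "1 \<le> s" using assms e by auto
  have "(\<lambda>g :: nat \<Rightarrow> 'n wdigraph. g s) \<in> topology_seq_space \<rightarrow>\<^sub>M wdigraph_space"
    unfolding topology_seq_space_def using s by (intro measurable_component_singleton) auto
  note [measurable] = measurable_weight[OF this]
  show ?thesis unfolding e average_coeff_def prod.case by measurable
qed

lemma measurable_ave_state [measurable]: "(\<lambda>\<omega>. ave (x (Suc k) \<omega>)) \<in> borel_measurable M"
proof -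
  have "(\<lambda>\<omega>. x (Suc k) \<omega> $ i) \<in> borel_measurable M" for i
    using measurable_state[of "Suc k"] unfolding borel_measurable_vec_iff by simp
  then show ?thesis unfolding ave_def by (intro borel_measurable_times borel_measurable_sum) auto
qed

text \<open>
  The noise of time \<open>s\<close> enters the average with coefficients of order \<open>a s\<close>, so by
  \<open>noise_second_moment\<close> the increments are controlled by sums of squared gains.
\<close>

lemma ave_increment_second_moment:
  obtains C where "0 \<le> C"
    "\<And>k l. k \<le> l \<Longrightarrow> integrable M (\<lambda>\<omega>. (ave (x (Suc l) \<omega>) - ave (x (Suc k) \<omega>))\<^sup>2)"
    "\<And>k l. k \<le> l \<Longrightarrow> expectation (\<lambda>\<omega>. (ave (x (Suc l) \<omega>) - ave (x (Suc k) \<omega>))\<^sup>2)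
      \<le> C * (\<Sum>s=Suc k..l. (a s)\<^sup>2)"
proof -
  obtain C where C: "0 \<le> C" and moment: "\<And>J c. finite J \<Longrightarrow> J \<subseteq> noise_index \<Longrightarrow>
       (\<And>e. e \<in> J \<Longrightarrow> (\<lambda>g. c g e) \<in> borel_measurable topology_seq_space) \<Longrightarrow>
       (\<integral>\<^sup>+\<omega>. ennreal ((active_sum J c (topologies \<omega>) (noises \<omega>))\<^sup>2) \<partial>M)
         \<le> (\<integral>\<^sup>+\<omega>. ennreal (C * (\<Sum>e\<in>J \<inter> active (topologies \<omega>). (c (topologies \<omega>) e)\<^sup>2)) \<partial>M)"
    by (rule noise_second_moment) blast
  let ?n = "real CARD('n)"
  have bound: "(\<integral>\<^sup>+\<omega>. ennreal ((ave (x (Suc l) \<omega>) - ave (x (Suc k) \<omega>))\<^sup>2) \<partial>M)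
      \<le> ennreal (C * amax\<^sup>2 * (\<Sum>s=Suc k..l. (a s)\<^sup>2))" if kl: "k \<le> l" for k l
  proof -
    define J where "J = {Suc k..l} \<times> (UNIV :: ('n \<times> 'n) set)"
    have J: "finite J" "J \<subseteq> noise_index" using index_subset[of "Suc k" l] by (simp_all add: J_def)
    have "(\<integral>\<^sup>+\<omega>. ennreal ((ave (x (Suc l) \<omega>) - ave (x (Suc k) \<omega>))\<^sup>2) \<partial>M)
        = (\<integral>\<^sup>+\<omega>. ennreal ((active_sum J average_coeff (topologies \<omega>) (noises \<omega>))\<^sup>2) \<partial>M)"
      by (rule nn_integral_cong) (simp add: ave_state_diff[OF _ kl] J_def)
    also have "\<dots> \<le> (\<integral>\<^sup>+\<omega>. ennreal (C * (\<Sum>e\<in>J \<inter> active (topologies \<omega>). (average_coeff (topologies \<omega>) e)\<^sup>2)) \<partial>M)"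
      by (rule moment[OF J]) (auto simp: J_def intro!: measurable_average_coeff[of "Suc k" _ l])
    also have "\<dots> \<le> (\<integral>\<^sup>+\<omega>. ennreal (C * amax\<^sup>2 * (\<Sum>s=Suc k..l. (a s)\<^sup>2)) \<partial>M)"
    proof (intro nn_integral_mono ennreal_leI)
      fix \<omega> assume \<omega>: "\<omega> \<in> space M"
      have "(\<Sum>e\<in>J \<inter> active (topologies \<omega>). (average_coeff (topologies \<omega>) e)\<^sup>2)
          \<le> (\<Sum>e\<in>J \<inter> active (topologies \<omega>). case e of (s, j, i) \<Rightarrow> (a s)\<^sup>2 * amax\<^sup>2 / ?n\<^sup>2)"
      proof (rule sum_mono)
        fix e assume e: "e \<in> J \<inter> active (topologies \<omega>)"
        obtain s j i where sji: "e = (s, j, i)" by (cases e)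
        have "(average_coeff (topologies \<omega>) e)\<^sup>2 = (a s)\<^sup>2 * (weight (topologies \<omega> s) i j)\<^sup>2 / ?n\<^sup>2"
          by (simp add: sji average_coeff_def power_mult_distrib power_divide)
        also have "\<dots> \<le> (a s)\<^sup>2 * amax\<^sup>2 / ?n\<^sup>2"
          using e sji active_weight[OF \<omega>] by (intro divide_right_mono mult_left_mono) auto
        finally show "(average_coeff (topologies \<omega>) e)\<^sup>2 \<le> (case e of (s, j, i) \<Rightarrow> (a s)\<^sup>2 * amax\<^sup>2 / ?n\<^sup>2)"
          by (simp add: sji)
      qed
      also have "\<dots> \<le> (\<Sum>(s, j, i)\<in>J. (a s)\<^sup>2 * amax\<^sup>2 / ?n\<^sup>2)"
        using J(1) by (intro sum_mono2) auto
      also have "\<dots> = ?n * (\<Sum>s=Suc k..l. ?n * ((a s)\<^sup>2 * amax\<^sup>2 / ?n\<^sup>2))"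
        unfolding J_def sum_index_product[of "\<lambda>s i. (a s)\<^sup>2 * amax\<^sup>2 / ?n\<^sup>2"] by simp
      also have "\<dots> = amax\<^sup>2 * (\<Sum>s=Suc k..l. (a s)\<^sup>2)"
        by (simp add: sum_distrib_left power2_eq_square mult_ac)
      finally show "C * (\<Sum>e\<in>J \<inter> active (topologies \<omega>). (average_coeff (topologies \<omega>) e)\<^sup>2)
          \<le> C * amax\<^sup>2 * (\<Sum>s=Suc k..l. (a s)\<^sup>2)"
        using C by (simp add: mult_left_mono mult.assoc)
    qed
    also have "\<dots> = ennreal (C * amax\<^sup>2 * (\<Sum>s=Suc k..l. (a s)\<^sup>2))" by (simp add: emeasure_space_1)
    finally show ?thesis .
  qed
  have int: "integrable M (\<lambda>\<omega>. (ave (x (Suc l) \<omega>) - ave (x (Suc k) \<omega>))\<^sup>2)" if "k \<le> l" for k l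
    using bound[OF that] by (intro integrableI_bounded) (auto simp: le_less_trans[OF _ ennreal_less_top])
  show thesis
  proof (rule that[of "C * amax\<^sup>2"])
    show "0 \<le> C * amax\<^sup>2" using C by simp
    fix k l :: nat assume kl: "k \<le> l"
    show "integrable M (\<lambda>\<omega>. (ave (x (Suc l) \<omega>) - ave (x (Suc k) \<omega>))\<^sup>2)" by (rule int[OF kl])
    have "0 \<le> C * amax\<^sup>2 * (\<Sum>s=Suc k..l. (a s)\<^sup>2)" using C by (simp add: sum_nonneg)
    then show "expectation (\<lambda>\<omega>. (ave (x (Suc l) \<omega>) - ave (x (Suc k) \<omega>))\<^sup>2)
        \<le> C * amax\<^sup>2 * (\<Sum>s=Suc k..l. (a s)\<^sup>2)"
      using bound[OF kl] by (subst (asm) nn_integral_eq_integral[OF int[OF kl]]) auto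
  qed
qed

lemma expectation_ave_state: "integrable M (\<lambda>\<omega>. ave (x (Suc k) \<omega>))"
  "expectation (\<lambda>\<omega>. ave (x (Suc k) \<omega>)) = ave x1"
proof -
  define J where "J = {1..k} \<times> (UNIV :: ('n \<times> 'n) set)"
  define S where "S \<omega> = active_sum J average_coeff (topologies \<omega>) (noises \<omega>)" for \<omega>
  have J: "finite J" "J \<subseteq> noise_index" using index_subset[of 1 k] by (simp_all add: J_def)
  have meas: "(\<lambda>g. average_coeff g e) \<in> borel_measurable topology_seq_space" if "e \<in> J" for e
    using that unfolding J_def by (intro measurable_average_coeff[of 1]) auto
  have eq: "ave (x (Suc k) \<omega>) = ave x1 + S \<omega>" if "\<omega> \<in> space M" for \<omega>
    using ave_state_diff[OF that, of 0 k] initial[OF that] by (simp add: S_def J_def)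
  obtain C where "integrable M (\<lambda>\<omega>. (ave (x (Suc k) \<omega>) - ave (x (Suc 0) \<omega>))\<^sup>2)"
    by (rule ave_increment_second_moment) blast
  also have "?this \<longleftrightarrow> integrable M (\<lambda>\<omega>. (S \<omega>)\<^sup>2)"
    using eq initial by (intro Bochner_Integration.integrable_cong) auto
  finally have sq: "integrable M (\<lambda>\<omega>. (S \<omega>)\<^sup>2)" .
  have Sm: "S \<in> borel_measurable M"
    unfolding S_def[abs_def] by (rule measurable_active_sum_path[OF J meas])
  have int: "integrable M S" by (rule square_integrable_imp_integrable[OF Sm sq])
  have zero: "expectation S = 0"
  proof -
    have "S = (\<lambda>\<omega>. active_sum J average_coeff (topologies \<omega>) (noises \<omega>))"
      by (simp add: S_def fun_eq_iff)
    then show ?thesis using expectation_active_sum_eq_0[OF J meas] int by simp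
  qed
  have "integrable M (\<lambda>\<omega>. ave (x (Suc k) \<omega>)) \<longleftrightarrow> integrable M (\<lambda>\<omega>. ave x1 + S \<omega>)"
    by (intro Bochner_Integration.integrable_cong) (auto simp: eq)
  then show "integrable M (\<lambda>\<omega>. ave (x (Suc k) \<omega>))" using int by simp
  have "expectation (\<lambda>\<omega>. ave (x (Suc k) \<omega>)) = expectation (\<lambda>\<omega>. ave x1 + S \<omega>)"
    by (intro Bochner_Integration.integral_cong) (auto simp: eq)
  then show "expectation (\<lambda>\<omega>. ave (x (Suc k) \<omega>)) = ave x1" using int zero by (simp add: prob_space)
qed

text \<open>
  The increments of the average after time \<open>k\<close> are bounded in mean square by the tail of a
  convergent series, so the averages converge in \<open>L\<^sup>2\<close>; the mean is the same at all times.
\<close>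

lemma average_limit:
  assumes "summable (\<lambda>s. (a s)\<^sup>2)"
  obtains Z \<epsilon> where "Z \<in> borel_measurable M" "integrable M Z" "integrable M (\<lambda>\<omega>. (Z \<omega>)\<^sup>2)"
    "expectation Z = ave x1" "\<epsilon> \<longlonglongrightarrow> 0"
    "\<And>k. (\<integral>\<^sup>+\<omega>. ennreal ((ave (x (Suc k) \<omega>) - Z \<omega>)\<^sup>2) \<partial>M) \<le> ennreal (\<epsilon> k)"
proof -
  obtain C where C: "0 \<le> C"
    "\<And>k l. k \<le> l \<Longrightarrow> integrable M (\<lambda>\<omega>. (ave (x (Suc l) \<omega>) - ave (x (Suc k) \<omega>))\<^sup>2)"
    "\<And>k l. k \<le> l \<Longrightarrow> expectation (\<lambda>\<omega>. (ave (x (Suc l) \<omega>) - ave (x (Suc k) \<omega>))\<^sup>2)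
      \<le> C * (\<Sum>s=Suc k..l. (a s)\<^sup>2)"
    by (rule ave_increment_second_moment) blast
  \<comment> \<open>The sum starts at \<open>0\<close>, but only differences of partial sums matter.\<close>
  define \<epsilon> where "\<epsilon> k = C * ((\<Sum>s. (a s)\<^sup>2) - (\<Sum>s\<le>k. (a s)\<^sup>2))" for k
  have "(\<lambda>k. \<Sum>s\<le>k. (a s)\<^sup>2) \<longlonglongrightarrow> (\<Sum>s. (a s)\<^sup>2)"
    using assms by (simp add: summable_LIMSEQ')
  then have "(\<lambda>k. C * ((\<Sum>s. (a s)\<^sup>2) - (\<Sum>s\<le>k. (a s)\<^sup>2))) \<longlonglongrightarrow> C * ((\<Sum>s. (a s)\<^sup>2) - (\<Sum>s. (a s)\<^sup>2))"
    by (intro tendsto_intros)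
  then have \<epsilon>: "\<epsilon> \<longlonglongrightarrow> 0" by (simp add: \<epsilon>_def[abs_def])
  have incr: "expectation (\<lambda>\<omega>. (ave (x (Suc l) \<omega>) - ave (x (Suc k) \<omega>))\<^sup>2) \<le> \<epsilon> k" if "k \<le> l" for k l
  proof -
    have "(\<Sum>s\<le>k. (a s)\<^sup>2) + (\<Sum>s=Suc k..l. (a s)\<^sup>2) = (\<Sum>s\<le>l. (a s)\<^sup>2)"
    proof -
      have "{..l} = {..k} \<union> {Suc k..l}" using that by auto
      then show ?thesis by (simp add: sum.union_disjoint)
    qed
    also have "\<dots> \<le> (\<Sum>s. (a s)\<^sup>2)" by (intro sum_le_suminf assms) auto
    finally have "C * (\<Sum>s=Suc k..l. (a s)\<^sup>2) \<le> \<epsilon> k"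
      unfolding \<epsilon>_def using C(1) by (intro mult_left_mono) auto
    then show ?thesis using C(3)[OF that] by linarith
  qed
  have sq: "integrable M (\<lambda>\<omega>. (ave (x (Suc k) \<omega>))\<^sup>2)" for k
  proof -
    have "integrable M (\<lambda>\<omega>. ((ave (x (Suc k) \<omega>) - ave (x (Suc 0) \<omega>)) + ave x1)\<^sup>2)"
      using C(2)[of 0 k] by (intro integrable_add_square) auto
    moreover have "integrable M (\<lambda>\<omega>. ((ave (x (Suc k) \<omega>) - ave (x (Suc 0) \<omega>)) + ave x1)\<^sup>2)
        \<longleftrightarrow> integrable M (\<lambda>\<omega>. (ave (x (Suc k) \<omega>))\<^sup>2)"
      using initial by (intro Bochner_Integration.integrable_cong) auto
    ultimately show ?thesis by simp
  qed
  obtain Z where Z: "Z \<in> borel_measurable M" "integrable M Z" "integrable M (\<lambda>\<omega>. (Z \<omega>)\<^sup>2)"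
    "\<And>k. (\<integral>\<^sup>+\<omega>. ennreal ((ave (x (Suc k) \<omega>) - Z \<omega>)\<^sup>2) \<partial>M) \<le> ennreal (\<epsilon> k)"
    "(\<lambda>k. expectation (\<lambda>\<omega>. ave (x (Suc k) \<omega>))) \<longlonglongrightarrow> expectation Z"
    using L2_limit_exists[OF prob_space_axioms measurable_ave_state sq incr \<epsilon>] by blast
  have "expectation Z = ave x1"
    using Z(5) unfolding expectation_ave_state(2) by (simp add: LIMSEQ_const_iff)
  then show thesis using that Z \<epsilon> by blast
qed

text \<open>
  The squared distance to consensus splits orthogonally into \<open>V\<close> and the error of the average.
\<close>

lemma consensus:
  assumes summable: "summable (\<lambda>s. (a s)\<^sup>2)"
    and V: "\<And>t. 1 \<le> t \<Longrightarrow> (\<integral>\<^sup>+\<omega>. ennreal (V (x t \<omega>)) \<partial>M) \<le> ennreal (C * real t powr (2 * \<mu> - 1))"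
    and \<mu>: "\<mu> < 1 / 2" and C: "0 \<le> C"
  shows "unbiased_ms_average_consensus M x x1 \<and>
    (\<forall>t\<ge>1. integrable M (\<lambda>\<omega>. V (x t \<omega>))) \<and>
    (\<lambda>t. expectation (\<lambda>\<omega>. V (x t \<omega>))) \<in> O(\<lambda>t. 1 / real t powr (1 - 2 * \<mu>))"
proof -
  let ?n = "real CARD('n)"
  obtain Z \<epsilon> where Z: "Z \<in> borel_measurable M" "integrable M Z" "integrable M (\<lambda>\<omega>. (Z \<omega>)\<^sup>2)"
    "expectation Z = ave x1" and \<epsilon>: "\<epsilon> \<longlonglongrightarrow> 0"
    "\<And>k. (\<integral>\<^sup>+\<omega>. ennreal ((ave (x (Suc k) \<omega>) - Z \<omega>)\<^sup>2) \<partial>M) \<le> ennreal (\<epsilon> k)"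
    by (rule average_limit[OF summable]) blast
  note [measurable] = Z(1)
  have Vm [measurable]: "(\<lambda>\<omega>. V (x t \<omega>)) \<in> borel_measurable M" if "1 \<le> t" for t
    by (rule measurable_V[OF measurable_state[OF that]])
  have int: "integrable M (\<lambda>\<omega>. V (x t \<omega>))" if "1 \<le> t" for t
    using V[OF that] Vm[OF that]
    by (intro integrableI_bounded) (auto simp: V_nonneg le_less_trans[OF _ ennreal_less_top])
  have EV: "expectation (\<lambda>\<omega>. V (x t \<omega>)) \<le> C * real t powr (2 * \<mu> - 1)" if "1 \<le> t" for t
    using V[OF that] C by (subst (asm) nn_integral_eq_integral[OF int[OF that]]) (auto simp: V_nonneg)
  have rate: "(\<lambda>t. expectation (\<lambda>\<omega>. V (x t \<omega>))) \<in> O(\<lambda>t. 1 / real t powr (1 - 2 * \<mu>))"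
  proof (rule bigoI[where c=C])
    have "norm (expectation (\<lambda>\<omega>. V (x t \<omega>))) \<le> C * norm (1 / real t powr (1 - 2 * \<mu>))" if "1 \<le> t" for t
    proof -
      have "1 / real t powr (1 - 2 * \<mu>) = real t powr (2 * \<mu> - 1)"
        using powr_minus_divide[of "real t" "1 - 2 * \<mu>"] by simp
      then show ?thesis using EV[OF that] by (simp add: V_nonneg)
    qed
    then show "\<forall>\<^sub>F t in sequentially. norm (expectation (\<lambda>\<omega>. V (x t \<omega>))) \<le> C * norm (1 / real t powr (1 - 2 * \<mu>))"
      unfolding eventually_sequentially by blast
  qed
  have conv: "(\<lambda>t. \<integral>\<^sup>+\<omega>. ennreal ((norm (x t \<omega> - (\<chi> i. Z \<omega>)))\<^sup>2) \<partial>M) \<longlonglongrightarrow> 0"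
  proof (rule LIMSEQ_imp_Suc, rule tendsto_sandwich[where f="\<lambda>_. 0"])
    have "(\<integral>\<^sup>+\<omega>. ennreal ((norm (x (Suc k) \<omega> - (\<chi> i. Z \<omega>)))\<^sup>2) \<partial>M)
        \<le> ennreal (C * real (Suc k) powr (2 * \<mu> - 1)) + ennreal ?n * ennreal (\<epsilon> k)" for k
    proof -
      have "(\<integral>\<^sup>+\<omega>. ennreal ((norm (x (Suc k) \<omega> - (\<chi> i. Z \<omega>)))\<^sup>2) \<partial>M)
          = (\<integral>\<^sup>+\<omega>. ennreal (V (x (Suc k) \<omega>)) + ennreal ?n * ennreal ((ave (x (Suc k) \<omega>) - Z \<omega>)\<^sup>2) \<partial>M)"
        unfolding norm_diff_const_square
        by (intro nn_integral_cong) (simp add: V_nonneg ennreal_mult')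
      also have "\<dots> = (\<integral>\<^sup>+\<omega>. ennreal (V (x (Suc k) \<omega>)) \<partial>M) + ennreal ?n * (\<integral>\<^sup>+\<omega>. ennreal ((ave (x (Suc k) \<omega>) - Z \<omega>)\<^sup>2) \<partial>M)"
        using Vm[of "Suc k"] by (subst nn_integral_add) (auto simp: nn_integral_cmult)
      also have "\<dots> \<le> ennreal (C * real (Suc k) powr (2 * \<mu> - 1)) + ennreal ?n * ennreal (\<epsilon> k)"
        by (intro add_mono mult_left_mono V \<epsilon>(2)) auto
      finally show ?thesis .
    qed
    then show "\<forall>\<^sub>F k in sequentially. (\<integral>\<^sup>+\<omega>. ennreal ((norm (x (Suc k) \<omega> - (\<chi> i. Z \<omega>)))\<^sup>2) \<partial>M)
        \<le> ennreal (C * real (Suc k) powr (2 * \<mu> - 1)) + ennreal ?n * ennreal (\<epsilon> k)" by simp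
    have "(\<lambda>t. real (Suc t) powr (2 * \<mu> - 1)) \<longlonglongrightarrow> 0"
      using \<mu> by (intro LIMSEQ_Suc tendsto_neg_powr filterlim_real_sequentially) auto
    then have "(\<lambda>k. ennreal (C * real (Suc k) powr (2 * \<mu> - 1)) + ennreal ?n * ennreal (\<epsilon> k))
        \<longlonglongrightarrow> ennreal (C * 0) + ennreal ?n * ennreal 0"
      by (intro tendsto_add tendsto_ennrealI tendsto_mult_left ennreal_tendsto_cmult \<epsilon>(1)) auto
    then show "(\<lambda>k. ennreal (C * real (Suc k) powr (2 * \<mu> - 1)) + ennreal ?n * ennreal (\<epsilon> k)) \<longlonglongrightarrow> 0"
      by simp
  qed auto
  have "ms_consensus_to M x Z"
    unfolding ms_consensus_to_def using Z measurable_state conv by blast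
  then have "unbiased_ms_average_consensus M x x1"
    unfolding unbiased_ms_average_consensus_def using Z(4) by blast
  then show ?thesis using int rate by blast
qed

end


section \<open>The gain\<close>

lemma V_eq_0_if_single_agent:
  fixes y :: "real ^ ('n::finite)"
  assumes "CARD('n) = 1"
  shows "V y = 0"
proof -
  have "u = v" for u v :: 'n using assms by (metis card_1_singletonE UNIV_I singletonD)
  then have "\<bar>y $ u - y $ v\<bar> \<le> 0" for u v by (metis diff_self abs_zero order_refl)
  then have "V y \<le> real CARD('n) * 0\<^sup>2" by (rule V_le_spread)
  then show ?thesis using V_nonneg[of y] by simp
qed

text \<open>
  Without edges the connectivity event of (A1') would be empty, although for \<open>t = 2\<close> the lower bound
  on its conditional probability is positive.  The existence of an edge is what makes \<open>amax\<close> at least \<open>1\<close>.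
\<close>

lemma edge_exists_if_cond_A1':
  fixes G :: "nat \<Rightarrow> 'a \<Rightarrow> ('n::finite) wdigraph"
  assumes "prob_space M" and G: "\<And>t. 1 \<le> t \<Longrightarrow> G t \<in> M \<rightarrow>\<^sub>M wdigraph_space"
    and A1: "cond_A1' M G K \<mu> p" and n: "CARD('n) \<noteq> 1"
  shows "\<exists>\<omega>\<in>space M. \<exists>t\<ge>1. \<exists>i j. j \<in> neighbors (G t \<omega>) i"
proof (rule ccontr)
  assume "\<not> ?thesis"
  then have empty: "fst (G t \<omega>) = {}" if "\<omega> \<in> space M" "1 \<le> t" for t \<omega>
    using that by (auto simp: neighbors_def)
  interpret prob_space M by fact
  define F where "F = generated_by M wdigraph_space G {1..<2}"
  interpret finite_measure_subalgebra M F
    unfolding F_def by unfold_locales (rule subalgebra_generated_by, use G in auto)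
  obtain u v :: 'n where uv: "u \<noteq> v"
  proof -
    have "\<exists>u v :: 'n. u \<noteq> v"
    proof (rule ccontr)
      assume "\<not> (\<exists>u v :: 'n. u \<noteq> v)"
      then have "(UNIV :: 'n set) = {undefined}" by auto
      then show False using n by (metis card.empty card_insert_disjoint empty_iff finite.emptyI One_nat_def)
    qed
    then show thesis using that by blast
  qed
  have never: "{\<omega>' \<in> space M. strongly_connected_edges (\<Union>t'\<in>{2..2 + K - 1}. fst (G t' \<omega>'))} = {}"
  proof -
    have "\<not> strongly_connected_edges (\<Union>t'\<in>{2..2 + K - 1}. fst (G t' \<omega>))" if "\<omega> \<in> space M" for \<omega>
      using uv empty[OF that] by (auto simp: strongly_connected_edges_def)
    then show ?thesis by blast
  qed
  have "\<forall>t\<ge>1. AE \<omega> in M. real_cond_exp M (generated_by M wdigraph_space G {1..<t})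
      (indicator {\<omega>' \<in> space M. strongly_connected_edges (\<Union>t'\<in>{t..t + K - 1}. fst (G t' \<omega>'))}) \<omega>
      \<ge> p * real t powr (-\<mu>) * ln (real t)"
    using A1 unfolding cond_A1'_def by blast
  from this[rule_format, of 2]
  have "AE \<omega> in M. real_cond_exp M F (indicator {}) \<omega> \<ge> p * real 2 powr (-\<mu>) * ln (real 2)"
    unfolding never F_def by simp
  moreover have "indicator {} = (\<lambda>_ :: 'a. 0 :: real)" by (simp add: fun_eq_iff)
  ultimately have "AE \<omega> in M. real_cond_exp M F (\<lambda>_. 0) \<omega> \<ge> p * 2 powr (-\<mu>) * ln 2"
    by simp
  moreover have "AE \<omega> in M. real_cond_exp M F (\<lambda>_. 0) \<omega> = 0"
    by (rule real_cond_exp_F_meas) auto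
  ultimately have "AE \<omega> in M. p * 2 powr (-\<mu>) * ln 2 \<le> 0"
    by eventually_elim simp
  moreover have "0 < p * 2 powr (-\<mu>) * ln 2" using A1 by (simp add: cond_A1'_def)
  ultimately have "AE \<omega> in M. False" by simp
  then show False by simp
qed

lemma degree_le:
  fixes g :: "('n::finite) wdigraph"
  assumes "weights_within amax g" "0 \<le> amax"
  shows "(\<Sum>j\<in>neighbors g i - {i}. weight g i j) \<le> (real CARD('n) - 1) * amax"
proof -
  have "(\<Sum>j\<in>neighbors g i - {i}. weight g i j) \<le> (\<Sum>j\<in>neighbors g i - {i}. amax)"
    using assms(1) by (intro sum_mono) (auto simp: weights_within_def)
  also have "\<dots> \<le> (\<Sum>j\<in>UNIV - {i}. amax)"
    using assms(2) by (intro sum_mono2) auto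
  also have "\<dots> = (real CARD('n) - 1) * amax" by (simp add: card_Diff_singleton of_nat_diff)
  finally show ?thesis .
qed

theorem theorem5p1:
  fixes M :: "'a measure"
    and G :: "nat \<Rightarrow> 'a \<Rightarrow> ('n::{finite,linorder}) wdigraph"
    and w :: "nat \<Rightarrow> 'n \<Rightarrow> 'n \<Rightarrow> 'a \<Rightarrow> real"
    and x :: "nat \<Rightarrow> 'a \<Rightarrow> real ^ ('n::{finite,linorder})"
    and x1 :: "real ^ ('n::{finite,linorder})"
    and K :: nat
    and \<mu> p amax \<alpha> tstar c n :: real
  assumes "prob_space M"
    and "n = real CARD('n)"
    and "\<And>t. 1 \<le> t \<Longrightarrow> G t \<in> M \<rightarrow>\<^sub>M wdigraph_space"
    and "\<And>t j i. 1 \<le> t \<Longrightarrow> w t j i \<in> borel_measurable M"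
    and "\<And>t \<omega>. 1 \<le> t \<Longrightarrow> \<omega> \<in> space M \<Longrightarrow> weights_within amax (G t \<omega>)"
    and "cond_A1' M G K \<mu> p"
    and "cond_A2 M G"
    and "cond_A3 M G w"
    and "c \<ge> 1"
    and "\<alpha> \<ge> 32 * n * (n - 1) ^ 4 * c / (2 * n - 3)\<^sup>2"
    and "tstar \<ge> of_int \<lfloor>2 * \<alpha> * (n - 1) * amax\<rfloor>"
    and "\<And>\<omega>. \<omega> \<in> space M \<Longrightarrow> x 1 \<omega> = x1"
    and "follows_dynamics M G w (\<lambda>t. \<alpha> / (real t powr (1 - \<mu>) + tstar)) x"
  shows "unbiased_ms_average_consensus M x x1 \<and>
         (\<forall>t\<ge>1. integrable M (\<lambda>\<omega>. V (x t \<omega>))) \<and>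
         (\<lambda>t. prob_space.expectation M (\<lambda>\<omega>. V (x t \<omega>)))
           \<in> O(\<lambda>t. 1 / real t powr (1 - 2 * \<mu>))"
proof -
  interpret prob_space M by fact
  define a where "a t = \<alpha> / (real t powr (1 - \<mu>) + tstar)" for t
  have \<mu>: "0 < \<mu>" "\<mu> < 1 / 2" using assms(6) by (simp_all add: cond_A1'_def)
  have n1: "1 \<le> n"
  proof -
    have "1 \<le> CARD('n)" using zero_less_card_finite[where 'a='n] by linarith
    then show ?thesis unfolding assms(2) by linarith
  qed
  have n2: "2 \<le> n" if "CARD('n) \<noteq> 1"
  proof -
    have "2 \<le> CARD('n)" using that zero_less_card_finite[where 'a='n] by linarith
    then show ?thesis unfolding assms(2) by linarith
  qed
  have \<alpha>0: "0 \<le> \<alpha>"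
  proof -
    have "0 \<le> 32 * n * (n - 1) ^ 4 * c / (2 * n - 3)\<^sup>2" using n1 assms(9) by simp
    then show ?thesis using assms(10) by linarith
  qed
  have \<alpha>pos: "0 < \<alpha>" if "CARD('n) \<noteq> 1"
  proof -
    have "0 < 32 * n * (n - 1) ^ 4 * c / (2 * n - 3)\<^sup>2" using n2[OF that] assms(9) by simp
    then show ?thesis using assms(10) by linarith
  qed
  have amax: "0 \<le> amax" if n: "CARD('n) \<noteq> 1"
  proof -
    obtain \<omega> t i j where "\<omega> \<in> space M" "1 \<le> t" "j \<in> neighbors (G t \<omega>) i"
      using edge_exists_if_cond_A1'[OF assms(1,3,6) n] by blast
    then show ?thesis using assms(5)[of t \<omega>] by (force simp: weights_within_def)
  qed
  have deg0: "0 \<le> 2 * \<alpha> * (n - 1) * amax"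
  proof (cases "CARD('n) = 1")
    case True
    then show ?thesis using assms(2) by simp
  next
    case False
    then show ?thesis using amax \<alpha>0 n1 by simp
  qed
  \<comment> \<open>The \<open>1\<close> comes from \<open>t powr (1 - \<mu>) \<ge> 1\<close> and compensates for the rounding in the bound on \<open>tstar\<close>.\<close>
  have tstar: "0 \<le> tstar" "2 * \<alpha> * (n - 1) * amax \<le> 1 + tstar"
  proof -
    have "0 \<le> \<lfloor>2 * \<alpha> * (n - 1) * amax\<rfloor>" using deg0 by simp
    then have "(0::real) \<le> of_int \<lfloor>2 * \<alpha> * (n - 1) * amax\<rfloor>" by linarith
    then show "0 \<le> tstar" using assms(11) by linarith
    show "2 * \<alpha> * (n - 1) * amax \<le> 1 + tstar" using assms(11) by linarith
  qed
  have powr1: "1 \<le> real t powr (1 - \<mu>)" if "1 \<le> t" for t :: nat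
    using that \<mu> by (intro ge_one_powr_ge_zero) auto
  have inv: "real t powr (\<mu> - 1) = 1 / real t powr (1 - \<mu>)" for t :: nat
    using powr_minus_divide[of "real t" "1 - \<mu>"] by simp
  have a_nonneg: "0 \<le> a t" for t using \<alpha>0 tstar by (simp add: a_def)
  have a_upper: "a t \<le> \<alpha> * real t powr (\<mu> - 1)" if "1 \<le> t" for t
  proof -
    have "\<alpha> / (real t powr (1 - \<mu>) + tstar) \<le> \<alpha> / real t powr (1 - \<mu>)"
      using powr1[OF that] \<alpha>0 tstar(1) by (intro divide_left_mono mult_pos_pos) linarith+
    then show ?thesis unfolding a_def inv by simp
  qed
  have a_lower: "\<alpha> / (1 + tstar) * real t powr (\<mu> - 1) \<le> a t" if "1 \<le> t" for t
  proof -
    have "real t powr (1 - \<mu>) + tstar \<le> real t powr (1 - \<mu>) * (1 + tstar)"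
      using powr1[OF that] tstar mult_right_mono[of 1 "real t powr (1 - \<mu>)" tstar] by (simp add: distrib_left)
    then have "\<alpha> / (real t powr (1 - \<mu>) * (1 + tstar)) \<le> \<alpha> / (real t powr (1 - \<mu>) + tstar)"
      using \<alpha>0 tstar powr1[OF that] by (intro divide_left_mono) auto
    then show ?thesis unfolding a_def inv by (simp add: mult.commute)
  qed
  have adm: "admissible (a t) (G t \<omega>)" if t: "1 \<le> t" and \<omega>: "\<omega> \<in> space M" for t \<omega>
    unfolding admissible_def
  proof (intro conjI allI ballI)
    show "0 \<le> a t" by (rule a_nonneg)
    show "balanced (G t \<omega>)" using assms(7) t \<omega> by (simp add: cond_A2_def)
    show "1 \<le> weight (G t \<omega>) i j" if "j \<in> neighbors (G t \<omega>) i" for i j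
      using assms(5)[OF t \<omega>] that by (simp add: weights_within_def)
    fix i
    let ?d = "\<Sum>j\<in>neighbors (G t \<omega>) i - {i}. weight (G t \<omega>) i j"
    have d: "?d \<le> (n - 1) * amax"
    proof (cases "CARD('n) = 1")
      case True
      then have "j = i" for j by (metis card_1_singletonE UNIV_I singletonD)
      then have no_other: "neighbors (G t \<omega>) i - {i} = {}" by blast
      show ?thesis unfolding no_other using True assms(2) by simp
    next
      case False
      then show ?thesis using degree_le[OF assms(5)[OF t \<omega>] amax] assms(2) by simp
    qed
    have "a t \<le> \<alpha> / (1 + tstar)"
      unfolding a_def using \<alpha>0 tstar powr1[OF t] by (intro divide_left_mono) auto
    have "a t * ?d \<le> a t * ((n - 1) * amax)" using d a_nonneg by (rule mult_left_mono)
    also have "\<dots> \<le> \<alpha> / (1 + tstar) * ((n - 1) * amax)"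
    proof (cases "CARD('n) = 1")
      case True
      then show ?thesis using assms(2) by simp
    next
      case False
      then show ?thesis using \<open>a t \<le> _\<close> amax n1 by (intro mult_right_mono) auto
    qed
    also have "\<dots> \<le> 1 / 2" using tstar by (simp add: field_simps)
    finally show "a t * ?d \<le> 1 / 2" .
  qed
  interpret noisy_consensus M G w a amax x x1
    using assms(3-5,8,12,13) adm by unfold_locales (auto simp: a_def[abs_def])
  have "\<exists>D\<ge>0. \<forall>s\<ge>1. \<forall>k y.
     real (s + k) * expectation (\<lambda>\<omega>. V (flow a (\<lambda>t. G t \<omega>) s k y)) \<le> D * real s * V y"
  proof (cases "CARD('n) = 1")
    case True
    then show ?thesis by (intro exI[of _ 0]) (simp add: V_eq_0_if_single_agent)
  next
    case False
    then have "0 < \<alpha> / (1 + tstar)" using \<alpha>pos tstar by simp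
    from expectation_V_flow_decay[OF assms(1,3) adm assms(6) this a_lower]
    show ?thesis by simp
  qed
  then obtain D where D: "0 \<le> D"
    "\<And>s k y. 1 \<le> s \<Longrightarrow> real (s + k) * expectation (\<lambda>\<omega>. V (flow a (\<lambda>t. G t \<omega>) s k y)) \<le> D * real s * V y"
    by blast
  obtain C where C: "0 \<le> C"
    "\<And>t. 1 \<le> t \<Longrightarrow> (\<integral>\<^sup>+\<omega>. ennreal (V (x t \<omega>)) \<partial>M) \<le> ennreal (C * real t powr (2 * \<mu> - 1))"
    using V_state_second_moment[OF D(2,1) a_upper \<alpha>0 \<mu>] by blast
  have "summable (\<lambda>t. (a t)\<^sup>2)"
  proof (rule summable_comparison_test')
    have "summable (\<lambda>t. real t powr (2 * \<mu> - 2))" using \<mu> by (simp add: summable_real_powr_iff)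
    then show "summable (\<lambda>t. \<alpha>\<^sup>2 * real t powr (2 * \<mu> - 2))" by (rule summable_mult)
    fix t :: nat assume t: "1 \<le> t"
    have "(a t)\<^sup>2 \<le> (\<alpha> * real t powr (\<mu> - 1))\<^sup>2" using a_upper[OF t] a_nonneg by (rule power_mono)
    also have "\<dots> = \<alpha>\<^sup>2 * (real t powr (\<mu> - 1) * real t powr (\<mu> - 1))"
      by (simp add: power2_eq_square)
    also have "real t powr (\<mu> - 1) * real t powr (\<mu> - 1) = real t powr (2 * \<mu> - 2)"
      unfolding powr_add[symmetric] by (simp add: algebra_simps)
    finally show "norm ((a t)\<^sup>2) \<le> \<alpha>\<^sup>2 * real t powr (2 * \<mu> - 2)" by simp
  qed
  from consensus[OF this C(2) \<mu>(2) C(1)] show ?thesis .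
qed

end
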